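(* Let $c$ be a proper transportation cost, $\rho>0$ and $\hat P\in\mathcal P_c(X)$. Let $\mathcal W_\infty=\overline{\operatorname{conv}}^{w}\{P^{\otimes\infty}:P\in\mathbb B^c_\rho(\hat P)\}\subseteq\mathcal P(X^\infty)$ and $\hat{\mathcal W}_\infty=\{\bar P\in\mathcal P_{\mathrm{sym}}(X^\infty): (\mathrm{pr}_{1:M})_\#\bar P\in\mathbb B^{c^M}_{M\rho}(\hat P^{\otimes M})\ \forall M\in\mathbb N\}$. Then $$\mathcal W_\infty=\Big\{\int P^{\otimes\infty}d\nu(P):\ \nu\in\mathcal P(\mathcal P(X)),\ W_c(\hat P,P)\le\rho\ \text{for }\nu\text{-a.e. }P\Big\},$$ $$\hat{\mathcal W}_\infty=\Big\{\int P^{\otimes\infty}d\nu(P):\ \nu\in\mathcal P(\mathcal P(X)),\ \int W_c(\hat P,P)\,d\nu(P)\le\rho\Big\}.$$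
   Context: $X$ nonempty Polish; $\mathcal P(Y)$ denotes the Borel probability measures on a Polish $Y$, with the weak topology; $\overline{\operatorname{conv}}^{w}$ is the closed convex hull in that topology. $X^\infty$ carries the product topology; $\mathrm{pr}_{1:M}$ is the projection onto the first $M$ coordinates; $\mathcal P_{\mathrm{sym}}(X^\infty)$ is the set of measures invariant under every permutation of coordinates fixing all but finitely many indices. A transportation cost is lower semi-continuous, symmetric, $c(x,x)=0$; proper means $c(x,y)\le K(c(x,z)+c(z,y))$ for some $K>0$ and compact sublevel sets $\{x:c(x_0,x)\le r\}$. $\mathcal P_c(X)$ = measures with finite $c$-moment; $W_c$ the optimal transport cost; $\mathbb B^c_\rho(\hat P)=\{P\in\mathcal P_c(X):W_c(P,\hat P)\le\rho\}$; $c^M(x,y)=\sum_{i\le M}c(x_i,y_i)$ and $\mathbb B^{c^M}_{M\rho}(\hat P^{\otimes M})$ the analogous ball on $X^M$. For $\nu\in\mathcal P(\mathcal P(X))$, $\int P^{\otimes\infty}d\nu(P)$ is the measure $A\mapsto\int P^{\otimes\infty}(A)\,d\nu(P)$. *)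

theory Defs
  imports "HOL-Analysis.Analysis" "HOL-Probability.Probability"
begin

definition lsc_cost :: "('a::topological_space \<Rightarrow> 'a \<Rightarrow> real) \<Rightarrow> bool" where
  "lsc_cost c \<longleftrightarrow> (\<forall>t. open {p :: 'a \<times> 'a. t < c (fst p) (snd p)})"

definition transport_cost :: "('a::topological_space \<Rightarrow> 'a \<Rightarrow> real) \<Rightarrow> bool" where
  "transport_cost c \<longleftrightarrow> (\<forall>x y. 0 \<le> c x y) \<and> lsc_cost c \<and> (\<forall>x y. c x y = c y x) \<and> (\<forall>x. c x x = 0)"

definition proper_cost :: "('a::topological_space \<Rightarrow> 'a \<Rightarrow> real) \<Rightarrow> bool" where
  "proper_cost c \<longleftrightarrow> transport_cost c
     \<and> (\<exists>K>0. \<forall>x y z. c x y \<le> K * (c x z + c z y))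
     \<and> (\<forall>x0 r. compact {x. c x0 x \<le> r})"

definition probs :: "'b measure \<Rightarrow> 'b measure set" where
  "probs S = {P. prob_space P \<and> sets P = sets S}"

definition couplings :: "'b measure \<Rightarrow> 'b measure \<Rightarrow> 'b measure \<Rightarrow> ('b \<times> 'b) measure set" where
  "couplings S P Q = {\<pi>. prob_space \<pi> \<and> sets \<pi> = sets (S \<Otimes>\<^sub>M S)
       \<and> distr \<pi> S fst = P \<and> distr \<pi> S snd = Q}"

definition Wc :: "'b measure \<Rightarrow> ('b \<Rightarrow> 'b \<Rightarrow> real) \<Rightarrow> 'b measure \<Rightarrow> 'b measure \<Rightarrow> ennreal" where
  "Wc S c P Q = (INF \<pi>\<in>couplings S P Q. \<integral>\<^sup>+ z. ennreal (c (fst z) (snd z)) \<partial>\<pi>)"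

definition Pc :: "'b measure \<Rightarrow> ('b \<Rightarrow> 'b \<Rightarrow> real) \<Rightarrow> 'b measure set" where
  "Pc S c = {P \<in> probs S. \<exists>x0\<in>space S. (\<integral>\<^sup>+ x. ennreal (c x0 x) \<partial>P) < \<infinity>}"

definition Wball :: "'b measure \<Rightarrow> ('b \<Rightarrow> 'b \<Rightarrow> real) \<Rightarrow> real \<Rightarrow> 'b measure \<Rightarrow> 'b measure set" where
  "Wball S c \<rho> Phat = {P \<in> Pc S c. Wc S c P Phat \<le> ennreal \<rho>}"

definition weak_topo :: "'b::topological_space measure \<Rightarrow> 'b measure topology" where
  "weak_topo S = topology_generated_by
     {{P \<in> probs S. (\<integral>x. f x \<partial>P) \<in> U} | (f :: 'b \<Rightarrow> real) U.
        continuous_on UNIV f \<and> bounded (range f) \<and> open U}"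

definition mix_fin :: "'b measure \<Rightarrow> nat set \<Rightarrow> (nat \<Rightarrow> real) \<Rightarrow> (nat \<Rightarrow> 'b measure) \<Rightarrow> 'b measure" where
  "mix_fin S I a Q = measure_of (space S) (sets S) (\<lambda>B. \<Sum>i\<in>I. ennreal (a i) * emeasure (Q i) B)"

definition conv_meas :: "'b measure \<Rightarrow> 'b measure set \<Rightarrow> 'b measure set" where
  "conv_meas S A = {mix_fin S I a Q | I a Q. finite I \<and> I \<noteq> {} \<and>
      (\<forall>i\<in>I. 0 \<le> a i \<and> Q i \<in> A) \<and> sum a I = 1}"

definition closed_conv_weak :: "'b::topological_space measure \<Rightarrow> 'b measure set \<Rightarrow> 'b measure set" where
  "closed_conv_weak S A = weak_topo S closure_of conv_meas S A"

abbreviation Xinf :: "'a::topological_space measure \<Rightarrow> (nat \<Rightarrow> 'a) measure" where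
  "Xinf X \<equiv> PiM (UNIV :: nat set) (\<lambda>_. X)"

abbreviation iid :: "'a measure \<Rightarrow> (nat \<Rightarrow> 'a) measure" where
  "iid P \<equiv> PiM (UNIV :: nat set) (\<lambda>_. P)"

definition mix_iid :: "'a::topological_space measure measure \<Rightarrow> (nat \<Rightarrow> 'a) measure" where
  "mix_iid \<nu> = measure_of (space (Xinf (borel :: 'a measure))) (sets (Xinf (borel :: 'a measure)))
      (\<lambda>A. \<integral>\<^sup>+ P. emeasure (iid P) A \<partial>\<nu>)"

definition Psym :: "(nat \<Rightarrow> 'a) measure \<Rightarrow> (nat \<Rightarrow> 'a) measure set" where
  "Psym S = {Q \<in> probs S. \<forall>\<sigma>::nat \<Rightarrow> nat. bij \<sigma> \<and> finite {i. \<sigma> i \<noteq> i} \<longrightarrow>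
      distr Q S (\<lambda>x. x \<circ> \<sigma>) = Q}"

abbreviation XM :: "nat \<Rightarrow> 'a measure \<Rightarrow> (nat \<Rightarrow> 'a) measure" where
  "XM M X \<equiv> PiM {..<M} (\<lambda>_. X)"

definition costM :: "nat \<Rightarrow> ('a \<Rightarrow> 'a \<Rightarrow> real) \<Rightarrow> (nat \<Rightarrow> 'a) \<Rightarrow> (nat \<Rightarrow> 'a) \<Rightarrow> real" where
  "costM M c x y = (\<Sum>i<M. c (x i) (y i))"

definition prM :: "nat \<Rightarrow> (nat \<Rightarrow> 'a) \<Rightarrow> (nat \<Rightarrow> 'a)" where
  "prM M x = restrict x {..<M}"

end

(*
Kantorovich duality reduces both inclusions to integrals of test functions. The cost is the supremum of
countably many functions a * 1_U(x) * 1_V(y) with U, V basic open sets; for finitely many of them optimal transport is a finite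
linear programme, whose potentials take finitely many values and may be taken rational. A sequence of finite
optimal plans is coded by binary digits as laws on the Cantor set in the real line, where Helly's theorem gives a limit,
and the limit is decoded into a coupling. So W_c(P, Q) is a supremum of countably many expressions
(int phi dP) + (int psi dQ) with psi lower semicontinuous; in particular it is measurable in Q.

A measure on X^oo is exchangeable iff it is a mixture of i.i.d. laws (de Finetti: second moments give almost
sure convergence of empirical averages, and exchangeability lets each coordinate be replaced by its limit average).

First identity: exchangeability and the bounds int prod_{i<k} (g(x_i) + B) <= r^k, for continuous g <= psi, pass
to weak limits, and letting k tend to infinity they bound the essential supremum of P |-> int g dP. Conversely a mixture is
approximated by grouping the mixing measure according to the values of finitely many test integrals.

Second identity: test the optimal coupling of the M-marginals with the maximum of finitely many averaged dual
pairs; the law of large numbers on the Phat side and Jensen's inequality on the other give the bound as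
M tends to infinity. Conversely, apply duality on X^oo to the cost c^M and use W_{c^M}(P^oo, Phat^oo) <= M W_c(P, Phat).
*)
theory Submission
  imports Defs
begin

subsection \<open>Finite transport plans and binary coding\<close>

text \<open>Couplings are obtained without Prokhorov's theorem on \<open>'a\<close>: after coding,
  all laws sit on [0, 1], where tightness is free, and a measurable left inverse of the code brings
  the limit back. Only the second potential has to be lower semicontinuous, since only the second
  measure is moved by weak limits; the first potential is merely Borel. Testing with one coordinate
  would bound just the mean, over the mixing measure, of the integral of \<psi>. A product over k
  coordinates integrates under an i.i.d. law to a k-th power, and the k-th moments see the essential
  supremum. In the second identity the dual pair that is nearly optimal for P varies with P, and
  testing one pair at a time would only bound a supremum of means. Taking the maximum over pairs
  inside the integral, at empirical averages, recovers the mean of the supremum. Functions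
  restricted to \<open>{..<M}\<close> do not form a Polish type, so duality for \<open>costM\<close>
  is applied to whole sequences, and the marginals are reached by pushing couplings forward.\<close>

lemma compact_box_fun: "compact {w :: 'z \<Rightarrow> real. \<forall>z. 0 \<le> w z \<and> w z \<le> B}"
proof -
  have "compactin (product_topology (\<lambda>_::'z. euclidean :: real topology) UNIV) (PiE UNIV (\<lambda>_. {0..B}))"
    by (subst compactin_PiE) auto
  then have "compact (PiE UNIV (\<lambda>_::'z. {0..B}))"
    by (simp add: euclidean_product_topology)
  also have "PiE UNIV (\<lambda>_::'z. {0..B}) = {w. \<forall>z. 0 \<le> w z \<and> w z \<le> B}"
    by (auto simp: PiE_iff)
  finally show ?thesis .
qed

text \<open>The hypothesis controls the one-sided derivative at 0 of a quadratic. It turns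
  minimality along a segment of a convex set into a first-order condition.\<close>

lemma nonneg_if_quadratic_nonneg:
  fixes A B :: real
  assumes "\<And>t. 0 < t \<Longrightarrow> t \<le> 1 \<Longrightarrow> 0 \<le> 2 * t * A + t^2 * B"
  shows "0 \<le> A"
proof (rule ccontr)
  assume "\<not> 0 \<le> A"
  \<comment> \<open>With A negative this gives \<open>t * \<bar>B\<bar> \<le> - A\<close>, so that
    \<open>2 * A + t * B\<close> is still negative.\<close>
  define t where "t = min 1 (- A / (\<bar>B\<bar> + 1))"
  have t: "0 < t" "t \<le> 1" using \<open>\<not> 0 \<le> A\<close> by (auto simp: t_def divide_neg_pos)
  have "t \<le> - A / (\<bar>B\<bar> + 1)" by (simp add: t_def)
  then have "t * (\<bar>B\<bar> + 1) \<le> - A" using pos_le_divide_eq[of "\<bar>B\<bar> + 1" t "- A"] by linarith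
  then have "t * \<bar>B\<bar> \<le> - A" using t by (simp add: algebra_simps)
  moreover have "t * B \<le> t * \<bar>B\<bar>" using t by (intro mult_left_mono) auto
  ultimately have "2 * A + t * B < 0" using \<open>\<not> 0 \<le> A\<close> by linarith
  then have "t * (2 * A + t * B) < 0" using t by (simp add: mult_pos_neg)
  with assms[OF t] show False by (simp add: algebra_simps power2_eq_square)
qed

text \<open>The minimiser of the penalised least squares functional either is a feasible plan, or its
  residuals, read as potentials, violate a dual bound (the first-order conditions).\<close>

lemma finite_transport_duality:
  fixes p :: "'i \<Rightarrow> real" and q :: "'j \<Rightarrow> real" and c :: "'i \<Rightarrow> 'j \<Rightarrow> real"
  assumes fin: "finite I" "finite J" and ne: "I \<noteq> {}"
    and p: "\<And>i. i \<in> I \<Longrightarrow> 0 \<le> p i" "sum p I = 1"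
    and q: "\<And>j. j \<in> J \<Longrightarrow> 0 \<le> q j" "sum q J = 1"
    and r: "0 \<le> r"
    and dual: "\<And>\<phi>. (\<Sum>i\<in>I. \<phi> i * p i) + (\<Sum>j\<in>J. (MIN i\<in>I. c i j - \<phi> i) * q j) \<le> r"
  shows "\<exists>w. (\<forall>i\<in>I. \<forall>j\<in>J. 0 \<le> w i j) \<and> (\<forall>i\<in>I. (\<Sum>j\<in>J. w i j) = p i)
    \<and> (\<forall>j\<in>J. (\<Sum>i\<in>I. w i j) = q j) \<and> (\<Sum>i\<in>I. \<Sum>j\<in>J. c i j * w i j) \<le> r"
proof -
  \<comment> \<open>The upper bound 4 only provides compactness; it is not active at the minimiser.\<close>
  define K where "K = {w :: 'i \<times> 'j \<Rightarrow> real. \<forall>z. 0 \<le> w z \<and> w z \<le> 4}"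
  define row where "row w i = (\<Sum>j\<in>J. w (i, j))" for w :: "'i \<times> 'j \<Rightarrow> real" and i
  define col where "col w j = (\<Sum>i\<in>I. w (i, j))" for w :: "'i \<times> 'j \<Rightarrow> real" and j
  define cost where "cost w = (\<Sum>i\<in>I. \<Sum>j\<in>J. c i j * w (i, j))" for w :: "'i \<times> 'j \<Rightarrow> real"
  define F where "F w = (\<Sum>i\<in>I. (row w i - p i)^2) + (\<Sum>j\<in>J. (col w j - q j)^2)
    + (max 0 (cost w - r))^2" for w
  have "continuous_on UNIV F"
    unfolding F_def row_def col_def cost_def
    by (intro continuous_intros continuous_on_max continuous_on_product_coordinates)
  then have "continuous_on K F" by (rule continuous_on_subset) auto
  moreover have "compact K" unfolding K_def by (rule compact_box_fun)
  moreover have "(\<lambda>_. 0) \<in> K" by (auto simp: K_def)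
  ultimately obtain w where w: "w \<in> K" "\<And>v. v \<in> K \<Longrightarrow> F w \<le> F v"
    using continuous_attains_inf[of K F] by blast
  define R where "R i = row w i - p i" for i
  define S where "S j = col w j - q j" for j
  define l where "l = max 0 (cost w - r)"
  \<comment> \<open>Half the derivative of \<open>F\<close> at \<open>w\<close> in direction
    \<open>d\<close>; \<open>R\<close>, \<open>S\<close> and \<open>l\<close> are the residuals of
    the rows, the columns and the cost.\<close>
  define A where "A d = (\<Sum>i\<in>I. R i * row d i) + (\<Sum>j\<in>J. S j * col d j) + l * cost d" for d
  have A_sum: "A d = (\<Sum>i\<in>I. \<Sum>j\<in>J. (R i + S j + l * c i j) * d (i, j))" for d
  proof -
    have "(\<Sum>j\<in>J. S j * col d j) = (\<Sum>i\<in>I. \<Sum>j\<in>J. S j * d (i, j))"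
      unfolding col_def sum_distrib_left by (rule sum.swap)
    then show ?thesis
      unfolding A_def row_def cost_def
      by (simp add: sum_distrib_left sum.distrib algebra_simps)
  qed
  have deriv: "0 \<le> A (\<lambda>z. v z - w z)" if v: "v \<in> K" for v
  proof -
    define d where "d = (\<lambda>z. v z - w z)"
    define B where "B = (\<Sum>i\<in>I. (row d i)^2) + (\<Sum>j\<in>J. (col d j)^2) + (cost d)^2"
    have "0 \<le> 2 * t * A d + t^2 * B" if t: "0 < t" "t \<le> 1" for t
    proof -
      define u where "u = (\<lambda>z. w z + t * d z)"
      have "u z = (1 - t) * w z + t * v z" for z by (simp add: u_def d_def algebra_simps)
      moreover have "0 \<le> (1 - t) * w z + t * v z \<and> (1 - t) * w z + t * v z \<le> 4" for z
      proof -
        have "0 \<le> w z" "w z \<le> 4" "0 \<le> v z" "v z \<le> 4" using w(1) v by (simp_all only: K_def mem_Collect_eq)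
        then show ?thesis using t convex_bound_le[of "w z" 4 "v z" "1 - t" t] by simp
      qed
      ultimately have "u \<in> K" by (simp add: K_def)
      then have le: "F w \<le> F u" by (rule w)
      have ru: "row u i - p i = R i + t * row d i" for i
        by (simp add: row_def u_def R_def sum.distrib sum_distrib_left)
      have cu: "col u j - q j = S j + t * col d j" for j
        by (simp add: col_def u_def S_def sum.distrib sum_distrib_left)
      have cost_u: "cost u = cost w + t * cost d"
        by (simp add: cost_def u_def sum.distrib sum_distrib_left algebra_simps)
      \<comment> \<open>The cost penalty is not quadratic, but it lies below the quadratic with the
        same value and slope at \<open>t = 0\<close>, and minimality only needs an upper bound for
        \<open>F u\<close>.\<close>
      have pos_part: "(max 0 (a + b))^2 \<le> (max 0 a + b)^2" for a b :: real
      proof (cases "0 \<le> a + b")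
        case True
        then show ?thesis by (intro power_mono) auto
      qed auto
      have "(max 0 (cost u - r))^2 \<le> (l + t * cost d)^2"
        using pos_part[of "cost w - r" "t * cost d"] by (simp add: cost_u l_def algebra_simps)
      then have "F u \<le> (\<Sum>i\<in>I. (R i + t * row d i)^2) + (\<Sum>j\<in>J. (S j + t * col d j)^2) + (l + t * cost d)^2"
        by (simp add: F_def ru cu)
      also have "\<dots> = F w + 2 * t * A d + t^2 * B"
        unfolding F_def R_def[symmetric] S_def[symmetric] l_def[symmetric] A_def B_def
        by (simp add: power2_sum sum.distrib sum_distrib_left algebra_simps power_mult_distrib)
      finally show ?thesis using le by linarith
    qed
    then show ?thesis unfolding d_def[symmetric] by (rule nonneg_if_quadratic_nonneg)
  qed
  have w0: "0 \<le> w z" "w z \<le> 4" for z using w(1) by (simp_all only: K_def mem_Collect_eq)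
  \<comment> \<open>The zero plan misses the marginals by p and q, whose squares add up to at most 1
    each, and its cost 0 does not exceed r.\<close>
  have F0: "F (\<lambda>_. 0) \<le> 2"
  proof -
    have sq: "(\<Sum>i\<in>X. (f i)^2) \<le> 1" if "finite X" "\<And>i. i \<in> X \<Longrightarrow> 0 \<le> f i" "sum f X = 1" for f :: "'x \<Rightarrow> real" and X
    proof -
      have "f i \<le> 1" if "i \<in> X" for i
        using member_le_sum[of i X f] \<open>sum f X = 1\<close> \<open>finite X\<close> that \<open>\<And>i. i \<in> X \<Longrightarrow> 0 \<le> f i\<close> by auto
      then have "(\<Sum>i\<in>X. (f i)^2) \<le> sum f X"
        using that by (intro sum_mono) (simp add: power2_eq_square mult_left_le)
      then show ?thesis using that by simp
    qed
    show ?thesis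
      using sq[OF fin(1) p] sq[OF fin(2) q] r by (simp add: F_def row_def col_def cost_def)
  qed
  \<comment> \<open>Minimality gives \<open>F w \<le> 2\<close>, hence \<open>R i \<le> 2\<close>
    and, with \<open>p i \<le> 1\<close>, entries at most 3: there is room to raise one of them by
    1.\<close>
  have w3: "w (i, j) \<le> 3" if "i \<in> I" "j \<in> J" for i j
  proof -
    have "(R i)^2 \<le> (\<Sum>i\<in>I. (R i)^2)"
      using that fin by (intro member_le_sum) auto
    also have "\<dots> \<le> F w" unfolding F_def R_def by (simp add: sum_nonneg)
    also have "\<dots> \<le> 2\<^sup>2" using w(2)[of "\<lambda>_. 0"] F0 \<open>(\<lambda>_. 0) \<in> K\<close> by simp
    finally have "R i \<le> 2" by (rule power2_le_imp_le) simp
    moreover have "p i \<le> 1"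
      using member_le_sum[of i I p] p fin that by auto
    moreover have "w (i, j) \<le> row w i"
      unfolding row_def using member_le_sum[of j J "\<lambda>j. w (i, j)"] that fin w0 by auto
    ultimately show ?thesis by (simp add: R_def)
  qed
  \<comment> \<open>Raising the single entry (i, j) is an admissible direction, and the derivative
    in it is the dual constraint at (i, j).\<close>
  have G: "0 \<le> R i + S j + l * c i j" if "i \<in> I" "j \<in> J" for i j
  proof -
    have "w((i, j) := w (i, j) + 1) \<in> K"
      using w0 w3[OF that] by (auto simp: K_def add_increasing)
    moreover have "(\<lambda>z. (w((i, j) := w (i, j) + 1)) z - w z) = (\<lambda>z. if z = (i, j) then 1 else 0)"
      by auto
    ultimately have "0 \<le> A (\<lambda>z. if z = (i, j) then 1 else 0)"
      using deriv by metis
    also have "\<dots> = (\<Sum>i'\<in>I. if i' = i then \<Sum>j'\<in>J. if j' = j then R i + S j + l * c i j else 0 else 0)"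
      unfolding A_sum by (intro sum.cong refl) (auto intro!: sum.cong sum.neutral)
    also have "\<dots> = R i + S j + l * c i j"
      using that fin by simp
    finally show ?thesis .
  qed
  \<comment> \<open>Complementary slackness: the derivative along \<open>w\<close> is nonnegative by
    \<open>G\<close>, and nonpositive because shrinking \<open>w\<close> to 0 stays in the
    box.\<close>
  have "0 \<le> A w" unfolding A_sum using G w0 by (intro sum_nonneg mult_nonneg_nonneg) auto
  moreover have "0 \<le> - A w"
    using deriv[OF \<open>(\<lambda>_. 0) \<in> K\<close>] unfolding A_sum by (simp add: sum_negf)
  ultimately have Aw: "A w = 0" by simp
  \<comment> \<open>The dual value of the potentials \<open>- R\<close> and \<open>- S\<close>. It
    exceeds \<open>l * r\<close> by exactly the penalty, so the bound \<open>V \<le> l * r\<close>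
    forces the penalty to vanish.\<close>
  define V where "V = (\<Sum>i\<in>I. - R i * p i) + (\<Sum>j\<in>J. - S j * q j)"
  have V: "V = l * r + F w"
  proof -
    have "(\<Sum>i\<in>I. - R i * p i) = (\<Sum>i\<in>I. (R i)^2) - (\<Sum>i\<in>I. R i * row w i)"
      unfolding sum_subtractf[symmetric] by (intro sum.cong refl) (simp add: R_def algebra_simps power2_eq_square)
    moreover have "(\<Sum>j\<in>J. - S j * q j) = (\<Sum>j\<in>J. (S j)^2) - (\<Sum>j\<in>J. S j * col w j)"
      unfolding sum_subtractf[symmetric] by (intro sum.cong refl) (simp add: S_def algebra_simps power2_eq_square)
    moreover have "l * cost w = l * r + l^2"
      by (simp add: l_def max_def algebra_simps power2_eq_square)
    ultimately show ?thesis
      using Aw unfolding V_def A_def F_def R_def[symmetric] S_def[symmetric] l_def[symmetric] by linarith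
  qed
  \<comment> \<open>If \<open>l\<close> vanishes, \<open>- R i - S j \<le> 0\<close> is averaged
    against the product of p and q. Otherwise division by \<open>l\<close> makes the potentials
    admissible for c, and \<open>- S j / l\<close> lies below the minimum in
    \<open>dual\<close>.\<close>
  have "V \<le> l * r"
  proof (cases "l = 0")
    case True
    have "V = (\<Sum>i\<in>I. - R i * p i * sum q J) + (\<Sum>j\<in>J. - S j * q j * sum p I)"
      by (simp add: V_def p q)
    also have "(\<Sum>j\<in>J. - S j * q j * sum p I) = (\<Sum>i\<in>I. \<Sum>j\<in>J. - S j * q j * p i)"
      by (simp only: sum_distrib_left, rule sum.swap)
    also have "(\<Sum>i\<in>I. - R i * p i * sum q J) + \<dots> = (\<Sum>i\<in>I. \<Sum>j\<in>J. - ((R i + S j) * (p i * q j)))"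
      unfolding sum_distrib_left sum.distrib[symmetric] by (intro sum.cong refl) (simp add: algebra_simps)
    also have "\<dots> \<le> 0"
      using G True p q by (intro sum_nonpos) simp
    finally show ?thesis using True by simp
  next
    case False
    then have l: "0 < l" by (simp add: l_def max_def split: if_splits)
    have "(\<Sum>j\<in>J. (- S j / l) * q j) \<le> (\<Sum>j\<in>J. (MIN i\<in>I. c i j - (- R i / l)) * q j)"
    proof (intro sum_mono mult_right_mono)
      fix j assume j: "j \<in> J"
      have "- S j / l \<le> c i j - (- R i / l)" if "i \<in> I" for i
        using G[OF that j] l by (simp add: field_simps)
      then show "- S j / l \<le> (MIN i\<in>I. c i j - (- R i / l))"
        using fin ne by (subst Min_ge_iff) auto
    qed (use q in auto)
    then have "(\<Sum>i\<in>I. (- R i / l) * p i) + (\<Sum>j\<in>J. (- S j / l) * q j) \<le> r"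
      using dual[of "\<lambda>i. - R i / l"] by linarith
    moreover have "(\<Sum>i\<in>I. (- R i / l) * p i) + (\<Sum>j\<in>J. (- S j / l) * q j) = V / l"
      by (simp add: V_def add_divide_distrib sum_divide_distrib)
    ultimately have "V / l \<le> r" by simp
    then show ?thesis using l by (simp add: pos_divide_le_eq mult.commute)
  qed
  then have "F w \<le> 0" using V by simp
  then have "(\<Sum>i\<in>I. (R i)^2) + (\<Sum>j\<in>J. (S j)^2) + l^2 \<le> 0"
    unfolding F_def R_def S_def l_def .
  moreover have "0 \<le> (\<Sum>i\<in>I. (R i)^2)" "0 \<le> (\<Sum>j\<in>J. (S j)^2)" "0 \<le> l^2"
    by (auto intro: sum_nonneg)
  ultimately have *: "(\<Sum>i\<in>I. (R i)^2) = 0" "(\<Sum>j\<in>J. (S j)^2) = 0" "l^2 = 0"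
    by linarith+
  show ?thesis
  proof (intro exI[of _ "\<lambda>i j. w (i, j)"] conjI ballI)
    show "(\<Sum>j\<in>J. w (i, j)) = p i" if "i \<in> I" for i
      using *(1) fin that by (simp add: sum_nonneg_eq_0_iff R_def row_def)
    show "(\<Sum>i\<in>I. w (i, j)) = q j" if "j \<in> J" for j
      using *(2) fin that by (simp add: sum_nonneg_eq_0_iff S_def col_def)
    show "(\<Sum>i\<in>I. \<Sum>j\<in>J. c i j * w (i, j)) \<le> r"
      using *(3) by (simp add: l_def cost_def max_def split: if_splits)
  qed (rule w0)
qed


section \<open>Binary sequences as points of the line\<close>

text \<open>The Cantor set embeds binary sequences into the line so that every digit is the restriction of a
  continuous function on the whole line; weak convergence of laws thus passes to digits.\<close>

primrec digit :: "nat \<Rightarrow> real \<Rightarrow> real" where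
  "digit 0 s = min 1 (max 0 (3 * s - 1))"
| "digit (Suc k) s = digit k (3 * s - 2 * min 1 (max 0 (3 * s - 1)))"

text \<open>Ternary digits 0 and 2 leave the gap (1/3, 2/3) between points with first digit 0 and
  points with first digit 1; on it the clamped function in \<open>digit\<close> rises from 0 to
  1.\<close>

definition cantor :: "(nat \<Rightarrow> real) \<Rightarrow> real" where
  "cantor b = (\<Sum>k. 2 * b k / 3 ^ Suc k)"

lemma continuous_on_digit: "continuous_on UNIV (digit k)"
proof (induction k)
  case 0
  show ?case by (simp, intro continuous_intros)
next
  case (Suc k)
  show ?case unfolding digit.simps
    by (rule continuous_on_compose2[OF Suc]) (auto intro!: continuous_intros)
qed

lemma borel_measurable_digit [measurable]: "digit k \<in> borel_measurable borel"
  by (rule borel_measurable_continuous_onI[OF continuous_on_digit])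

lemma digit_bounds: "0 \<le> digit k s" "digit k s \<le> 1"
  by (induction k arbitrary: s) auto

lemma sums_ternary: "(\<lambda>k. 2 / 3 ^ Suc k) sums (1::real)"
  using sums_mult[OF geometric_sums[of "1/3::real"], of "2/3"]
  by (simp add: power_divide field_simps)

lemma summable_cantor:
  assumes b: "\<And>k. b k \<in> {0, 1}"
  shows "summable (\<lambda>k. 2 * b k / 3 ^ Suc k :: real)"
proof (rule summable_comparison_test'[OF sums_summable[OF sums_ternary], of 0])
  fix k :: nat
  have "0 \<le> b k" "b k \<le> 1" using b[of k] by auto
  then show "norm (2 * b k / 3 ^ Suc k) \<le> 2 / 3 ^ Suc k"
    by (simp add: divide_right_mono abs_mult)
qed

lemma
  assumes b: "\<And>k. b k \<in> {0, 1}"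
  shows cantor_nonneg: "0 \<le> cantor b" and cantor_le_1: "cantor b \<le> 1"
    and cantor_shift: "cantor b = (2 * b 0 + cantor (\<lambda>k. b (Suc k))) / 3"
proof -
  have bd: "0 \<le> 2 * b k / 3 ^ Suc k" "2 * b k / 3 ^ Suc k \<le> 2 / 3 ^ Suc k" for k
    using b[of k] by auto
  note sm = summable_cantor[of b, OF b]
  show "0 \<le> cantor b" unfolding cantor_def by (intro suminf_nonneg sm bd)
  show "cantor b \<le> 1" unfolding cantor_def sums_unique[OF sums_ternary]
    by (intro suminf_le bd sm sums_summable[OF sums_ternary])
  note sm' = summable_cantor[of "\<lambda>k. b (Suc k)", OF b]
  have "cantor b = 2 * b 0 / 3 + (\<Sum>k. 2 * b (Suc k) / 3 ^ Suc (Suc k))"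
    unfolding cantor_def using suminf_split_initial_segment[OF sm, of 1] by simp
  also have "(\<Sum>k. 2 * b (Suc k) / 3 ^ Suc (Suc k)) = cantor (\<lambda>k. b (Suc k)) / 3"
    unfolding cantor_def suminf_divide[OF sm', symmetric] by simp
  finally show "cantor b = (2 * b 0 + cantor (\<lambda>k. b (Suc k))) / 3" by (simp add: add_divide_distrib)
qed

lemma cantor_first_digit:
  assumes "\<And>k. b k \<in> {0, 1}"
  shows "min 1 (max 0 (3 * cantor b - 1)) = b 0"
proof -
  define y where "y = cantor (\<lambda>k. b (Suc k))"
  have "cantor b = (2 * b 0 + y) / 3" "0 \<le> y" "y \<le> 1"
    unfolding y_def
    using cantor_shift[of b, OF assms] cantor_nonneg[of "\<lambda>k. b (Suc k)", OF assms]
      cantor_le_1[of "\<lambda>k. b (Suc k)", OF assms] by auto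
  moreover have "b 0 = 0 \<or> b 0 = 1" using assms[of 0] by auto
  ultimately show ?thesis by auto
qed

lemma digit_cantor:
  assumes "\<And>k. b k \<in> {0, 1}"
  shows "digit k (cantor b) = b k"
  using assms
proof (induction k arbitrary: b)
  case (0 b)
  then show ?case using cantor_first_digit[of b] by simp
next
  case (Suc k b)
  have "3 * cantor b - 2 * b 0 = cantor (\<lambda>k. b (Suc k))"
    using cantor_shift[of b] Suc.prems by simp
  then show ?case
    using Suc.IH[of "\<lambda>k. b (Suc k)"] Suc.prems cantor_first_digit[of b, OF Suc.prems]
    by (simp only: digit.simps)
qed

text \<open>A point is the limit of points picked from ever smaller basic sets that contain it, and
  the code records which sets contain it. Taking the first suitable index makes each choice
  countably valued and measurable.\<close>

lemma code_retraction:
  fixes U :: "nat \<Rightarrow> 'b::polish_space set"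
  assumes U: "topological_basis (range U)"
  shows "\<exists>r\<in>borel_measurable (PiM UNIV (\<lambda>_::nat. borel :: real measure)).
    \<forall>x. r (\<lambda>k. indicator (U k) x) = (x :: 'b)"
proof -
  define small where "small n k \<longleftrightarrow> (\<forall>x\<in>U k. \<forall>y\<in>U k. dist x y < 1 / 2 ^ n)" for n k
  define N where "N n a = (LEAST k. small n k \<and> a k = (1::real))" for n and a :: "nat \<Rightarrow> real"
  define d where "d n a = (SOME y. y \<in> U (N n a))" for n a
  \<comment> \<open>For a sequence that codes no point the chosen points may fail to converge; the
    constant makes the limit exist everywhere.\<close>
  define f where "f n a = (if Cauchy (\<lambda>n. d n a) then d n a else undefined)" for n a
  define r where "r a = lim (\<lambda>n. f n a)" for a
  let ?M = "PiM UNIV (\<lambda>_::nat. borel :: real measure)"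
  have "N n \<in> measurable ?M (count_space UNIV)" for n
    unfolding N_def by measurable
  then have [measurable]: "d n \<in> borel_measurable ?M" for n
    unfolding d_def
    by (rule measurable_compose[where g = "\<lambda>k. SOME y. y \<in> U k"]) simp
  have [measurable]: "f n \<in> borel_measurable ?M" for n
    unfolding f_def by measurable
  have "convergent (\<lambda>n. f n a)" for a
    by (cases "Cauchy (\<lambda>n. d n a)") (auto simp: f_def Cauchy_convergent convergent_const)
  then have lim: "(\<lambda>n. f n a) \<longlonglongrightarrow> r a" for a
    unfolding r_def by (simp add: convergent_LIMSEQ_iff)
  have "r \<in> borel_measurable ?M"
    by (rule borel_measurable_LIMSEQ_metric[where f = f]) (auto intro: lim)
  moreover have "r (\<lambda>k. indicator (U k) x) = x" for x
  proof -
    define a :: "nat \<Rightarrow> real" where "a = (\<lambda>k. indicator (U k) x)"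
    have near: "dist (d n a) x < (1 / 2) ^ n" for n
    proof -
      have "open (ball x (1 / 2 ^ Suc n))" "x \<in> ball x (1 / 2 ^ Suc n)" by auto
      then obtain k where k: "x \<in> U k" "U k \<subseteq> ball x (1 / 2 ^ Suc n)"
        using topological_basisE[OF U] by (metis rangeE)
      have "small n k" unfolding small_def
      proof (intro ballI)
        fix y z assume "y \<in> U k" "z \<in> U k"
        then have "dist x y < 1 / 2 ^ Suc n" "dist x z < 1 / 2 ^ Suc n" using k(2) by auto
        then show "dist y z < 1 / 2 ^ n"
          using dist_triangle3[of y z x] by simp
      qed
      then have "small n (N n a) \<and> a (N n a) = 1"
        unfolding N_def using k(1) LeastI[of "\<lambda>k. small n k \<and> a k = 1" k] by (simp add: a_def)
      then have s: "small n (N n a)" and x: "x \<in> U (N n a)" by (auto simp: a_def indicator_def split: if_splits)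
      then have "d n a \<in> U (N n a)" unfolding d_def by (intro someI)
      then show ?thesis using s x unfolding small_def by (auto simp: power_divide)
    qed
    have "(\<lambda>n. d n a) \<longlonglongrightarrow> x"
    proof (subst tendsto_dist_iff, rule tendsto_sandwich[of "\<lambda>_. 0"])
      show "(\<lambda>n. (1 / 2 :: real) ^ n) \<longlonglongrightarrow> 0" by (intro LIMSEQ_power_zero) simp
      show "\<forall>\<^sub>F n in sequentially. dist (d n a) x \<le> (1 / 2) ^ n" by (intro always_eventually allI less_imp_le near)
    qed auto
    then have "(\<lambda>n. f n a) \<longlonglongrightarrow> x"
      using LIMSEQ_imp_Cauchy[of "\<lambda>n. d n a"] by (simp add: f_def)
    then show ?thesis using lim LIMSEQ_unique unfolding a_def by blast
  qed
  ultimately show ?thesis by blast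
qed

subsection \<open>Kantorovich duality\<close>

declare digit.simps [simp del]

text \<open>A running maximum that starts from 0. With products of indicators it is the n-th
  approximation of the cost from below; with weights 1 it is the maximum of finitely many dual
  values.\<close>

primrec hmax :: "(nat \<Rightarrow> real) \<Rightarrow> nat \<Rightarrow> (nat \<Rightarrow> real) \<Rightarrow> real" where
  "hmax a 0 u = 0"
| "hmax a (Suc n) u = max (hmax a n u) (a n * u n)"

lemma hmax_nonneg: "0 \<le> hmax a n u"
  by (induction n) (auto simp: le_max_iff_disj)

lemma hmax_mono: "m \<le> n \<Longrightarrow> hmax a m u \<le> hmax a n u"
  by (induction n) (auto simp: le_Suc_eq le_max_iff_disj)

lemma hmax_cong: "(\<And>k. k < n \<Longrightarrow> u k = v k) \<Longrightarrow> hmax a n u = hmax a n v"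
  by (induction n) auto

lemma hmax_le: "0 \<le> b \<Longrightarrow> (\<And>k. k < n \<Longrightarrow> a k * u k \<le> b) \<Longrightarrow> hmax a n u \<le> b"
  by (induction n) auto

lemma hmax_ge: "k < n \<Longrightarrow> a k * u k \<le> hmax a n u"
  by (induction n) (auto simp: less_Suc_eq le_max_iff_disj)

lemma continuous_on_hmax:
  "(\<And>k. continuous_on S (\<lambda>s. u s k)) \<Longrightarrow> continuous_on S (\<lambda>s. hmax a n (u s))"
  by (induction n) (auto intro!: continuous_intros)

lemma borel_measurable_hmax [measurable (raw)]:
  "(\<And>k. (\<lambda>s. u s k) \<in> borel_measurable M) \<Longrightarrow> (\<lambda>s. hmax a n (u s)) \<in> borel_measurable M"
  by (induction n) auto

lemma abs_hmax_le: "(\<And>k. \<bar>u k\<bar> \<le> 1) \<Longrightarrow> \<bar>hmax a n u\<bar> \<le> (\<Sum>k<n. \<bar>a k\<bar>)"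
proof (induction n)
  case (Suc n)
  have "\<bar>a n * u n\<bar> \<le> \<bar>a n\<bar>" using Suc.prems[of n] by (simp add: abs_mult mult_left_le)
  moreover have "0 \<le> (\<Sum>k<n. \<bar>a k\<bar>)" by (intro sum_nonneg) auto
  ultimately show ?case using Suc by auto
qed simp

text \<open>The values label the atoms of the algebra generated by the first n sets; on these finite
  spaces transport becomes a linear programme.\<close>

definition code :: "(nat \<Rightarrow> 'b set) \<Rightarrow> nat \<Rightarrow> 'b \<Rightarrow> nat set" where
  "code U n x = {k\<in>{..<n}. x \<in> U k}"

lemma code_in_Pow: "code U n x \<in> Pow {..<n}" by (auto simp: code_def)

lemma indicator_code: "k < n \<Longrightarrow> indicator (code U n x) k = (indicator (U k) x :: real)"
  by (auto simp: code_def indicator_def)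

lemma measurable_code [measurable]:
  assumes [measurable]: "\<And>k. U k \<in> sets M"
  shows "code U n \<in> measurable M (count_space UNIV)"
proof -
  have "code U n \<in> measurable M (count_space (Pow {..<n}))"
  proof (subst measurable_count_space_eq2, simp, intro conjI ballI)
    show "code U n \<in> space M \<rightarrow> Pow {..<n}" by (auto simp: code_def)
    fix I assume I: "I \<in> Pow {..<n}"
    have "code U n -` {I} \<inter> space M = space M - (\<Union>k\<in>I. space M - U k) - (\<Union>k\<in>{..<n} - I. U k)"
      using I by (auto simp: code_def)
    also have "\<dots> \<in> sets M" using I finite_subset[of I "{..<n}"]
      by (intro sets.Diff sets.finite_UN assms sets.top) auto
    finally show "code U n -` {I} \<inter> space M \<in> sets M" .
  qed
  from measurable_compose[OF this, of "\<lambda>I. I" "count_space UNIV"] show ?thesis by simp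
qed

lemma (in prob_space) integral_code:
  fixes f :: "nat set \<Rightarrow> real"
  assumes [measurable]: "\<And>k. U k \<in> sets M"
  shows "(\<integral>x. f (code U n x) \<partial>M) = (\<Sum>I\<in>Pow {..<n}. f I * measure M {x\<in>space M. code U n x = I})"
proof -
  have [measurable]: "{x\<in>space M. code U n x = I} \<in> sets M" for I by measurable
  have "f (code U n x) = (\<Sum>I\<in>Pow {..<n}. f I * indicator {x\<in>space M. code U n x = I} x)" if "x \<in> space M" for x
    using code_in_Pow[of U n x] that by (simp add: indicator_def if_distrib sum.delta cong: if_cong)
  then have "(\<integral>x. f (code U n x) \<partial>M)
      = (\<integral>x. (\<Sum>I\<in>Pow {..<n}. f I * indicator {x\<in>space M. code U n x = I} x) \<partial>M)"
    by (intro Bochner_Integration.integral_cong) auto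
  also have "\<dots> = (\<Sum>I\<in>Pow {..<n}. f I * measure M {x\<in>space M. code U n x = I})"
    by (subst Bochner_Integration.integral_sum) (auto intro!: integrable_real_mult_indicator simp: emeasure_eq_measure)
  finally show ?thesis .
qed

lemma (in prob_space) sum_code: 
  assumes [measurable]: "\<And>k. U k \<in> sets M"
  shows "(\<Sum>I\<in>Pow {..<n}. measure M {x\<in>space M. code U n x = I}) = 1"
  using integral_code[OF assms, where f = "\<lambda>_. 1" and n = n] by (simp add: prob_space)

section \<open>The coupling as a weak limit of finite plans\<close>

lemma indicator_01_affine:
  "b \<in> {0, 1} \<Longrightarrow> indicator A b = indicator A 0 + (indicator A 1 - indicator A 0) * (b :: real)"
  by auto

text \<open>A function of a digit in {0, 1} is affine in it, so the indicator of a cylinder is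
  almost surely a product of affine functions of finitely many digits. Such products are continuous
  in the digits and pass to weak limits, unlike indicators.\<close>

lemma distr_digits_eqI:
  fixes g :: "nat \<Rightarrow> 'c \<Rightarrow> real" and U :: "nat \<Rightarrow> 'b set"
  assumes "prob_space M" and "prob_space P"
    and g[measurable]: "\<And>k. g k \<in> borel_measurable M" and U[measurable]: "\<And>k. U k \<in> sets P"
    and g01: "\<And>k. AE s in M. g k s \<in> {0, 1}"
    and eq: "\<And>K \<alpha> \<beta>. finite K \<Longrightarrow> (\<integral>s. (\<Prod>k\<in>K. \<alpha> k + \<beta> k * g k s) \<partial>M)
      = (\<integral>x. (\<Prod>k\<in>K. \<alpha> k + \<beta> k * indicator (U k) x) \<partial>P)"
  shows "distr M (PiM UNIV (\<lambda>_::nat. borel)) (\<lambda>s k. g k s)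
    = distr P (PiM UNIV (\<lambda>_::nat. borel)) (\<lambda>x k. indicator (U k) x)"
proof -
  interpret M: prob_space M by fact
  interpret P: prob_space P by fact
  let ?N = "PiM UNIV (\<lambda>_::nat. borel :: real measure)"
  have mM[measurable]: "(\<lambda>s k. g k s) \<in> measurable M ?N" by (rule measurable_PiM_single') auto
  have mP[measurable]: "(\<lambda>x k. indicator (U k) x) \<in> measurable P ?N" by (rule measurable_PiM_single') auto
  show ?thesis
  proof (rule measure_eqI_PiM_infinite)
    show "finite_measure (distr M ?N (\<lambda>s k. g k s))"
      by (rule finite_measureI) (simp add: emeasure_distr M.emeasure_eq_measure)
    fix A :: "nat \<Rightarrow> real set" and J :: "nat set"
    assume J: "finite J" and A[measurable]: "\<And>i. i \<in> J \<Longrightarrow> A i \<in> sets borel"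
    define B where "B = prod_emb UNIV (\<lambda>_::nat. borel :: real measure) J (Pi\<^sub>E J A)"
    have B: "B = {b. \<forall>k\<in>J. b k \<in> A k}" by (auto simp: B_def prod_emb_def PiE_iff)
    have Bs[measurable]: "B \<in> sets ?N" unfolding B_def using J A by (intro sets_PiM_I) auto
    define \<alpha> \<beta> :: "nat \<Rightarrow> real" where "\<alpha> k = indicator (A k) 0" and "\<beta> k = indicator (A k) 1 - indicator (A k) 0" for k
    have ind: "indicator B b = (\<Prod>k\<in>J. \<alpha> k + \<beta> k * b k)" if "\<And>k. b k \<in> {0, 1}" for b :: "nat \<Rightarrow> real"
    proof -
      have "indicator B b = (\<Prod>k\<in>J. indicator (A k) (b k) :: real)"
        using J by (cases "b \<in> B") (auto simp: B prod_zero_iff indicator_def)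
      also have "\<dots> = (\<Prod>k\<in>J. \<alpha> k + \<beta> k * b k)"
        unfolding \<alpha>_def \<beta>_def by (intro prod.cong refl indicator_01_affine that)
      finally show ?thesis .
    qed
    have meas: "measure (distr M' ?N f) B = (\<integral>b. indicator B b \<partial>distr M' ?N f)"
      if "f \<in> measurable M' ?N" for M' :: "'x measure" and f
      using sets.sets_into_space[OF Bs] by (simp add: Int_absorb2)
    have "measure (distr M ?N (\<lambda>s k. g k s)) B = (\<integral>s. indicator B (\<lambda>k. g k s) \<partial>M)"
      unfolding meas[OF mM] by (rule integral_distr) auto
    also have "\<dots> = (\<integral>s. (\<Prod>k\<in>J. \<alpha> k + \<beta> k * g k s) \<partial>M)"
    proof (rule integral_cong_AE)
      have "AE s in M. \<forall>k. g k s \<in> {0, 1}" using g01 by (simp add: AE_all_countable)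
      then show "AE s in M. indicator B (\<lambda>k. g k s) = (\<Prod>k\<in>J. \<alpha> k + \<beta> k * g k s)"
        by eventually_elim (rule ind, auto)
    qed measurable
    also have "\<dots> = (\<integral>x. (\<Prod>k\<in>J. \<alpha> k + \<beta> k * indicator (U k) x) \<partial>P)" by (rule eq[OF J])
    also have "\<dots> = (\<integral>x. indicator B (\<lambda>k. indicator (U k) x :: real) \<partial>P)"
      by (intro Bochner_Integration.integral_cong refl ind[symmetric]) (auto simp: indicator_def)
    also have "\<dots> = measure (distr P ?N (\<lambda>x k. indicator (U k) x)) B"
      unfolding meas[OF mP] by (rule integral_distr[symmetric]) auto
    finally show "emeasure (distr M ?N (\<lambda>s k. g k s)) (prod_emb UNIV (\<lambda>_. borel) J (Pi\<^sub>E J A))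
      = emeasure (distr P ?N (\<lambda>x k. indicator (U k) x)) (prod_emb UNIV (\<lambda>_. borel) J (Pi\<^sub>E J A))"
      unfolding B_def[symmetric]
      using finite_measure.emeasure_eq_measure[of "distr M ?N (\<lambda>s k. g k s)" B]
        finite_measure.emeasure_eq_measure[of "distr P ?N (\<lambda>x k. indicator (U k) x)" B]
        M.prob_space_distr[OF mM] P.prob_space_distr[OF mP] by (simp add: prob_space_def)
  qed auto
qed


text \<open>The plan of level n is a law of pairs of codes, hence of one binary sequence and of one
  point of the Cantor set. In the limit the two halves of the digits have the laws of the codes
  under P and Q, so they almost surely code points; decoding them gives the coupling.\<close>

lemma coupling_of_finite_plans:
  fixes P Q :: "'b::polish_space measure" and U V :: "nat \<Rightarrow> 'b set"
  assumes P: "P \<in> probs borel" and Q: "Q \<in> probs borel"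
    and U: "topological_basis (range U)" and V: "topological_basis (range V)"
    and w: "\<And>n I J. I \<in> Pow {..<n} \<Longrightarrow> J \<in> Pow {..<n} \<Longrightarrow> 0 \<le> w n I J"
    and rows: "\<And>n I. I \<in> Pow {..<n} \<Longrightarrow> (\<Sum>J\<in>Pow {..<n}. w n I J) = measure P {x\<in>space P. code U n x = I}"
    and cols: "\<And>n J. J \<in> Pow {..<n} \<Longrightarrow> (\<Sum>I\<in>Pow {..<n}. w n I J) = measure Q {y\<in>space Q. code V n y = J}"
    and cost: "\<And>n. (\<Sum>I\<in>Pow {..<n}. \<Sum>J\<in>Pow {..<n}.
      hmax a n (\<lambda>k. indicator I k * indicator J k) * w n I J) \<le> r"
  shows "\<exists>\<pi>\<in>couplings borel P Q. \<forall>n.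
    (\<integral>z. hmax a n (\<lambda>k. indicator (U k) (fst z) * indicator (V k) (snd z)) \<partial>\<pi>) \<le> r"
proof -
  have sP[measurable_cong]: "sets P = sets borel" and sQ[measurable_cong]: "sets Q = sets borel"
    using P Q by (auto simp: probs_def)
  interpret P: prob_space P using P by (simp add: probs_def)
  interpret Q: prob_space Q using Q by (simp add: probs_def)
  have U': "U k \<in> sets P" and V': "V k \<in> sets Q" and U''[measurable]: "U k \<in> sets borel" and V''[measurable]: "V k \<in> sets borel" for k
    using topological_basis_open[OF U, of "U k"] topological_basis_open[OF V, of "V k"] by (auto simp: sP sQ)
  let ?N = "PiM UNIV (\<lambda>_::nat. borel :: real measure)"
  define Z where "Z n = Pow {..<n} \<times> Pow {..<n::nat}" for n
  \<comment> \<open>Even positions carry the first code, odd positions the second.\<close>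
  define dig :: "nat set \<times> nat set \<Rightarrow> nat \<Rightarrow> real" where
    "dig z k = (if even k then indicator (fst z) (k div 2) else indicator (snd z) (k div 2))" for z k
  define pm where "pm n = point_measure (Z n) (\<lambda>z. ennreal (w n (fst z) (snd z)))" for n
  define \<mu> where "\<mu> n = distr (pm n) borel (\<lambda>z. cantor (dig z))" for n
  have dig01: "dig z k \<in> {0, 1}" for z k by (auto simp: dig_def indicator_def)
  have finZ: "finite (Z n)" for n by (auto simp: Z_def)
  have wZ: "z \<in> Z n \<Longrightarrow> 0 \<le> w n (fst z) (snd z)" for z n by (auto simp: Z_def intro: w)
  have rowsum: "(\<Sum>z\<in>Z n. w n (fst z) (snd z) * f (fst z)) = (\<integral>x. f (code U n x) \<partial>P)" for n f
  proof -
    have "(\<Sum>z\<in>Z n. w n (fst z) (snd z) * f (fst z)) = (\<Sum>I\<in>Pow {..<n}. \<Sum>J\<in>Pow {..<n}. w n I J * f I)"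
      unfolding Z_def by (simp add: sum.cartesian_product split_def)
    also have "\<dots> = (\<Sum>I\<in>Pow {..<n}. f I * measure P {x\<in>space P. code U n x = I})"
      by (intro sum.cong refl) (simp add: rows[symmetric] sum_distrib_left mult.commute)
    finally show ?thesis by (simp only: P.integral_code[OF U', where f = f and n = n])
  qed
  have colsum: "(\<Sum>z\<in>Z n. w n (fst z) (snd z) * f (snd z)) = (\<integral>x. f (code V n x) \<partial>Q)" for n f
  proof -
    have "(\<Sum>z\<in>Z n. w n (fst z) (snd z) * f (snd z)) = (\<Sum>I\<in>Pow {..<n}. \<Sum>J\<in>Pow {..<n}. w n I J * f J)"
      unfolding Z_def by (simp add: sum.cartesian_product split_def)
    also have "\<dots> = (\<Sum>J\<in>Pow {..<n}. \<Sum>I\<in>Pow {..<n}. w n I J * f J)" by (rule sum.swap)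
    also have "\<dots> = (\<Sum>J\<in>Pow {..<n}. f J * measure Q {x\<in>space Q. code V n x = J})"
      by (intro sum.cong refl) (simp add: cols[symmetric] sum_distrib_left mult.commute)
    finally show ?thesis by (simp only: Q.integral_code[OF V', where f = f and n = n])
  qed
  have prob_pm: "prob_space (pm n)" for n
  proof (rule prob_spaceI)
    have "(\<Sum>z\<in>Z n. w n (fst z) (snd z)) = 1"
      using rowsum[of n "\<lambda>_. 1"] by (simp add: P.prob_space)
    then show "emeasure (pm n) (space (pm n)) = 1"
      unfolding pm_def space_point_measure
      by (subst emeasure_point_measure_finite) (auto simp: finZ sum_ennreal wZ)
  qed
  have meas: "(\<lambda>z. cantor (dig z)) \<in> borel_measurable (pm n)" for n by (simp add: pm_def)
  have rd: "real_distribution (\<mu> n)" for n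
    unfolding \<mu>_def using prob_pm meas by (rule prob_space.real_distribution_distr)
  have int_\<mu>: "integral\<^sup>L (\<mu> n) f = (\<Sum>z\<in>Z n. w n (fst z) (snd z) * f (cantor (dig z)))"
    if [measurable]: "f \<in> borel_measurable borel" for f :: "real \<Rightarrow> real" and n
    unfolding \<mu>_def using meas
    by (subst integral_distr) (auto simp: pm_def lebesgue_integral_point_measure_finite finZ wZ)
  \<comment> \<open>All the laws live on [0, 1]; the left end -1 is taken because the interval is
    open on the left and 0 is a possible value.\<close>
  have "tight \<mu>" unfolding tight_def
  proof (intro conjI allI impI)
    fix \<epsilon> :: real assume "0 < \<epsilon>"
    have bds: "-1 < cantor (dig z)" "cantor (dig z) \<le> 1" for z
      using cantor_nonneg[of "dig z", OF dig01] cantor_le_1[of "dig z", OF dig01] by linarith+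
    have "measure (\<mu> n) {-1<..1} = 1" for n
    proof -
      have "measure (\<mu> n) {-1<..1} = measure (pm n) (space (pm n))"
        unfolding \<mu>_def using bds meas
        by (subst measure_distr) (auto intro!: arg_cong[where f = "measure (pm n)"])
      then show ?thesis using prob_space.prob_space[OF prob_pm] by simp
    qed
    then show "\<exists>a b. a < b \<and> (\<forall>n. 1 - \<epsilon> < measure (\<mu> n) {a<..b})"
      using \<open>0 < \<epsilon>\<close> by (intro exI[of _ "-1"] exI[of _ 1]) auto
  qed (rule rd)
  then obtain s M where s: "strict_mono s" and M: "real_distribution M" and "weak_conv_m (\<mu> \<circ> id \<circ> s) M"
    using tight_imp_convergent_subsubsequence[of \<mu> id] strict_mono_id by blast
  then have conv: "weak_conv_m (\<lambda>n. \<mu> (s n)) M" by (simp add: comp_def)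
  interpret M: real_distribution M by fact
  have lim: "(\<lambda>n. \<Sum>z\<in>Z (s n). w (s n) (fst z) (snd z) * f (cantor (dig z))) \<longlonglongrightarrow> integral\<^sup>L M f"
    if f: "continuous_on UNIV f" "\<And>x. \<bar>f x\<bar> \<le> B" for f :: "real \<Rightarrow> real" and B
  proof -
    have "(\<lambda>n. integral\<^sup>L (\<mu> (s n)) f) \<longlonglongrightarrow> integral\<^sup>L M f"
      using f by (intro weak_conv_imp_integral_bdd_continuous_conv[OF rd M conv, where B = B])
        (auto simp: continuous_on_eq_continuous_at)
    then show ?thesis using borel_measurable_continuous_onI[OF f(1)] by (simp add: int_\<mu>)
  qed
  have dc: "digit k (cantor (dig z)) = dig z k" for k z by (rule digit_cantor[OF dig01])
  \<comment> \<open>A weak limit of binary digits could lie strictly between 0 and 1. The continuous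
    test d * (1 - d) has integral 0 under every approximating law and excludes this.\<close>
  have d01: "AE x in M. digit k x \<in> {0, 1}" for k
  proof -
    have "(\<integral>x. digit k x * (1 - digit k x) \<partial>M) = 0"
    proof (rule LIMSEQ_unique[OF lim])
      show "continuous_on UNIV (\<lambda>x. digit k x * (1 - digit k x))"
        by (intro continuous_intros continuous_on_digit)
      show "\<bar>digit k x * (1 - digit k x)\<bar> \<le> 1" for x
        using digit_bounds[of k x] by (simp add: abs_mult mult_le_one)
      have z: "dig z k * (1 - dig z k) = 0" for z using dig01[of z k] by auto
      show "(\<lambda>n. \<Sum>z\<in>Z (s n). w (s n) (fst z) (snd z) *
        (digit k (cantor (dig z)) * (1 - digit k (cantor (dig z))))) \<longlonglongrightarrow> 0"
        unfolding dc z by simp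
    qed
    moreover have "integrable M (\<lambda>x. digit k x * (1 - digit k x))"
      using digit_bounds[of k] by (intro M.integrable_const_bound[of _ 1]) (auto simp: abs_mult mult_le_one)
    ultimately have "AE x in M. digit k x * (1 - digit k x) = 0"
      using digit_bounds[of k] by (subst (asm) integral_nonneg_eq_0_iff_AE) auto
    then show ?thesis by eventually_elim auto
  qed
  have prodlim: "(\<lambda>n. \<Sum>z\<in>Z (s n). w (s n) (fst z) (snd z) * (\<Prod>k\<in>K. \<alpha> k + \<beta> k * dig z (h k)))
    \<longlonglongrightarrow> (\<integral>x. (\<Prod>k\<in>K. \<alpha> k + \<beta> k * digit (h k) x) \<partial>M)" for K :: "nat set" and \<alpha> \<beta> and h :: "nat \<Rightarrow> nat"
  proof -
    have "(\<lambda>n. \<Sum>z\<in>Z (s n). w (s n) (fst z) (snd z) * (\<Prod>k\<in>K. \<alpha> k + \<beta> k * digit (h k) (cantor (dig z))))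
      \<longlonglongrightarrow> (\<integral>x. (\<Prod>k\<in>K. \<alpha> k + \<beta> k * digit (h k) x) \<partial>M)"
    proof (rule lim)
      show "continuous_on UNIV (\<lambda>x. \<Prod>k\<in>K. \<alpha> k + \<beta> k * digit (h k) x)"
        by (intro continuous_intros continuous_on_digit)
      show "\<bar>\<Prod>k\<in>K. \<alpha> k + \<beta> k * digit (h k) x\<bar> \<le> (\<Prod>k\<in>K. \<bar>\<alpha> k\<bar> + \<bar>\<beta> k\<bar>)" for x
        unfolding abs_prod
      proof (intro prod_mono conjI)
        fix k
        have "\<bar>\<beta> k * digit (h k) x\<bar> \<le> \<bar>\<beta> k\<bar>" using digit_bounds[of "h k" x] by (simp add: abs_mult mult_left_le)
        then show "\<bar>\<alpha> k + \<beta> k * digit (h k) x\<bar> \<le> \<bar>\<alpha> k\<bar> + \<bar>\<beta> k\<bar>" by linarith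
      qed simp
    qed
    then show ?thesis by (simp add: dc)
  qed
  \<comment> \<open>A finite set of digits lies below the level \<open>s n\<close> from some stage
    on, and there the truncated code agrees with membership in the basic sets.\<close>
  have ev: "eventually (\<lambda>n. K \<subseteq> {..<s n}) sequentially" if K: "finite K" for K
  proof -
    obtain m where "K \<subseteq> {..<m}" using K finite_nat_iff_bounded by auto
    then have "K \<subseteq> {..<s n}" if "n \<ge> m" for n using seq_suble[OF s, of n] that by fastforce
    then show ?thesis by (auto simp: eventually_sequentially)
  qed
  \<comment> \<open>Both marginals are instances: \<open>h\<close> picks the even or the odd
    positions and \<open>sel\<close> the matching code. The integrals of digit products are even
    constant from some stage on.\<close>
  have eq_law: "distr M ?N (\<lambda>x k. digit (h k) x) = distr R ?N (\<lambda>x k. indicator (W k) x)"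
    if R: "prob_space R" and W: "\<And>k. W k \<in> sets R" and sel: "\<And>z k. dig z (h k) = indicator (sel z) k"
      and sums: "\<And>n f. (\<Sum>z\<in>Z n. w n (fst z) (snd z) * f (sel z)) = (\<integral>x. f (code W n x) \<partial>R)"
    for R :: "'b measure" and W and h :: "nat \<Rightarrow> nat" and sel :: "nat set \<times> nat set \<Rightarrow> nat set"
  proof (rule distr_digits_eqI)
    fix K :: "nat set" and \<alpha> \<beta> assume K: "finite K"
    have "eventually (\<lambda>n. (\<Sum>z\<in>Z (s n). w (s n) (fst z) (snd z) * (\<Prod>k\<in>K. \<alpha> k + \<beta> k * dig z (h k)))
      = (\<integral>x. (\<Prod>k\<in>K. \<alpha> k + \<beta> k * indicator (W k) x) \<partial>R)) sequentially"
      using ev[OF K]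
    proof eventually_elim
      case (elim n)
      have "(\<Sum>z\<in>Z (s n). w (s n) (fst z) (snd z) * (\<Prod>k\<in>K. \<alpha> k + \<beta> k * dig z (h k)))
        = (\<integral>x. (\<Prod>k\<in>K. \<alpha> k + \<beta> k * indicator (code W (s n) x) k) \<partial>R)"
        unfolding sel by (rule sums)
      also have "\<dots> = (\<integral>x. (\<Prod>k\<in>K. \<alpha> k + \<beta> k * indicator (W k) x) \<partial>R)"
        using elim by (intro Bochner_Integration.integral_cong prod.cong refl) (auto simp: indicator_code)
      finally show ?case .
    qed
    from LIMSEQ_unique[OF prodlim[of \<alpha> \<beta> h K] tendsto_eventually[OF this]]
    show "(\<integral>x. (\<Prod>k\<in>K. \<alpha> k + \<beta> k * digit (h k) x) \<partial>M) = (\<integral>x. (\<Prod>k\<in>K. \<alpha> k + \<beta> k * indicator (W k) x) \<partial>R)" .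
  qed (use W d01 M.prob_space_axioms R in auto)
  have eqX: "distr M ?N (\<lambda>x k. digit (2 * k) x) = distr P ?N (\<lambda>x k. indicator (U k) x)"
    by (rule eq_law[OF P.prob_space_axioms U' _ rowsum]) (simp add: dig_def)
  have eqY: "distr M ?N (\<lambda>x k. digit (Suc (2 * k)) x) = distr Q ?N (\<lambda>x k. indicator (V k) x)"
    by (rule eq_law[OF Q.prob_space_axioms V' _ colsum]) (simp add: dig_def)
  obtain rU rV where [measurable]: "rU \<in> borel_measurable ?N" "rV \<in> borel_measurable ?N"
    and rU: "\<And>x. rU (\<lambda>k. indicator (U k) x) = x" and rV: "\<And>x. rV (\<lambda>k. indicator (V k) x) = x"
    using code_retraction[OF U] code_retraction[OF V] by blast
  define X where "X x = rU (\<lambda>k. digit (2 * k) x)" for x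
  define Y where "Y x = rV (\<lambda>k. digit (Suc (2 * k)) x)" for x
  have dX[measurable]: "(\<lambda>x k. digit (2 * k) x) \<in> measurable borel ?N"
    and dY[measurable]: "(\<lambda>x k. digit (Suc (2 * k)) x) \<in> measurable borel ?N"
    and dU[measurable]: "(\<lambda>x k. indicator (U k) x :: real) \<in> measurable borel ?N"
    and dV[measurable]: "(\<lambda>x k. indicator (V k) x :: real) \<in> measurable borel ?N"
    by (rule measurable_PiM_single'; simp)+
  have sM[measurable_cong]: "sets M = sets borel" by simp
  have dXM: "(\<lambda>x k. digit (2 * k) x) \<in> measurable M ?N"
    and dYM: "(\<lambda>x k. digit (Suc (2 * k)) x) \<in> measurable M ?N"
    and dUP: "(\<lambda>x k. indicator (U k) x :: real) \<in> measurable P ?N"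
    and dVQ: "(\<lambda>x k. indicator (V k) x :: real) \<in> measurable Q ?N"
    using dX dY dU dV by (simp_all only: measurable_cong_sets[OF sM refl]
      measurable_cong_sets[OF sP refl] measurable_cong_sets[OF sQ refl])
  have X[measurable]: "X \<in> borel_measurable borel" and Y[measurable]: "Y \<in> borel_measurable borel"
    unfolding X_def Y_def by measurable
  \<comment> \<open>Whether the digits agree with the code of the decoded point depends on the digit
    law alone, and for the law of genuine codes they always agree.\<close>
  have decode: "AE x in M. \<forall>k. indicator (W k) (r (\<lambda>k. digit (h k) x)) = digit (h k) x"
    if [measurable]: "r \<in> borel_measurable ?N" "\<And>k. W k \<in> sets borel"
      and inv: "\<And>x. r (\<lambda>k. indicator (W k) x) = x"
      and law: "distr M ?N (\<lambda>x k. digit (h k) x) = distr R ?N (\<lambda>x k. indicator (W k) x)"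
      and mM: "(\<lambda>x k. digit (h k) x) \<in> measurable M ?N"
      and mR: "(\<lambda>x k. indicator (W k) x :: real) \<in> measurable R ?N"
    for r :: "(nat \<Rightarrow> real) \<Rightarrow> 'b" and W and h :: "nat \<Rightarrow> nat" and R
  proof -
    have [measurable]: "(\<lambda>b. indicator (W k) (r b) :: real) \<in> borel_measurable ?N" for k
      by (rule measurable_compose[where g = "indicator (W k)"]) measurable
    have "{b\<in>space ?N. (indicator (W k) (r b) :: real) = b k} \<in> sets ?N" for k
      by (rule borel_measurable_eq) measurable
    then have [measurable]: "Measurable.pred ?N (\<lambda>b. \<forall>k. indicator (W k) (r b) = b k)"
      by (intro pred_intros_countable) (simp add: pred_def)
    have "AE b in distr R ?N (\<lambda>x k. indicator (W k) x). \<forall>k. indicator (W k) (r b) = b k"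
      by (subst AE_distr_iff[OF mR]) (auto simp: inv)
    then show ?thesis unfolding law[symmetric] by (subst (asm) AE_distr_iff[OF mM]) auto
  qed
  have AEX: "AE x in M. \<forall>k. indicator (U k) (X x) = digit (2 * k) x"
    unfolding X_def by (rule decode[OF _ _ rU eqX dXM dUP]) measurable
  have AEY: "AE x in M. \<forall>k. indicator (V k) (Y x) = digit (Suc (2 * k)) x"
    unfolding Y_def by (rule decode[OF _ _ rV eqY dYM dVQ]) measurable
  define \<pi> where "\<pi> = distr M (borel \<Otimes>\<^sub>M borel) (\<lambda>x. (X x, Y x))"
  have "distr \<pi> borel fst = distr (distr M ?N (\<lambda>x k. digit (2 * k) x)) borel rU"
    unfolding \<pi>_def by (subst (1 2) distr_distr) (auto simp: comp_def X_def)
  also have "\<dots> = P"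
    unfolding eqX by (subst distr_distr) (auto simp: comp_def rU distr_id2[OF sP[symmetric]] dU dUP)
  finally have fst: "distr \<pi> borel fst = P" .
  have "distr \<pi> borel snd = distr (distr M ?N (\<lambda>x k. digit (Suc (2 * k)) x)) borel rV"
    unfolding \<pi>_def by (subst (1 2) distr_distr) (auto simp: comp_def Y_def)
  also have "\<dots> = Q"
    unfolding eqY by (subst distr_distr) (auto simp: comp_def rV distr_id2[OF sQ[symmetric]] dV dVQ)
  finally have snd: "distr \<pi> borel snd = Q" .
  have "\<pi> \<in> couplings borel P Q"
    unfolding couplings_def using fst snd by (auto simp: \<pi>_def intro!: M.prob_space_distr)
  moreover have "(\<integral>z. hmax a n (\<lambda>k. indicator (U k) (fst z) * indicator (V k) (snd z)) \<partial>\<pi>) \<le> r" for n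
  proof -
    have "(\<integral>z. hmax a n (\<lambda>k. indicator (U k) (fst z) * indicator (V k) (snd z)) \<partial>\<pi>)
      = (\<integral>x. hmax a n (\<lambda>k. indicator (U k) (X x) * indicator (V k) (Y x)) \<partial>M)"
      unfolding \<pi>_def by (subst integral_distr) auto
    also have "\<dots> = (\<integral>x. hmax a n (\<lambda>k. digit (2 * k) x * digit (Suc (2 * k)) x) \<partial>M)"
    proof (rule integral_cong_AE)
      show "AE x in M. hmax a n (\<lambda>k. indicator (U k) (X x) * indicator (V k) (Y x))
        = hmax a n (\<lambda>k. digit (2 * k) x * digit (Suc (2 * k)) x)"
        using AEX AEY by eventually_elim simp
    qed measurable
    also have "\<dots> \<le> r"
    proof (rule LIMSEQ_le_const2)
      have bd: "\<bar>hmax a n (\<lambda>k. digit (2 * k) x * digit (Suc (2 * k)) x)\<bar> \<le> (\<Sum>k<n. \<bar>a k\<bar>)" for x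
        by (intro abs_hmax_le) (simp add: abs_mult mult_le_one digit_bounds)
      show "(\<lambda>m. \<Sum>z\<in>Z (s m). w (s m) (fst z) (snd z) *
        hmax a n (\<lambda>k. digit (2 * k) (cantor (dig z)) * digit (Suc (2 * k)) (cantor (dig z))))
        \<longlonglongrightarrow> (\<integral>x. hmax a n (\<lambda>k. digit (2 * k) x * digit (Suc (2 * k)) x) \<partial>M)"
        using bd by (intro lim continuous_on_hmax continuous_intros continuous_on_digit)
      have "(\<Sum>z\<in>Z (s m). w (s m) (fst z) (snd z) *
        hmax a n (\<lambda>k. digit (2 * k) (cantor (dig z)) * digit (Suc (2 * k)) (cantor (dig z)))) \<le> r" if "n \<le> m" for m
      proof -
        \<comment> \<open>The approximate cost increases with the level, so the bound at level
          \<open>s m\<close> applies to the n-th cost.\<close>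
        have "n \<le> s m" using seq_suble[OF s, of m] that by simp
        then have "(\<Sum>z\<in>Z (s m). w (s m) (fst z) (snd z) *
          hmax a n (\<lambda>k. digit (2 * k) (cantor (dig z)) * digit (Suc (2 * k)) (cantor (dig z))))
          \<le> (\<Sum>z\<in>Z (s m). w (s m) (fst z) (snd z) * hmax a (s m) (\<lambda>k. indicator (fst z) k * indicator (snd z) k))"
          unfolding dc by (intro sum_mono mult_left_mono wZ) (simp add: dig_def hmax_mono)
        also have "\<dots> \<le> r"
          using cost[of "s m"] by (simp add: Z_def sum.cartesian_product split_def mult.commute)
        finally show ?thesis .
      qed
      then show "\<exists>N. \<forall>m\<ge>N. (\<Sum>z\<in>Z (s m). w (s m) (fst z) (snd z) *
        hmax a n (\<lambda>k. digit (2 * k) (cantor (dig z)) * digit (Suc (2 * k)) (cantor (dig z)))) \<le> r" by blast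
    qed
    finally show ?thesis .
  qed
  ultimately show ?thesis by blast
qed

text \<open>A nonnegative multiple of the indicator of an open set has open superlevel sets, and a
  maximum exceeds t iff one of its terms does.\<close>

lemma open_hmax:
  fixes V :: "nat \<Rightarrow> 'b::topological_space set"
  assumes V: "\<And>k. open (V k)" and a: "\<And>k. 0 \<le> a k"
  shows "open {y. t < hmax a n (\<lambda>k. indicator I k * indicator (V k) y)}"
proof (induction n)
  case (Suc n)
  have "open {y. t < a n * (indicator I n * indicator (V n) y)}"
  proof (cases "t < 0")
    case True
    then have "{y. t < a n * (indicator I n * indicator (V n) y)} = UNIV"
      using a[of n] by (auto simp: indicator_def intro: less_le_trans)
    then show ?thesis by simp
  next
    case False
    then have "{y. t < a n * (indicator I n * indicator (V n) y)} = (if t < a n * indicator I n then V n else {})"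
      by (auto simp: indicator_def)
    then show ?thesis using V by simp
  qed
  with Suc have "open ({y. t < hmax a n (\<lambda>k. indicator I k * indicator (V k) y)}
    \<union> {y. t < a n * (indicator I n * indicator (V n) y)})" by (rule open_Un)
  moreover have "{y. t < hmax a (Suc n) (\<lambda>k. indicator I k * indicator (V k) y)}
    = {y. t < hmax a n (\<lambda>k. indicator I k * indicator (V k) y)} \<union> {y. t < a n * (indicator I n * indicator (V n) y)}"
    by (auto simp: less_max_iff_disj)
  ultimately show ?case by (simp only:)
qed simp

lemma abs_le_sum: "finite A \<Longrightarrow> i \<in> A \<Longrightarrow> \<bar>f i :: real\<bar> \<le> (\<Sum>i\<in>A. \<bar>f i\<bar>)"
  by (rule member_le_sum) auto

text \<open>A pair consists of a rational function of the code of x and of its c-transform for the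
  approximate cost of the same level. The family is countable and fixed before P and Q, which later
  yields measurability in Q. The zero pair makes it nonempty.\<close>

theorem countable_transport_duality:
  fixes C :: "'b::polish_space \<Rightarrow> 'b \<Rightarrow> real"
  assumes lsc: "lsc_cost C" and nonneg: "\<And>x y. 0 \<le> C x y"
  obtains D :: "(('b \<Rightarrow> real) \<times> ('b \<Rightarrow> real)) set" where
    "countable D" "(\<lambda>_. 0, \<lambda>_. 0) \<in> D"
    "\<And>\<phi> \<psi>. (\<phi>, \<psi>) \<in> D \<Longrightarrow> \<phi> \<in> borel_measurable borel"
    "\<And>\<phi> \<psi>. (\<phi>, \<psi>) \<in> D \<Longrightarrow> \<psi> \<in> borel_measurable borel"
    "\<And>\<phi> \<psi>. (\<phi>, \<psi>) \<in> D \<Longrightarrow> \<exists>B. \<forall>x. \<bar>\<phi> x\<bar> \<le> B \<and> \<bar>\<psi> x\<bar> \<le> B"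
    "\<And>\<phi> \<psi> t. (\<phi>, \<psi>) \<in> D \<Longrightarrow> open {y. t < \<psi> y}"
    "\<And>\<phi> \<psi> x y. (\<phi>, \<psi>) \<in> D \<Longrightarrow> \<phi> x + \<psi> y \<le> C x y"
    "\<And>P Q r. P \<in> probs borel \<Longrightarrow> Q \<in> probs borel \<Longrightarrow> 0 \<le> r \<Longrightarrow>
      (\<And>\<phi> \<psi>. (\<phi>, \<psi>) \<in> D \<Longrightarrow> (\<integral>x. \<phi> x \<partial>P) + (\<integral>y. \<psi> y \<partial>Q) \<le> r) \<Longrightarrow>
      \<exists>\<pi>\<in>couplings borel P Q. (\<integral>\<^sup>+z. ennreal (C (fst z) (snd z)) \<partial>\<pi>) \<le> ennreal r"
proof -
  obtain BB :: "'b set set" where BB: "countable BB" "topological_basis BB"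
    using ex_countable_basis by blast
  have "BB \<noteq> {}" using topological_basisE[OF BB(2), of UNIV undefined] by auto
  define BA where "BA = from_nat_into BB"
  \<comment> \<open>Triples of two basic sets and a rational are enumerated, so \<open>U\<close> and
    \<open>V\<close> each run through the whole basis, with repetitions.\<close>
  define e :: "nat \<Rightarrow> nat \<times> nat \<times> rat" where "e = from_nat"
  define U where "U k = BA (fst (e k))" for k
  define V where "V k = BA (fst (snd (e k)))" for k
  define q :: "nat \<Rightarrow> real" where "q k = of_rat (snd (snd (e k)))" for k
  \<comment> \<open>A box receives its rational as weight only if the cost exceeds that rational on
    the whole box; this keeps every \<open>c n\<close> below the cost.\<close>
  define a where "a k = (if 0 \<le> q k \<and> (\<forall>x\<in>U k. \<forall>y\<in>V k. q k < C x y) then q k else 0)" for k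
  define c where "c n x y = hmax a n (\<lambda>k. indicator (U k) x * indicator (V k) y)" for n and x y :: 'b
  have surj_e: "\<exists>k. e k = z" for z unfolding e_def using surj_from_nat by (metis surjD)
  have rBA: "range BA = BB" unfolding BA_def using BB(1) \<open>BB \<noteq> {}\<close> by (simp add: range_from_nat_into)
  have "range U = range BA" "range V = range BA"
    unfolding U_def V_def using surj_e[of "(_, undefined)"] surj_e[of "(undefined, _, undefined)"]
    by (auto simp: image_iff) (metis fst_conv snd_conv)+
  then have U: "topological_basis (range U)" and V: "topological_basis (range V)" using BB rBA by auto
  have oU: "open (U k)" and oV: "open (V k)" for k
    using topological_basis_open[OF U, of "U k"] topological_basis_open[OF V, of "V k"] by auto
  then have [measurable]: "U k \<in> sets borel" "V k \<in> sets borel" for k by auto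
  have a0: "0 \<le> a k" for k by (simp add: a_def)
  have c_le: "c n x y \<le> C x y" for n x y
    unfolding c_def using nonneg by (intro hmax_le) (auto simp: a_def indicator_def intro: less_imp_le)
  have c_lim: "(\<lambda>n. c n x y) \<longlonglongrightarrow> C x y" for x y
  proof (rule order_tendstoI)
    fix t assume t: "t < C x y"
    \<comment> \<open>Admissible weights are nonnegative, so a cost of 0 is reached through the
      starting value of \<open>hmax\<close> instead of a box.\<close>
    have "max t 0 < C x y \<or> C x y = 0 \<and> t < 0" using t nonneg[of x y] by auto
    then show "\<forall>\<^sub>F n in sequentially. t < c n x y"
    proof
      assume "max t 0 < C x y"
      then obtain s where s: "max t 0 < of_rat s" "of_rat s < C x y" using of_rat_dense by blast
      have "open {p. of_rat s < C (fst p) (snd p)}" using lsc by (simp add: lsc_cost_def)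
      then obtain O1 O2 where O: "open O1" "open O2" "x \<in> O1" "y \<in> O2" "O1 \<times> O2 \<subseteq> {p. of_rat s < C (fst p) (snd p)}"
        using s by (elim open_prod_elim[where x = "(x, y)"]) auto
      obtain U1 where U1: "U1 \<in> range BA" "x \<in> U1" "U1 \<subseteq> O1" using topological_basisE[OF BB(2) O(1,3)] rBA by metis
      obtain V1 where V1: "V1 \<in> range BA" "y \<in> V1" "V1 \<subseteq> O2" using topological_basisE[OF BB(2) O(2,4)] rBA by metis
      from U1 V1 obtain i j where ij: "U1 = BA i" "V1 = BA j" by auto
      obtain k where k: "e k = (i, j, s)" using surj_e by blast
      have UVk: "U k = U1" "V k = V1" "q k = of_rat s" by (simp_all add: U_def V_def q_def k ij)
      have "of_rat s < C x' y'" if "x' \<in> U1" "y' \<in> V1" for x' y'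
        using O(5) U1(3) V1(3) that by (auto dest!: subsetD[of _ _ "(x', y')"])
      then have "a k = of_rat s" using s(1) by (simp add: a_def UVk)
      then have "of_rat s \<le> c n x y" if "k < n" for n
        using hmax_ge[OF that, of a "\<lambda>k. indicator (U k) x * indicator (V k) y"] U1(2) V1(2)
        by (simp add: c_def UVk)
      then have "t < c n x y" if "k < n" for n using s that by fastforce
      then show ?thesis by (auto simp: eventually_sequentially intro!: exI[of _ "Suc k"])
    next
      assume "C x y = 0 \<and> t < 0"
      then show ?thesis by (auto simp: c_def intro!: always_eventually less_le_trans[OF _ hmax_nonneg])
    qed
  next
    fix t assume "C x y < t"
    then show "\<forall>\<^sub>F n in sequentially. c n x y < t" by (intro always_eventually allI) (rule le_less_trans[OF c_le])
  qed
  define h where "h n I J = hmax a n (\<lambda>k. indicator I k * indicator J k)" for n and I J :: "nat set"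
  have h_code: "h n (code U n x) (code V n y) = c n x y" for n x y
    unfolding h_def c_def by (rule hmax_cong) (simp add: indicator_code)
  \<comment> \<open>The c-transform of the table \<open>f\<close>, taken over all labels of atoms
    instead of points; labels of empty atoms can only lower it.\<close>
  define \<psi>' where "\<psi>' n f J = (MIN I\<in>Pow {..<n}. h n I J - f I)" for n and f :: "nat set \<Rightarrow> real" and J
  define pot where "pot n f = (\<lambda>x. f (code U n x), \<lambda>y. \<psi>' n f (code V n y))" for n f
  define F where "F n = PiE (Pow {..<n}) (\<lambda>_. range (of_rat :: rat \<Rightarrow> real))" for n :: nat
  define D where "D = (\<Union>n. pot n ` F n)"
  have D: "\<exists>n f. f \<in> F n \<and> \<phi> = (\<lambda>x. f (code U n x)) \<and> \<psi> = (\<lambda>y. \<psi>' n f (code V n y))" if "(\<phi>, \<psi>) \<in> D" for \<phi> \<psi>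
    using that by (auto simp: D_def pot_def)
  note code_m[measurable] = measurable_code[of U borel] measurable_code[of V borel]
  show ?thesis
  proof (rule that[of D])
    show "countable D"
      unfolding D_def F_def by (intro countable_UN countable_image countable_PiE) auto
    \<comment> \<open>At level 0 there is a single code and the approximate cost is 0, so the zero
      table gives the zero pair.\<close>
    have "(\<lambda>_. 0, \<lambda>_. 0) = pot 0 (\<lambda>I\<in>Pow {..<0}. 0)"
      by (auto simp: pot_def \<psi>'_def code_def h_def)
    moreover have "(\<lambda>I\<in>Pow {..<0}. 0) \<in> F 0" by (auto simp: F_def intro!: image_eqI[of _ _ 0])
    ultimately show "(\<lambda>_. 0, \<lambda>_. 0) \<in> D" by (auto simp: D_def)
  next
    fix \<phi> \<psi> assume "(\<phi>, \<psi>) \<in> D"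
    from D[OF this] obtain n f where f: "f \<in> F n"
      and \<phi>: "\<phi> = (\<lambda>x. f (code U n x))" and \<psi>: "\<psi> = (\<lambda>y. \<psi>' n f (code V n y))" by blast
    show "\<phi> \<in> borel_measurable borel" "\<psi> \<in> borel_measurable borel"
      unfolding \<phi> \<psi> by (rule measurable_compose[OF measurable_code]; simp)+
    show "\<exists>B. \<forall>x. \<bar>\<phi> x\<bar> \<le> B \<and> \<bar>\<psi> x\<bar> \<le> B"
      unfolding \<phi> \<psi> using abs_le_sum[OF _ code_in_Pow, of n f U] abs_le_sum[OF _ code_in_Pow, of n "\<psi>' n f" V]
      by (intro exI[of _ "max (\<Sum>I\<in>Pow {..<n}. \<bar>f I\<bar>) (\<Sum>I\<in>Pow {..<n}. \<bar>\<psi>' n f I\<bar>)"]) (auto simp: le_max_iff_disj)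
    show "open {y. t < \<psi> y}" for t
    proof -
      \<comment> \<open>The cost of level n reads only indices below n, where the truncated code may
        be replaced by membership in the open sets \<open>V k\<close>. This is what makes \<psi>
        lower semicontinuous.\<close>
      have "h n I (code V n y) = hmax a n (\<lambda>k. indicator I k * indicator (V k) y)" for I y
        unfolding h_def by (rule hmax_cong) (simp add: indicator_code)
      then have "{y. t < \<psi> y} = (\<Inter>I\<in>Pow {..<n}. {y. t + f I < hmax a n (\<lambda>k. indicator I k * indicator (V k) y)})"
        unfolding \<psi> \<psi>'_def by (subst Min_gr_iff) (auto simp: less_diff_eq)
      also have "open \<dots>" by (intro open_INT ballI open_hmax oV a0) simp
      finally show ?thesis .
    qed
    show "\<phi> x + \<psi> y \<le> C x y" for x y
    proof -
      have "\<psi> y \<le> h n (code U n x) (code V n y) - f (code U n x)"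
        unfolding \<psi> \<psi>'_def using code_in_Pow[of U n x] by (intro Min_le) auto
      then show ?thesis using c_le[of n x y] by (simp add: h_code \<phi>)
    qed
  next
    fix P Q :: "'b measure" and r :: real
    assume PQ: "P \<in> probs borel" "Q \<in> probs borel" and r: "0 \<le> r"
      and bound: "\<And>\<phi> \<psi>. (\<phi>, \<psi>) \<in> D \<Longrightarrow> (\<integral>x. \<phi> x \<partial>P) + (\<integral>y. \<psi> y \<partial>Q) \<le> r"
    interpret P: prob_space P using PQ by (simp add: probs_def)
    interpret Q: prob_space Q using PQ by (simp add: probs_def)
    have UP: "U k \<in> sets P" and VQ: "V k \<in> sets Q" for k using PQ by (auto simp: probs_def)
    define p where "p n I = measure P {x\<in>space P. code U n x = I}" for n I
    define qq where "qq n I = measure Q {x\<in>space Q. code V n x = I}" for n I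
    define plan where "plan n w \<longleftrightarrow> (\<forall>I\<in>Pow {..<n}. \<forall>J\<in>Pow {..<n}. 0 \<le> w I J)
      \<and> (\<forall>I\<in>Pow {..<n}. (\<Sum>J\<in>Pow {..<n}. w I J) = p n I)
      \<and> (\<forall>J\<in>Pow {..<n}. (\<Sum>I\<in>Pow {..<n}. w I J) = qq n J)
      \<and> (\<Sum>I\<in>Pow {..<n}. \<Sum>J\<in>Pow {..<n}. h n I J * w I J) \<le> r" for n w
    have "\<exists>w. plan n w" for n
      unfolding plan_def
    proof (rule finite_transport_duality)
      show "sum (p n) (Pow {..<n}) = 1" "sum (qq n) (Pow {..<n}) = 1"
        unfolding p_def qq_def using P.sum_code[OF UP] Q.sum_code[OF VQ] by auto
      fix \<phi> :: "nat set \<Rightarrow> real"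
      show "(\<Sum>I\<in>Pow {..<n}. \<phi> I * p n I) + (\<Sum>J\<in>Pow {..<n}. (MIN I\<in>Pow {..<n}. h n I J - \<phi> I) * qq n J) \<le> r"
      proof (rule field_le_epsilon)
        fix \<epsilon> :: real assume "0 < \<epsilon>"
        \<comment> \<open>Rational values slightly below \<phi> lose at most \<epsilon> in the first
          sum, as p has total mass 1, and can only raise the c-transform.\<close>
        have "\<exists>s. \<phi> I - \<epsilon> < of_rat s \<and> of_rat s < \<phi> I" for I using \<open>0 < \<epsilon>\<close> by (intro of_rat_dense) simp
        then obtain g where g: "\<And>I. \<phi> I - \<epsilon> < of_rat (g I)" "\<And>I. of_rat (g I) < \<phi> I" by metis
        define f where "f = restrict (\<lambda>I. of_rat (g I) :: real) (Pow {..<n})"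
        have "f \<in> F n" by (auto simp: f_def F_def)
        then have "pot n f \<in> D" by (auto simp: D_def)
        then have "(\<integral>x. f (code U n x) \<partial>P) + (\<integral>y. \<psi>' n f (code V n y) \<partial>Q) \<le> r"
          unfolding pot_def by (rule bound)
        then have le: "(\<Sum>I\<in>Pow {..<n}. f I * p n I) + (\<Sum>J\<in>Pow {..<n}. \<psi>' n f J * qq n J) \<le> r"
          unfolding P.integral_code[OF UP, where f = f and n = n]
            Q.integral_code[OF VQ, where f = "\<psi>' n f" and n = n] p_def qq_def .
        have "(\<Sum>I\<in>Pow {..<n}. \<phi> I * p n I) \<le> (\<Sum>I\<in>Pow {..<n}. (f I + \<epsilon>) * p n I)"
        proof (intro sum_mono mult_right_mono)
          fix I assume "I \<in> Pow {..<n}"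
          then show "\<phi> I \<le> f I + \<epsilon>" using g(1)[of I] by (simp add: f_def)
        qed (simp add: p_def)
        also have "\<dots> = (\<Sum>I\<in>Pow {..<n}. f I * p n I) + \<epsilon> * sum (p n) (Pow {..<n})"
          by (simp only: distrib_right sum.distrib sum_distrib_left)
        also have "sum (p n) (Pow {..<n}) = 1" unfolding p_def by (rule P.sum_code[OF UP])
        finally have 1: "(\<Sum>I\<in>Pow {..<n}. \<phi> I * p n I) \<le> (\<Sum>I\<in>Pow {..<n}. f I * p n I) + \<epsilon>" by simp
        have "(\<Sum>J\<in>Pow {..<n}. (MIN I\<in>Pow {..<n}. h n I J - \<phi> I) * qq n J) \<le> (\<Sum>J\<in>Pow {..<n}. \<psi>' n f J * qq n J)"
        proof (intro sum_mono mult_right_mono)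
          fix J
          have "(MIN I\<in>Pow {..<n}. h n I J - \<phi> I) \<le> h n I J - f I" if "I \<in> Pow {..<n}" for I
          proof -
            have "(MIN I\<in>Pow {..<n}. h n I J - \<phi> I) \<le> h n I J - \<phi> I" using that by (intro Min_le) auto
            also have "\<dots> \<le> h n I J - f I" using g(2)[of I] that by (simp add: f_def)
            finally show ?thesis .
          qed
          then show "(MIN I\<in>Pow {..<n}. h n I J - \<phi> I) \<le> \<psi>' n f J"
            unfolding \<psi>'_def by (subst Min_ge_iff) auto
        qed (simp add: qq_def)
        with 1 le show "(\<Sum>I\<in>Pow {..<n}. \<phi> I * p n I) + (\<Sum>J\<in>Pow {..<n}. (MIN I\<in>Pow {..<n}. h n I J - \<phi> I) * qq n J) \<le> r + \<epsilon>"
          by linarith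
      qed
    qed (auto simp: p_def qq_def r)
    then obtain w where w: "\<And>n. plan n (w n)"
      by metis
    have "\<exists>\<pi>\<in>couplings borel P Q. \<forall>n.
      (\<integral>z. hmax a n (\<lambda>k. indicator (U k) (fst z) * indicator (V k) (snd z)) \<partial>\<pi>) \<le> r"
    proof (rule coupling_of_finite_plans[where w = w, OF PQ U V])
      fix n :: nat and I J assume "I \<in> Pow {..<n}" "J \<in> Pow {..<n}"
      then show "0 \<le> w n I J" using w[of n] unfolding plan_def by blast
    next
      fix n :: nat and I assume "I \<in> Pow {..<n}"
      then show "(\<Sum>J\<in>Pow {..<n}. w n I J) = measure P {x\<in>space P. code U n x = I}"
        using w[of n] unfolding plan_def p_def by blast
    next
      fix n :: nat and J assume "J \<in> Pow {..<n}"
      then show "(\<Sum>I\<in>Pow {..<n}. w n I J) = measure Q {y\<in>space Q. code V n y = J}"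
        using w[of n] unfolding plan_def qq_def by blast
    next
      fix n :: nat
      show "(\<Sum>I\<in>Pow {..<n}. \<Sum>J\<in>Pow {..<n}. hmax a n (\<lambda>k. indicator I k * indicator J k) * w n I J) \<le> r"
        using w[of n] unfolding plan_def h_def by blast
    qed
    then obtain \<pi> where \<pi>: "\<pi> \<in> couplings borel P Q" and int: "\<And>n. (\<integral>z. c n (fst z) (snd z) \<partial>\<pi>) \<le> r"
      unfolding c_def by blast
    interpret \<pi>: prob_space \<pi> using \<pi> by (simp add: couplings_def)
    have [measurable_cong]: "sets \<pi> = sets (borel \<Otimes>\<^sub>M borel)" using \<pi> by (simp add: couplings_def)
    have [measurable]: "(\<lambda>z. c n (fst z) (snd z)) \<in> borel_measurable \<pi>" for n unfolding c_def by measurable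
    \<comment> \<open>Fatou's lemma lifts the bound from the approximate costs to their
      limit.\<close>
    have "(\<integral>\<^sup>+z. ennreal (C (fst z) (snd z)) \<partial>\<pi>) = (\<integral>\<^sup>+z. liminf (\<lambda>n. ennreal (c n (fst z) (snd z))) \<partial>\<pi>)"
      by (intro nn_integral_cong lim_imp_Liminf[symmetric] tendsto_ennrealI c_lim) simp
    also have "\<dots> \<le> liminf (\<lambda>n. \<integral>\<^sup>+z. ennreal (c n (fst z) (snd z)) \<partial>\<pi>)"
      by (rule nn_integral_liminf) measurable
    also have "\<dots> \<le> ennreal r"
    proof -
      have "(\<integral>\<^sup>+z. ennreal (c n (fst z) (snd z)) \<partial>\<pi>) \<le> ennreal r" for n
      proof -
        have "(\<integral>\<^sup>+z. ennreal (c n (fst z) (snd z)) \<partial>\<pi>) = ennreal (\<integral>z. c n (fst z) (snd z) \<partial>\<pi>)"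
        proof (intro nn_integral_eq_integral \<pi>.integrable_const_bound AE_I2)
          show "norm (c n (fst z) (snd z)) \<le> (\<Sum>k<n. \<bar>a k\<bar>)" for z
            unfolding c_def real_norm_def by (intro abs_hmax_le) (simp add: indicator_def)
        qed (simp_all add: c_def hmax_nonneg)
        then show ?thesis using int[of n] by (simp add: ennreal_leI)
      qed
      then show ?thesis by (intro Liminf_le) auto
    qed
    finally show "\<exists>\<pi>\<in>couplings borel P Q. (\<integral>\<^sup>+z. ennreal (C (fst z) (snd z)) \<partial>\<pi>) \<le> ennreal r"
      using \<pi> by blast
  qed
qed

subsection \<open>De Finetti's theorem\<close>

text \<open>\<open>mix_fin\<close> and \<open>mix_iid\<close> are given by formulas under
  \<open>measure_of\<close>. This identifies them with binds, which are measures already.\<close>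

lemma measure_of_eqI:
  assumes "sets N = sets S" and "\<And>A. A \<in> sets S \<Longrightarrow> f A = emeasure N A"
  shows "measure_of (space S) (sets S) f = N"
proof -
  have "measure_of (space S) (sets S) f = measure_of (space S) (sets S) (emeasure N)"
    using assms(2) by (intro measure_of_eq) (auto simp: sets.sigma_sets_eq sets.space_closed)
  also have "\<dots> = measure_of (space N) (sets N) (emeasure N)"
    using assms(1) sets_eq_imp_space_eq[OF assms(1)] by simp
  finally show ?thesis by (simp add: measure_of_of_measure)
qed

lemma sets_iid: "sets P = sets N \<Longrightarrow> sets (iid P) = sets (iid N)"
  by (intro sets_PiM_cong) auto

lemma prob_space_iid: "prob_space P \<Longrightarrow> prob_space (iid P)"
  by (intro prob_space_PiM) auto

lemma emeasure_iid_Collect: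
  assumes "prob_space P" "finite J" "\<And>i. i \<in> J \<Longrightarrow> A i \<in> sets P"
  shows "emeasure (iid P) {x \<in> space (iid P). \<forall>i\<in>J. x i \<in> A i} = (\<Prod>i\<in>J. emeasure P (A i))"
proof -
  interpret product_prob_space "\<lambda>_. P" UNIV by (intro product_prob_spaceI assms)
  show ?thesis using assms by (intro emeasure_PiM_Collect) auto
qed

text \<open>Cylinders generate the product space, and on a cylinder the kernel is a finite product
  of measurable evaluations.\<close>

lemma measurable_iid [measurable]: "iid \<in> prob_algebra N \<rightarrow>\<^sub>M prob_algebra (iid N)"
proof (rule measurable_prob_algebra_generated[OF sets_PiM Int_stable_prod_algebra prod_algebra_sets_into_space])
  fix P :: "'a measure" assume "P \<in> space (prob_algebra N)"
  then show "prob_space (iid P)" "sets (iid P) = sets (iid N)"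
    by (auto simp: space_prob_algebra intro!: prob_space_iid sets_iid)
next
  fix A assume "A \<in> prod_algebra UNIV (\<lambda>_::nat. N)"
  then obtain J E where JE: "A = prod_emb UNIV (\<lambda>_. N) J (Pi\<^sub>E J E)" "finite J" "\<And>i. i \<in> J \<Longrightarrow> E i \<in> sets N"
    by (auto elim!: prod_algebraE)
  have "emeasure (iid P) A = (\<Prod>i\<in>J. emeasure P (E i))" if "P \<in> space (prob_algebra N)" for P
  proof -
    have P: "prob_space P" "sets P = sets N" using that by (auto simp: space_prob_algebra)
    have "A = {x \<in> space (iid P). \<forall>i\<in>J. x i \<in> E i}"
      using JE sets_eq_imp_space_eq[OF P(2)] by (auto simp: prod_emb_def PiE_iff space_PiM)
    then show ?thesis using emeasure_iid_Collect[OF P(1) JE(2)] JE(3) P(2) by simp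
  qed
  moreover have "(\<lambda>P. \<Prod>i\<in>J. emeasure P (E i)) \<in> borel_measurable (prob_algebra N)"
    unfolding prob_algebra_def
    by (intro borel_measurable_prod_ennreal measurable_restrict_space1 measurable_emeasure_subprob_algebra JE)
  ultimately show "(\<lambda>P. emeasure (iid P) A) \<in> borel_measurable (prob_algebra N)"
    by (simp cong: measurable_cong)
qed

lemma mix_iid_eq_bind:
  assumes "\<nu> \<in> space (prob_algebra (prob_algebra (borel :: 'a::topological_space measure)))"
  shows "mix_iid \<nu> = \<nu> \<bind> iid"
  unfolding mix_iid_def
  by (rule measure_of_eqI) (simp_all add: sets_bind'[OF assms measurable_iid] emeasure_bind_prob_algebra[OF assms measurable_iid])

lemma distr_iid:
  assumes P: "prob_space P" and f: "f \<in> measurable P N"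
  shows "distr (iid P) (iid N) (\<lambda>x i. f (x i)) = iid (distr P N f)"
proof -
  have m: "(\<lambda>x i. f (x i)) \<in> measurable (iid P) (iid N)"
    using f by (intro measurable_PiM_single' measurable_compose[OF measurable_component_singleton])
      (auto simp: space_PiM PiE_iff dest: measurable_space)
  have s: "sets (iid (distr P N f)) = sets (iid N)" by (rule sets_iid) simp
  interpret D: prob_space "distr P N f" by (rule prob_space.prob_space_distr[OF P f])
  interpret I: prob_space "iid P" by (rule prob_space_iid[OF P])
  show ?thesis
  proof (rule measure_eqI_PiM_infinite)
    show "sets (distr (iid P) (iid N) (\<lambda>x i. f (x i))) = sets (iid N)" by simp
    show "sets (iid (distr P N f)) = sets (iid N)" by (rule s)
    show "finite_measure (distr (iid P) (iid N) (\<lambda>x i. f (x i)))"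
      using I.prob_space_distr[OF m] by (simp add: prob_space_def)
    fix A and J :: "nat set" assume J: "finite J" and A: "\<And>i. i \<in> J \<Longrightarrow> A i \<in> sets N"
    let ?E = "prod_emb UNIV (\<lambda>_. N) J (Pi\<^sub>E J A)"
    have E: "?E \<in> sets (iid N)" using J A by (intro sets_PiM_I) auto
    have pre: "(\<lambda>x i. f (x i)) -` ?E \<inter> space (iid P) = {x \<in> space (iid P). \<forall>i\<in>J. x i \<in> f -` A i \<inter> space P}"
      using measurable_space[OF f] by (auto simp: prod_emb_def PiE_iff space_PiM)
    have E': "?E = {x \<in> space (iid (distr P N f)). \<forall>i\<in>J. x i \<in> A i}"
      by (auto simp: prod_emb_def PiE_iff space_PiM)
    have "emeasure (distr (iid P) (iid N) (\<lambda>x i. f (x i))) ?E = (\<Prod>i\<in>J. emeasure P (f -` A i \<inter> space P))"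
      unfolding emeasure_distr[OF m E] pre using J A f P by (intro emeasure_iid_Collect) auto
    also have "\<dots> = (\<Prod>i\<in>J. emeasure (distr P N f) (A i))"
      using A f by (intro prod.cong refl) (simp add: emeasure_distr)
    also have "\<dots> = emeasure (iid (distr P N f)) ?E"
      unfolding E' using J A by (intro emeasure_iid_Collect[symmetric] D.prob_space_axioms) auto
    finally show "emeasure (distr (iid P) (iid N) (\<lambda>x i. f (x i))) ?E = emeasure (iid (distr P N f)) ?E" .
  qed
qed

section \<open>Second moments of exchangeable sequences and convergence of averages\<close>

lemma (in prob_space) expectation_square_combination:
  fixes f :: "nat \<Rightarrow> 'a \<Rightarrow> real"
  assumes "finite I"
    and [measurable]: "\<And>i. f i \<in> borel_measurable M" and B: "\<And>i x. \<bar>f i x\<bar> \<le> B"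
    and diag: "\<And>i. (\<integral>x. f i x * f i x \<partial>M) = v" and off: "\<And>i j. i \<noteq> j \<Longrightarrow> (\<integral>x. f i x * f j x \<partial>M) = w"
  shows "(\<integral>x. (\<Sum>i\<in>I. \<alpha> i * f i x)^2 \<partial>M) = (v - w) * (\<Sum>i\<in>I. (\<alpha> i)^2) + w * (\<Sum>i\<in>I. \<alpha> i)^2"
proof -
  have int: "integrable M (\<lambda>x. f i x * f j x)" for i j
  proof (rule integrable_const_bound[of _ "B * B"])
    show "AE x in M. norm (f i x * f j x) \<le> B * B"
      using B[of i] B[of j] by (auto simp: abs_mult intro!: mult_mono order_trans[OF abs_ge_zero B])
  qed measurable
  have ij: "(\<integral>x. f i x * f j x \<partial>M) = w + (if i = j then v - w else 0)" for i j
    using diag off by simp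
  have "(\<integral>x. (\<Sum>i\<in>I. \<alpha> i * f i x)^2 \<partial>M) = (\<integral>x. (\<Sum>i\<in>I. \<Sum>j\<in>I. \<alpha> i * \<alpha> j * (f i x * f j x)) \<partial>M)"
    by (intro Bochner_Integration.integral_cong refl) (simp add: power2_eq_square sum_product algebra_simps)
  also have "\<dots> = (\<Sum>i\<in>I. \<Sum>j\<in>I. \<alpha> i * \<alpha> j * (w + (if i = j then v - w else 0)))"
    using int by (simp add: ij[symmetric])
  also have "\<dots> = (\<Sum>i\<in>I. \<Sum>j\<in>I. w * (\<alpha> i * \<alpha> j) + (if i = j then (v - w) * (\<alpha> i)^2 else 0))"
    by (intro sum.cong refl) (simp add: algebra_simps power2_eq_square)
  also have "\<dots> = (v - w) * (\<Sum>i\<in>I. (\<alpha> i)^2) + w * (\<Sum>i\<in>I. \<alpha> i)^2"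
  proof -
    have "(\<Sum>i\<in>I. \<Sum>j\<in>I. w * (\<alpha> i * \<alpha> j)) = w * (\<Sum>i\<in>I. \<alpha> i)^2"
      unfolding power2_eq_square sum_product by (simp only: sum_distrib_left)
    then show ?thesis using \<open>finite I\<close> by (simp add: sum.distrib sum_distrib_left)
  qed
  finally show ?thesis .
qed

text \<open>The coefficients of a difference of two averages add up to 0, so the part of the
  covariances common to all pairs drops out, and only the sum of the squared coefficients, 1/n -
  1/N, remains. Independence is not involved.\<close>

lemma (in prob_space) expectation_avg_diff:
  fixes f :: "nat \<Rightarrow> 'a \<Rightarrow> real"
  assumes [measurable]: "\<And>i. f i \<in> borel_measurable M" and f01: "\<And>i x. 0 \<le> f i x" "\<And>i x. f i x \<le> 1"
    and diag: "\<And>i. (\<integral>x. f i x * f i x \<partial>M) = v" and off: "\<And>i j. i \<noteq> j \<Longrightarrow> (\<integral>x. f i x * f j x \<partial>M) = w"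
    and n: "0 < n" "n \<le> N"
  shows "(\<integral>x. ((\<Sum>i<n. f i x) / n - (\<Sum>i<N. f i x) / N)^2 \<partial>M) \<le> 1 / n"
proof -
  define \<alpha> :: "nat \<Rightarrow> real" where "\<alpha> i = (if i < n then 1 / n else 0) - 1 / N" for i
  have N: "0 < N" using n by simp
  have restr: "(\<Sum>i<N. if i < n then g i else 0) = (\<Sum>i<n. g i)" for g :: "nat \<Rightarrow> real"
    using n by (intro sum.mono_neutral_cong_right) auto
  have "(\<Sum>i<n. f i x) / n - (\<Sum>i<N. f i x) / N = (\<Sum>i<N. \<alpha> i * f i x)" for x
  proof -
    have "(\<Sum>i<N. \<alpha> i * f i x) = (\<Sum>i<N. (if i < n then f i x / n else 0) - f i x / N)"
      by (intro sum.cong refl) (simp add: \<alpha>_def algebra_simps)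
    then show ?thesis by (simp add: sum_subtractf restr sum_divide_distrib)
  qed
  then have "(\<integral>x. ((\<Sum>i<n. f i x) / n - (\<Sum>i<N. f i x) / N)^2 \<partial>M)
      = (\<integral>x. (\<Sum>i<N. \<alpha> i * f i x)^2 \<partial>M)" by simp
  also have "\<dots> = (v - w) * (\<Sum>i<N. (\<alpha> i)^2) + w * (\<Sum>i<N. \<alpha> i)^2"
    using f01 by (intro expectation_square_combination[where B = 1] diag off) auto
  also have "(\<Sum>i<N. \<alpha> i) = 0"
    unfolding \<alpha>_def sum_subtractf restr using n by simp
  also have "(\<Sum>i<N. (\<alpha> i)^2) = 1 / n - 1 / N"
  proof -
    have "(\<Sum>i<N. (\<alpha> i)^2) = (\<Sum>i<N. (if i < n then 1 / n^2 - 2 / (n * N) else 0) + 1 / N^2)"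
      by (intro sum.cong refl) (simp add: \<alpha>_def power2_diff power_divide)
    also have "\<dots> = n * (1 / n^2 - 2 / (n * N)) + N * (1 / N^2)"
      unfolding sum.distrib restr by simp
    also have "\<dots> = 1 / n - 1 / N" using n N by (simp add: field_simps power2_eq_square)
    finally show ?thesis .
  qed
  also have "(v - w) * (1 / n - 1 / N) + w * 0^2 \<le> 1 * (1 / n)"
  proof -
    have "v \<le> 1" unfolding diag[of 0, symmetric]
      using f01 by (intro integral_le_const integrable_const_bound[of _ 1]) (auto simp: abs_mult mult_le_one)
    moreover have "0 \<le> w" unfolding off[of 0 1, simplified, symmetric]
      using f01 by (intro integral_nonneg_AE) auto
    ultimately have "v - w \<le> 1" by simp
    moreover have "0 \<le> 1 / real n - 1 / N" "1 / real n - 1 / N \<le> 1 / n"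
      using n N by (auto simp: field_simps)
    ultimately have "(v - w) * (1 / n - 1 / N) \<le> 1 * (1 / real n - 1 / N)"
      by (intro mult_right_mono) auto
    also have "\<dots> \<le> 1 / n" by simp
    finally show ?thesis by simp
  qed
  finally show ?thesis by simp
qed

text \<open>The bounds force mean absolute increments of at most 2^-k. Their sum has finite mean, so
  the telescoping series converges absolutely almost surely.\<close>

lemma (in prob_space) AE_convergent_if_L2_summable:
  fixes X :: "nat \<Rightarrow> 'a \<Rightarrow> real"
  assumes [measurable]: "\<And>k. X k \<in> borel_measurable M" and B: "\<And>k x. \<bar>X k x\<bar> \<le> B"
    and L2: "\<And>k. (\<integral>x. (X k x - X (Suc k) x)^2 \<partial>M) \<le> (1 / 4) ^ k"
  shows "AE x in M. convergent (\<lambda>k. X k x)"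
proof -
  have int: "integrable M (\<lambda>x. (X k x - X (Suc k) x)^2)" for k
  proof (rule integrable_const_bound[of _ "(2 * B)^2"])
    have "\<bar>X k x - X (Suc k) x\<bar> \<le> 2 * B" for x using B[of k x] B[of "Suc k" x] by linarith
    then have "(X k x - X (Suc k) x)^2 \<le> (2 * B)^2" for x
      by (metis abs_ge_zero abs_le_square_iff abs_of_nonneg order_trans)
    then show "AE x in M. norm ((X k x - X (Suc k) x)^2) \<le> (2 * B)^2" by simp
  qed measurable
  have int1: "integrable M (\<lambda>x. \<bar>X (Suc k) x - X k x\<bar>)" for k
  proof (intro integrable_const_bound[of _ "B + B"] AE_I2)
    fix x show "norm \<bar>X (Suc k) x - X k x\<bar> \<le> B + B" using B[of k x] B[of "Suc k" x] by simp
  qed measurable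
  have L1: "(\<integral>\<^sup>+x. ennreal \<bar>X (Suc k) x - X k x\<bar> \<partial>M) \<le> ennreal ((1 / 2) ^ k)" for k
  proof -
    \<comment> \<open>The weight 2^k balances a square of mean 4^-k against the constant
      2^-k.\<close>
    have amgm: "\<bar>d\<bar> \<le> (2 ^ k * d^2 + (1 / 2) ^ k) / 2" for d :: real
    proof -
      have "0 \<le> (2 ^ k * \<bar>d\<bar> - 1)^2" by simp
      then have "2 * (2 ^ k * \<bar>d\<bar>) \<le> 2 ^ k * 2 ^ k * d^2 + 1" by (simp add: power2_diff power_mult_distrib power2_eq_square algebra_simps)
      then have "2 * \<bar>d\<bar> * 2 ^ k \<le> (2 ^ k * d^2 + (1 / 2) ^ k) * 2 ^ k"
        by (simp add: algebra_simps power_divide)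
      then show ?thesis by simp
    qed
    have "(\<integral>x. \<bar>X (Suc k) x - X k x\<bar> \<partial>M) \<le> (\<integral>x. (2 ^ k * (X k x - X (Suc k) x)^2 + (1 / 2) ^ k) / 2 \<partial>M)"
    proof (rule integral_mono)
      fix x show "\<bar>X (Suc k) x - X k x\<bar> \<le> (2 ^ k * (X k x - X (Suc k) x)^2 + (1 / 2) ^ k) / 2"
        using amgm[of "X k x - X (Suc k) x"] by (simp add: abs_minus_commute)
    qed (use int int1 in auto)
    also have "\<dots> = (2 ^ k * (\<integral>x. (X k x - X (Suc k) x)^2 \<partial>M) + (1 / 2) ^ k) / 2"
      using int by (simp add: prob_space)
    also have "\<dots> \<le> (2 ^ k * (1 / 4) ^ k + (1 / 2) ^ k) / 2"
      using L2 by (intro divide_right_mono add_right_mono mult_left_mono) auto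
    also have "(2::real) ^ k * (1 / 4) ^ k = (1 / 2) ^ k" by (simp flip: power_mult_distrib)
    finally have "(\<integral>x. \<bar>X (Suc k) x - X k x\<bar> \<partial>M) \<le> (1 / 2) ^ k" by simp
    then show ?thesis
      using int1 by (subst nn_integral_eq_integral) (auto intro: ennreal_leI)
  qed
  have "(\<integral>\<^sup>+x. (\<Sum>k. ennreal \<bar>X (Suc k) x - X k x\<bar>) \<partial>M) = (\<Sum>k. \<integral>\<^sup>+x. ennreal \<bar>X (Suc k) x - X k x\<bar> \<partial>M)"
    by (rule nn_integral_suminf) measurable
  also have "\<dots> \<le> (\<Sum>k. ennreal ((1 / 2) ^ k))" by (intro suminf_le L1) auto
  also have "\<dots> = ennreal (\<Sum>k. (1 / 2) ^ k)" by (rule suminf_ennreal2) (auto intro: summable_geometric)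
  also have "\<dots> < \<infinity>" by simp
  finally have "AE x in M. (\<Sum>k. ennreal \<bar>X (Suc k) x - X k x\<bar>) \<noteq> \<infinity>"
    by (intro nn_integral_PInf_AE) auto
  then show ?thesis
  proof eventually_elim
    case (elim x)
    then have "summable (\<lambda>k. \<bar>X (Suc k) x - X k x\<bar>)" by (intro summable_suminf_not_top) auto
    then have "summable (\<lambda>k. X (Suc k) x - X k x)" by (rule summable_rabs_cancel)
    then have "convergent (\<lambda>n. X n x - X 0 x)"
      by (simp add: summable_iff_convergent sum_lessThan_telescope[of "\<lambda>k. X k x"])
    then show ?case by (simp add: convergent_diff_const_right_iff)
  qed
qed

lemma Psym_integral:
  fixes g :: "(nat \<Rightarrow> 'a) \<Rightarrow> real"
  assumes Q: "Q \<in> Psym (iid N)" and \<sigma>: "bij \<sigma>" "finite {i. \<sigma> i \<noteq> i}"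
    and g: "g \<in> borel_measurable (iid N)"
  shows "(\<integral>x. g (x \<circ> \<sigma>) \<partial>Q) = (\<integral>x. g x \<partial>Q)"
proof -
  have sQ: "sets Q = sets (iid N)" and inv: "distr Q (iid N) (\<lambda>x. x \<circ> \<sigma>) = Q"
    using Q \<sigma> by (auto simp: Psym_def probs_def)
  have "(\<lambda>x. x \<circ> \<sigma>) \<in> measurable (iid N) (iid N)"
    by (rule measurable_PiM_single') (auto simp: space_PiM PiE_iff comp_def)
  then have m: "(\<lambda>x. x \<circ> \<sigma>) \<in> measurable Q (iid N)"
    by (simp add: measurable_cong_sets[OF sQ refl])
  have "(\<integral>x. g x \<partial>Q) = (\<integral>x. g x \<partial>distr Q (iid N) (\<lambda>x. x \<circ> \<sigma>))" by (simp only: inv)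
  also have "\<dots> = (\<integral>x. g (x \<circ> \<sigma>) \<partial>Q)" by (rule integral_distr[OF m g])
  finally show ?thesis by simp
qed

lemma bij_transpose: "bij (Transposition.transpose i j)" 
  by (rule o_bij[of "Transposition.transpose i j"]) auto

lemma finite_transpose: "finite {k. Transposition.transpose i j k \<noteq> k}"
  by (rule finite_subset[of _ "{i, j}"]) (auto simp: Transposition.transpose_def)

abbreviation avg :: "('a \<Rightarrow> real) \<Rightarrow> nat \<Rightarrow> (nat \<Rightarrow> 'a) \<Rightarrow> real" where
  "avg g k \<omega> \<equiv> (\<Sum>i<(4::nat) ^ k. g (\<omega> i)) / 4 ^ k"

text \<open>Along the lengths \<open>4 ^ k\<close> the squared \<open>L\<^sup>2\<close> errors of the averages decay geometrically, whence almost
  sure convergence. Taking the limes superior makes the limit total and, for every single sequence,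
  monotone in the observable and invariant under finite permutations.\<close>

definition Dlim :: "(real \<Rightarrow> 'a \<Rightarrow> real) \<Rightarrow> real \<Rightarrow> (nat \<Rightarrow> 'a) \<Rightarrow> real" where
  "Dlim f s \<omega> = real_of_ereal (limsup (\<lambda>k. ereal (avg (f s) k \<omega>)))"

text \<open>The index is a real number because the family will consist of the indicators of the
  events that a coded point is at most s.\<close>

locale bounded_observables =
  fixes N :: "'a measure" and f :: "real \<Rightarrow> 'a \<Rightarrow> real"
  assumes f_meas [measurable]: "\<And>s. f s \<in> borel_measurable N"
    and f0: "\<And>s x. 0 \<le> f s x" and f1: "\<And>s x. f s x \<le> 1"
begin

lemma avg_bounds:
  fixes \<omega> :: "nat \<Rightarrow> 'a"
  shows "0 \<le> avg (f s) k \<omega>" "avg (f s) k \<omega> \<le> 1"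
proof -
  show "0 \<le> avg (f s) k \<omega>" using f0 by (simp add: sum_nonneg)
  have "(\<Sum>i<(4::nat) ^ k. f s (\<omega> i)) \<le> of_nat (card {..<(4::nat) ^ k}) * 1" by (rule sum_bounded_above) (rule f1)
  then show "avg (f s) k \<omega> \<le> 1" by simp
qed

lemma abs_avg_le_1: "\<bar>avg (f s) k \<omega>\<bar> \<le> 1" for \<omega> :: "nat \<Rightarrow> 'a"
  unfolding abs_le_iff using avg_bounds[where s = s and k = k and \<omega> = \<omega>] by linarith

lemma limsup_avg_bounds:
  "0 \<le> limsup (\<lambda>k. ereal (avg (f s) k \<omega>))"
  "limsup (\<lambda>k. ereal (avg (f s) k \<omega>)) \<le> 1"
proof -
  have "limsup (\<lambda>k. 0 :: ereal) \<le> limsup (\<lambda>k. ereal (avg (f s) k \<omega>))"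
    by (intro Limsup_mono always_eventually allI) (simp only: ereal_less_eq zero_ereal_def avg_bounds)
  then show "0 \<le> limsup (\<lambda>k. ereal (avg (f s) k \<omega>))" by (simp add: Limsup_const)
  have "limsup (\<lambda>k. ereal (avg (f s) k \<omega>)) \<le> limsup (\<lambda>k. 1 :: ereal)"
    by (intro Limsup_mono always_eventually allI) (simp only: ereal_less_eq one_ereal_def avg_bounds)
  then show "limsup (\<lambda>k. ereal (avg (f s) k \<omega>)) \<le> 1" by (simp add: Limsup_const)
qed

lemma ereal_Dlim: "ereal (Dlim f s \<omega>) = limsup (\<lambda>k. ereal (avg (f s) k \<omega>))"
  unfolding Dlim_def using limsup_avg_bounds[of s \<omega>] by (intro ereal_real') auto

lemma Dlim_bounds: "0 \<le> Dlim f s \<omega>" "Dlim f s \<omega> \<le> 1"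
  using limsup_avg_bounds[of s \<omega>] unfolding ereal_Dlim[symmetric] by (auto simp: one_ereal_def)

lemma Dlim_mono: "(\<And>x. f s x \<le> f t x) \<Longrightarrow> Dlim f s \<omega> \<le> Dlim f t \<omega>"
proof -
  assume "\<And>x. f s x \<le> f t x"
  then have "ereal (Dlim f s \<omega>) \<le> ereal (Dlim f t \<omega>)"
    unfolding ereal_Dlim by (intro Limsup_mono always_eventually allI) (auto intro!: divide_right_mono sum_mono)
  then show ?thesis by simp
qed

lemma Dlim_const: "(\<And>x. f s x = b) \<Longrightarrow> Dlim f s \<omega> = b"
  unfolding Dlim_def by (simp add: Limsup_const)

lemma Dlim_measurable [measurable]: "Dlim f s \<in> borel_measurable (iid N)"
  unfolding Dlim_def by measurable

lemma Dlim_eqI: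
  assumes "(\<lambda>k. avg (f s) k \<omega>) \<longlonglongrightarrow> l" shows "Dlim f s \<omega> = l"
proof -
  have "(\<lambda>k. ereal (avg (f s) k \<omega>)) \<longlonglongrightarrow> ereal l" using assms by simp
  then have "limsup (\<lambda>k. ereal (avg (f s) k \<omega>)) = ereal l"
    by (intro lim_imp_Limsup) auto
  then show ?thesis by (simp add: Dlim_def)
qed

text \<open>Beyond its last displaced index a finite permutation only rearranges the summands of an
  initial segment, so all long averages agree.\<close>

lemma Dlim_permute:
  assumes "bij \<sigma>" "finite {i. \<sigma> i \<noteq> i}"
  shows "Dlim f s (\<omega> \<circ> \<sigma>) = Dlim f s \<omega>"
proof -
  obtain m where m: "{i. \<sigma> i \<noteq> i} \<subseteq> {..<m}" using assms(2) finite_nat_iff_bounded by auto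
  have eq: "(\<Sum>i<n. f s ((\<omega> \<circ> \<sigma>) i)) = (\<Sum>i<n. f s (\<omega> i))" if "m \<le> n" for n
  proof -
    have out: "\<sigma> i = i" if "n \<le> i" for i using m \<open>m \<le> n\<close> that by force
    have "\<sigma> ` {..<n} \<subseteq> {..<n}"
    proof (intro subsetI, elim imageE)
      fix i j assume "i \<in> {..<n}" "j = \<sigma> i"
      then show "j \<in> {..<n}"
        using out[of j] assms(1) by (metis bij_is_inj injD lessThan_iff not_less)
    qed
    moreover have "inj_on \<sigma> {..<n}" using assms(1) by (meson bij_is_inj inj_on_subset subset_UNIV)
    ultimately have "bij_betw \<sigma> {..<n} {..<n}" by (simp add: bij_betw_def endo_inj_surj)
    then show ?thesis unfolding comp_def by (rule sum.reindex_bij_betw)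
  qed
  have "\<forall>\<^sub>F k in sequentially. ereal (avg (f s) k (\<omega> \<circ> \<sigma>)) = ereal (avg (f s) k \<omega>)"
  proof (rule eventually_sequentiallyI)
    fix k assume "m \<le> k"
    moreover have "k < 4 ^ k" by (rule power_gt_expt) simp
    ultimately show "ereal (avg (f s) k (\<omega> \<circ> \<sigma>)) = ereal (avg (f s) k \<omega>)"
      by (subst eq) auto
  qed
  then show ?thesis unfolding Dlim_def by (intro arg_cong[where f = real_of_ereal] Limsup_eq)
qed

lemma AE_avg_tendsto_Dlim:
  assumes Q: "Q \<in> Psym (iid N)"
  shows "AE \<omega> in Q. (\<lambda>k. avg (f s) k \<omega>) \<longlonglongrightarrow> Dlim f s \<omega>"
proof -
  have sQ[measurable_cong]: "sets Q = sets (iid N)" using Q by (auto simp: Psym_def probs_def)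
  interpret prob_space Q using Q by (auto simp: Psym_def probs_def)
  define v where "v = (\<integral>\<omega>. f s (\<omega> 0) * f s (\<omega> 0) \<partial>Q)"
  define w where "w = (\<integral>\<omega>. f s (\<omega> 0) * f s (\<omega> 1) \<partial>Q)"
  have diag: "(\<integral>\<omega>. f s (\<omega> i) * f s (\<omega> i) \<partial>Q) = v" for i
    using Psym_integral[OF Q bij_transpose finite_transpose, of "\<lambda>\<omega>. f s (\<omega> 0) * f s (\<omega> 0)" 0 i]
    by (simp add: v_def)
  have off: "(\<integral>\<omega>. f s (\<omega> i) * f s (\<omega> j) \<partial>Q) = w" if "i \<noteq> j" for i j
  proof -
    \<comment> \<open>Two transpositions reduce any pair to (0, 1): the first moves i to 0, the
      second moves the image \<open>j'\<close> of j to 1.\<close>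
    define \<tau> where "\<tau> = Transposition.transpose 0 i"
    have "bij \<tau>" "finite {k. \<tau> k \<noteq> k}" unfolding \<tau>_def by (rule bij_transpose finite_transpose)+
    define j' where "j' = \<tau> j"
    have "j' \<noteq> 0" using that by (auto simp: j'_def \<tau>_def Transposition.transpose_def)
    have "(\<integral>\<omega>. f s (\<omega> i) * f s (\<omega> j) \<partial>Q) = (\<integral>\<omega>. f s ((\<omega> \<circ> \<tau>) i) * f s ((\<omega> \<circ> \<tau>) j) \<partial>Q)"
      using Psym_integral[OF Q \<open>bij \<tau>\<close> \<open>finite {k. \<tau> k \<noteq> k}\<close>, of "\<lambda>\<omega>. f s (\<omega> i) * f s (\<omega> j)"] by simp
    also have "\<dots> = (\<integral>\<omega>. f s (\<omega> 0) * f s (\<omega> j') \<partial>Q)" by (simp add: \<tau>_def j'_def)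
    also have "\<dots> = w"
      using Psym_integral[OF Q bij_transpose finite_transpose, of "\<lambda>\<omega>. f s (\<omega> 0) * f s (\<omega> 1)" 1 j'] \<open>j' \<noteq> 0\<close>
      by (simp add: w_def Transposition.transpose_def)
    finally show ?thesis .
  qed
  have "AE \<omega> in Q. convergent (\<lambda>k. avg (f s) k \<omega>)"
  proof (rule AE_convergent_if_L2_summable)
    show "\<bar>avg (f s) k \<omega>\<bar> \<le> 1" for k \<omega>
      by (rule abs_avg_le_1)
    show "(\<integral>\<omega>. (avg (f s) k \<omega> - (\<Sum>i<4 ^ Suc k. f s (\<omega> i)) / 4 ^ Suc k)\<^sup>2 \<partial>Q) \<le> (1 / 4) ^ k" for k
      using expectation_avg_diff[of "\<lambda>i \<omega>. f s (\<omega> i)" v w "4 ^ k" "4 ^ Suc k", OF _ _ _ diag off] f0 f1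
      by (simp add: power_divide)
  qed measurable
  then show ?thesis
  proof eventually_elim
    case (elim \<omega>)
    then obtain l where "(\<lambda>k. avg (f s) k \<omega>) \<longlonglongrightarrow> l" by (auto simp: convergent_def)
    with Dlim_eqI[OF this] show ?case by simp
  qed
qed

text \<open>By exchangeability one coordinate may be replaced by any other one not occurring in the rest
  of the integrand, hence by an average of such coordinates, hence by the limit of the averages.\<close>

lemma replace_coordinate:
  assumes Q: "Q \<in> Psym (iid N)" and J: "finite J" "j \<notin> J"
    and Y[measurable]: "Y \<in> borel_measurable (iid N)" and B: "\<And>\<omega>. \<bar>Y \<omega>\<bar> \<le> B"
    and inv: "\<And>\<sigma> \<omega>. bij \<sigma> \<Longrightarrow> finite {i. \<sigma> i \<noteq> i} \<Longrightarrow> (\<And>i. i \<in> J \<Longrightarrow> \<sigma> i = i) \<Longrightarrow> Y (\<omega> \<circ> \<sigma>) = Y \<omega>"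
  shows "(\<integral>\<omega>. f s (\<omega> j) * Y \<omega> \<partial>Q) = (\<integral>\<omega>. Dlim f s \<omega> * Y \<omega> \<partial>Q)"
proof -
  have sQ[measurable_cong]: "sets Q = sets (iid N)" using Q by (auto simp: Psym_def probs_def)
  interpret prob_space Q using Q by (auto simp: Psym_def probs_def)
  have B0: "0 \<le> B" using B[of undefined] by linarith
  define e where "e = (\<integral>\<omega>. f s (\<omega> j) * Y \<omega> \<partial>Q)"
  have int: "integrable Q (\<lambda>\<omega>. f s (\<omega> l) * Y \<omega>)" for l
  proof (rule integrable_const_bound[of _ "1 * B"])
    show "AE \<omega> in Q. norm (f s (\<omega> l) * Y \<omega>) \<le> 1 * B"
      unfolding real_norm_def abs_mult using f0 f1 B B0 by (intro AE_I2 mult_mono) auto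
  qed measurable
  have bd: "\<bar>\<integral>\<omega>. f s (\<omega> l) * Y \<omega> \<partial>Q\<bar> \<le> B" for l
  proof -
    have "\<bar>\<integral>\<omega>. f s (\<omega> l) * Y \<omega> \<partial>Q\<bar> \<le> (\<integral>\<omega>. \<bar>f s (\<omega> l) * Y \<omega>\<bar> \<partial>Q)" by (rule integral_abs_bound)
    also have "\<dots> \<le> 1 * B"
    proof (rule integral_le_const[OF integrable_abs[OF int]], rule AE_I2)
      fix \<omega> show "\<bar>f s (\<omega> l) * Y \<omega>\<bar> \<le> 1 * B"
        unfolding abs_mult using f0 f1 B B0 by (intro mult_mono) auto
    qed
    finally show ?thesis by simp
  qed
  have same: "(\<integral>\<omega>. f s (\<omega> l) * Y \<omega> \<partial>Q) = e" if "l \<notin> J" for l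
  proof -
    let ?\<tau> = "Transposition.transpose j l"
    have "Y (\<omega> \<circ> ?\<tau>) = Y \<omega>" for \<omega>
      using J that by (intro inv bij_transpose finite_transpose) (auto simp: Transposition.transpose_def)
    then show ?thesis
      using Psym_integral[OF Q bij_transpose finite_transpose, of "\<lambda>\<omega>. f s (\<omega> j) * Y \<omega>" j l]
      by (simp add: e_def)
  qed
  \<comment> \<open>Only indices in \<open>J\<close> can spoil the average: at most
    \<open>card J\<close> out of 4^k, each with error at most \<open>2 * B\<close>.\<close>
  have avg: "\<bar>(\<integral>\<omega>. avg (f s) k \<omega> * Y \<omega> \<partial>Q) - e\<bar> \<le> 2 * B * card J * (1 / 4) ^ k" for k
  proof -
    have "(\<integral>\<omega>. avg (f s) k \<omega> * Y \<omega> \<partial>Q) = (\<integral>\<omega>. (\<Sum>i<(4::nat) ^ k. f s (\<omega> i) * Y \<omega>) / 4 ^ k \<partial>Q)"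
      by (simp add: sum_distrib_right)
    also have "\<dots> = (\<Sum>i<(4::nat) ^ k. \<integral>\<omega>. f s (\<omega> i) * Y \<omega> \<partial>Q) / 4 ^ k"
      using int by simp
    also have "\<dots> - e = (\<Sum>i<(4::nat) ^ k. (\<integral>\<omega>. f s (\<omega> i) * Y \<omega> \<partial>Q) - e) / 4 ^ k"
      by (simp add: sum_subtractf field_simps)
    finally have "\<bar>(\<integral>\<omega>. avg (f s) k \<omega> * Y \<omega> \<partial>Q) - e\<bar>
      = \<bar>\<Sum>i<4 ^ k. (\<integral>\<omega>. f s (\<omega> i) * Y \<omega> \<partial>Q) - e\<bar> / 4 ^ k" by simp
    also have "\<bar>\<Sum>i<4 ^ k. (\<integral>\<omega>. f s (\<omega> i) * Y \<omega> \<partial>Q) - e\<bar> \<le> (\<Sum>i<(4::nat) ^ k. if i \<in> J then 2 * B else 0)"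
    proof (intro order_trans[OF sum_abs] sum_mono)
      fix i show "\<bar>(\<integral>\<omega>. f s (\<omega> i) * Y \<omega> \<partial>Q) - e\<bar> \<le> (if i \<in> J then 2 * B else 0)"
        using same[of i] bd[of i] bd[of j] unfolding e_def[symmetric] by auto
    qed
    also have "\<dots> = 2 * B * card ({..<(4::nat) ^ k} \<inter> J)" by (simp add: sum.If_cases)
    also have "\<dots> \<le> 2 * B * card J"
      using B0 J by (intro mult_left_mono) (auto intro: card_mono)
    finally show ?thesis by (simp add: divide_right_mono power_divide)
  qed
  have "(\<lambda>k. \<integral>\<omega>. avg (f s) k \<omega> * Y \<omega> \<partial>Q) \<longlonglongrightarrow> e"
  proof (rule LIM_zero_cancel, rule Lim_null_comparison)
    show "\<forall>\<^sub>F k in sequentially. norm ((\<integral>\<omega>. avg (f s) k \<omega> * Y \<omega> \<partial>Q) - e) \<le> 2 * B * card J * (1 / 4) ^ k"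
      using avg by simp
    have "(\<lambda>k. 2 * B * card J * (1 / 4 :: real) ^ k) \<longlonglongrightarrow> 2 * B * card J * 0"
      by (intro tendsto_intros LIMSEQ_power_zero) simp
    then show "(\<lambda>k. 2 * B * card J * (1 / 4 :: real) ^ k) \<longlonglongrightarrow> 0" by simp
  qed
  moreover have "(\<lambda>k. \<integral>\<omega>. avg (f s) k \<omega> * Y \<omega> \<partial>Q) \<longlonglongrightarrow> (\<integral>\<omega>. Dlim f s \<omega> * Y \<omega> \<partial>Q)"
  proof (rule integral_dominated_convergence[where w = "\<lambda>_. 1 * B"])
    show "AE \<omega> in Q. (\<lambda>k. avg (f s) k \<omega> * Y \<omega>) \<longlonglongrightarrow> Dlim f s \<omega> * Y \<omega>"
      using AE_avg_tendsto_Dlim[OF Q, of s] by eventually_elim (intro tendsto_intros)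
    show "AE \<omega> in Q. norm (avg (f s) k \<omega> * Y \<omega>) \<le> 1 * B" for k
      unfolding real_norm_def abs_mult by (intro AE_I2 mult_mono abs_avg_le_1 B) simp_all
  qed measurable
  ultimately show ?thesis unfolding e_def by (rule LIMSEQ_unique)
qed

text \<open>Coordinates are replaced one at a time. \<open>Z\<close> collects the limits already
  inserted and is invariant under all finite permutations, while the product of the remaining
  coordinates is invariant under those fixing their indices.\<close>

lemma expectation_prod_eq_Dlim:
  assumes Q: "Q \<in> Psym (iid N)" and J: "finite J"
    and Z: "Z \<in> borel_measurable (iid N)" and B: "\<And>\<omega>. \<bar>Z \<omega>\<bar> \<le> B"
    and inv: "\<And>\<sigma> \<omega>. bij \<sigma> \<Longrightarrow> finite {i. \<sigma> i \<noteq> i} \<Longrightarrow> Z (\<omega> \<circ> \<sigma>) = Z \<omega>"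
  shows "(\<integral>\<omega>. (\<Prod>j\<in>J. f (s j) (\<omega> j)) * Z \<omega> \<partial>Q) = (\<integral>\<omega>. (\<Prod>j\<in>J. Dlim f (s j) \<omega>) * Z \<omega> \<partial>Q)"
  using J Z B inv
proof (induction J arbitrary: Z)
  case (insert j J)
  note [measurable] = insert.prems(1)
  have prod_bd: "\<bar>\<Prod>j\<in>J. f (s j) (\<omega> j)\<bar> \<le> 1" for \<omega>
    unfolding abs_prod using f0 f1 by (intro prod_le_1) auto
  have B0: "0 \<le> B" using insert.prems(2)[of undefined] by linarith
  have "(\<integral>\<omega>. (\<Prod>j\<in>insert j J. f (s j) (\<omega> j)) * Z \<omega> \<partial>Q)
    = (\<integral>\<omega>. f (s j) (\<omega> j) * ((\<Prod>j\<in>J. f (s j) (\<omega> j)) * Z \<omega>) \<partial>Q)"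
    using insert.hyps by (simp add: mult.assoc)
  also have "\<dots> = (\<integral>\<omega>. Dlim f (s j) \<omega> * ((\<Prod>j\<in>J. f (s j) (\<omega> j)) * Z \<omega>) \<partial>Q)"
  proof (rule replace_coordinate[OF Q insert.hyps])
    show "\<bar>(\<Prod>j\<in>J. f (s j) (\<omega> j)) * Z \<omega>\<bar> \<le> 1 * B" for \<omega>
      unfolding abs_mult using prod_bd[of \<omega>] insert.prems(2)[of \<omega>] B0 by (intro mult_mono) auto
    fix \<sigma> \<omega> assume "bij \<sigma>" "finite {i. \<sigma> i \<noteq> i}" "\<And>i. i \<in> J \<Longrightarrow> \<sigma> i = i"
    then have "(\<Prod>j\<in>J. f (s j) ((\<omega> \<circ> \<sigma>) j)) = (\<Prod>j\<in>J. f (s j) (\<omega> j))" "Z (\<omega> \<circ> \<sigma>) = Z \<omega>"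
      by (simp, intro insert.prems(3))
    then show "(\<Prod>j\<in>J. f (s j) ((\<omega> \<circ> \<sigma>) j)) * Z (\<omega> \<circ> \<sigma>) = (\<Prod>j\<in>J. f (s j) (\<omega> j)) * Z \<omega>"
      by (simp only:)
  qed measurable
  also have "\<dots> = (\<integral>\<omega>. (\<Prod>j\<in>J. f (s j) (\<omega> j)) * (Dlim f (s j) \<omega> * Z \<omega>) \<partial>Q)"
    by (simp add: algebra_simps)
  also have "\<dots> = (\<integral>\<omega>. (\<Prod>j\<in>J. Dlim f (s j) \<omega>) * (Dlim f (s j) \<omega> * Z \<omega>) \<partial>Q)"
  proof (rule insert.IH)
    show "\<bar>Dlim f (s j) \<omega> * Z \<omega>\<bar> \<le> B" for \<omega>
      using mult_mono[of "\<bar>Dlim f (s j) \<omega>\<bar>" 1 "\<bar>Z \<omega>\<bar>" B] Dlim_bounds[of "s j" \<omega>] insert.prems(2)[of \<omega>] B0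
      by (simp add: abs_mult)
    show "Dlim f (s j) (\<omega> \<circ> \<sigma>) * Z (\<omega> \<circ> \<sigma>) = Dlim f (s j) \<omega> * Z \<omega>"
      if "bij \<sigma>" "finite {i. \<sigma> i \<noteq> i}" for \<sigma> \<omega>
      by (simp only: Dlim_permute[OF that] insert.prems(3)[OF that])
  qed measurable
  also have "\<dots> = (\<integral>\<omega>. (\<Prod>j\<in>insert j J. Dlim f (s j) \<omega>) * Z \<omega> \<partial>Q)"
    using insert.hyps by (simp add: algebra_simps)
  finally show ?case .
qed simp

end

text \<open>Together with stability under intersection this says that joint distribution functions
  determine a law on real sequences.\<close>

lemma sigma_sets_lower_orthants:
  "sets (iid (borel :: real measure)) = sigma_sets UNIV {{y. \<forall>i\<in>J. y i \<le> s i} | J s. finite (J :: nat set)}"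
proof -
  let ?P = "{{y \<in> (\<Pi>\<^sub>E i\<in>UNIV. UNIV). \<forall>i\<in>j. y i \<in> A i} | A j. j \<in> {j :: nat set. finite j} \<and> A \<in> Pi j (\<lambda>_. range (\<lambda>a::real. {..a}))}"
  have "sets (iid (borel :: real measure)) = sets (\<Pi>\<^sub>M i\<in>(UNIV::nat set). sigma UNIV (range (\<lambda>a::real. {..a})))"
    by (simp only: borel_eq_atMost)
  also have "\<dots> = sets (sigma (\<Pi>\<^sub>E i\<in>UNIV. UNIV) ?P)"
  proof (rule sets_PiM_sigma)
    have "x \<in> (\<Union>n. {..real n})" for x by (auto intro: real_arch_simple)
    then have "UNIV = \<Union> (range (\<lambda>n. {..real n}))" by auto
    then show "\<exists>S\<subseteq>range (\<lambda>a::real. {..a}). countable S \<and> UNIV = \<Union>S"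
      by (intro exI[of _ "range (\<lambda>n. {..real n})"]) auto
  qed auto
  also have "?P = {{y. \<forall>i\<in>J. y i \<le> s i} | J s. finite J}"
  proof (intro set_eqI iffI)
    fix B assume "B \<in> ?P"
    then obtain A J where J: "finite J" "A \<in> Pi J (\<lambda>_. range (\<lambda>a::real. {..a}))" and B: "B = {y. \<forall>i\<in>J. y i \<in> A i}"
      by auto
    then have "\<forall>i\<in>J. \<exists>a. A i = {..a}" by auto
    then obtain s where "\<forall>i\<in>J. A i = {..s i}" by metis
    then have "B = {y. \<forall>i\<in>J. y i \<le> s i}" unfolding B by auto
    with J show "B \<in> {{y. \<forall>i\<in>J. y i \<le> s i} | J s. finite J}" by blast
  next
    fix B assume "B \<in> {{y :: nat \<Rightarrow> real. \<forall>i\<in>J. y i \<le> s i} | J s. finite J}"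
    then obtain J s where "finite J" "B = {y. \<forall>i\<in>J. y i \<le> s i}" by auto
    then show "B \<in> ?P" by (intro CollectI exI[of _ "\<lambda>i. {..s i}"] exI[of _ J]) auto
  qed
  finally show ?thesis by simp
qed

lemma Int_stable_lower_orthants:
  "Int_stable {{y :: nat \<Rightarrow> real. \<forall>i\<in>J. y i \<le> s i} | J s. finite J}"
proof (rule Int_stableI)
  fix A B :: "(nat \<Rightarrow> real) set"
  assume "A \<in> {{y. \<forall>i\<in>J. y i \<le> s i} | J s. finite J}" "B \<in> {{y. \<forall>i\<in>J. y i \<le> s i} | J s. finite J}"
  then obtain J s J' s' where J: "finite J" "finite J'"
    and AB: "A = {y. \<forall>i\<in>J. y i \<le> s i}" "B = {y. \<forall>i\<in>J'. y i \<le> s' i}" by auto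
  define t where "t i = (if i \<in> J then if i \<in> J' then min (s i) (s' i) else s i else s' i)" for i
  have "A \<inter> B = {y. \<forall>i\<in>J \<union> J'. y i \<le> t i}"
    unfolding AB by (auto simp: t_def split: if_splits)
  with J show "A \<inter> B \<in> {{y. \<forall>i\<in>J. y i \<le> s i} | J s. finite J}"
    by (intro CollectI exI[of _ "J \<union> J'"] exI[of _ t]) simp
qed

section \<open>The directing random measure of a real observable\<close>

locale unit_observable =
  fixes N :: "'a measure" and T :: "'a \<Rightarrow> real"
  assumes T_meas [measurable]: "T \<in> borel_measurable N"
    and T0: "\<And>x. 0 \<le> T x" and T1: "\<And>x. T x \<le> 1"
begin

definition below :: "real \<Rightarrow> 'a \<Rightarrow> real" where "below s x = indicator {..s} (T x)"

sublocale bounded_observables N below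
proof
  show "below s \<in> borel_measurable N" for s unfolding below_def[abs_def] by measurable
qed (auto simp: below_def indicator_def)

text \<open>The limes superior of empirical distribution functions is monotone in s for every
  sequence but need not be right-continuous. The infimum from the right repairs this and still has a
  value for every sequence.\<close>

definition lim_cdf :: "(nat \<Rightarrow> 'a) \<Rightarrow> real \<Rightarrow> real" where
  "lim_cdf \<omega> s = (INF m. Dlim below (s + 1 / Suc m) \<omega>)"

lemma Dlim_below_mono: "s \<le> t \<Longrightarrow> Dlim below s \<omega> \<le> Dlim below t \<omega>"
  by (rule Dlim_mono) (auto simp: below_def indicator_def)

lemma bdd_below_Dlim: "bdd_below (range (\<lambda>m. Dlim below (s + 1 / Suc m) \<omega>))"
  using Dlim_bounds by (intro bdd_belowI[of _ 0]) auto

lemma lim_cdf_le: "s < t \<Longrightarrow> lim_cdf \<omega> s \<le> Dlim below t \<omega>"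
proof -
  assume "s < t"
  then obtain m where "inverse (real (Suc m)) < t - s" using reals_Archimedean[of "t - s"] by auto
  then have "s + 1 / Suc m \<le> t" by (simp add: inverse_eq_divide)
  then have "Dlim below (s + 1 / Suc m) \<omega> \<le> Dlim below t \<omega>" by (rule Dlim_below_mono)
  then show ?thesis unfolding lim_cdf_def by (rule cINF_lower2[OF bdd_below_Dlim UNIV_I])
qed

lemma lim_cdf_ge: "Dlim below s \<omega> \<le> lim_cdf \<omega> s"
  unfolding lim_cdf_def by (intro cINF_greatest Dlim_below_mono) auto

lemma lim_cdf_bounds: "0 \<le> lim_cdf \<omega> s" "lim_cdf \<omega> s \<le> 1"
  using order_trans[OF Dlim_bounds(1) lim_cdf_ge] order_trans[OF lim_cdf_le[of s "s + 1"] Dlim_bounds(2)] by auto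

lemma lim_cdf_mono: "s \<le> t \<Longrightarrow> lim_cdf \<omega> s \<le> lim_cdf \<omega> t"
  by (cases "s = t") (auto intro: order_trans[OF lim_cdf_le lim_cdf_ge])

lemma lim_cdf_0: "s < 0 \<Longrightarrow> lim_cdf \<omega> s = 0"
proof -
  assume "s < 0"
  \<comment> \<open>\<open>lim_cdf_le\<close> compares with a strictly larger threshold; s / 2 is
    one that is still negative.\<close>
  have "\<not> T x \<le> s / 2" for x using T0[of x] \<open>s < 0\<close> by linarith
  then have "Dlim below (s / 2) \<omega> = 0"
    by (intro Dlim_const) (simp add: below_def)
  then show ?thesis using lim_cdf_le[of s "s / 2" \<omega>] lim_cdf_bounds[of \<omega> s] \<open>s < 0\<close> by simp
qed

lemma lim_cdf_1: "1 \<le> s \<Longrightarrow> lim_cdf \<omega> s = 1"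
proof -
  assume "1 \<le> s"
  have "Dlim below s \<omega> = 1"
    using \<open>1 \<le> s\<close> order_trans[OF T1] by (intro Dlim_const) (auto simp: below_def indicator_def)
  then show ?thesis using lim_cdf_ge[of s \<omega>] lim_cdf_bounds[of \<omega> s] by simp
qed

lemma tendsto_lim_cdf: "(\<lambda>m. Dlim below (s + 1 / Suc m) \<omega>) \<longlonglongrightarrow> lim_cdf \<omega> s"
  unfolding lim_cdf_def
  by (intro LIMSEQ_decseq_INF bdd_below_Dlim) (auto simp: decseq_def intro!: Dlim_below_mono simp: frac_le)

lemma lim_cdf_measurable [measurable]: "(\<lambda>\<omega>. lim_cdf \<omega> s) \<in> borel_measurable (iid N)"
  by (rule borel_measurable_LIMSEQ_real[OF tendsto_lim_cdf]) measurable

lemma lim_cdf_right_continuous: "continuous (at_right a) (lim_cdf \<omega>)"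
  unfolding continuous_within
proof (rule order_tendstoI)
  fix b assume "b < lim_cdf \<omega> a"
  then show "\<forall>\<^sub>F s in at_right a. b < lim_cdf \<omega> s"
    unfolding eventually_at_right_field using lim_cdf_mono[of a _ \<omega>]
    by (intro exI[of _ "a + 1"]) (auto intro: less_le_trans)
next
  fix b assume "lim_cdf \<omega> a < b"
  then have "\<forall>\<^sub>F m in sequentially. Dlim below (a + 1 / Suc m) \<omega> < b"
    using tendsto_lim_cdf by (rule order_tendstoD(2)[rotated])
  then obtain m where m: "Dlim below (a + 1 / Suc m) \<omega> < b" by (auto simp: eventually_sequentially)
  show "\<forall>\<^sub>F s in at_right a. lim_cdf \<omega> s < b"
    unfolding eventually_at_right_field
    by (intro exI[of _ "a + 1 / Suc m"]) (auto intro: le_less_trans[OF lim_cdf_le m])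
qed

lemma lim_cdf_at_bot: "(lim_cdf \<omega> \<longlongrightarrow> 0) at_bot"
  by (rule tendsto_eventually) (auto simp: eventually_at_bot_linorder lim_cdf_0 intro!: exI[of _ "-1"])

lemma lim_cdf_at_top: "(lim_cdf \<omega> \<longlongrightarrow> 1) at_top"
  by (rule tendsto_eventually) (auto simp: eventually_at_top_linorder lim_cdf_1 intro!: exI[of _ 1])

text \<open>\<open>lim_cdf\<close> is a distribution function for every sequence, not only almost
  surely, so this is a probability kernel with no exceptional set to handle.\<close>

definition directing :: "(nat \<Rightarrow> 'a) \<Rightarrow> real measure" where
  "directing \<omega> = interval_measure (lim_cdf \<omega>)"

lemma directing: "prob_space (directing \<omega>)" "sets (directing \<omega>) = sets borel"
  "emeasure (directing \<omega>) {..s} = ennreal (lim_cdf \<omega> s)"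
proof -
  interpret real_distribution "directing \<omega>"
    unfolding directing_def
    by (intro real_distribution_interval_measure lim_cdf_mono lim_cdf_right_continuous lim_cdf_at_bot lim_cdf_at_top)
  show "prob_space (directing \<omega>)" by (rule prob_space_axioms)
  show "sets (directing \<omega>) = sets borel" by simp
  show "emeasure (directing \<omega>) {..s} = ennreal (lim_cdf \<omega> s)"
    unfolding directing_def
    by (rule emeasure_interval_measure_Iic[OF lim_cdf_mono lim_cdf_right_continuous lim_cdf_at_bot])
qed

lemma directing_measurable [measurable]: "directing \<in> iid N \<rightarrow>\<^sub>M prob_algebra borel"
proof (rule measurable_prob_algebra_generated[where G = "range (\<lambda>a::real. {..a})" and \<Omega> = UNIV])
  show "sets borel = sigma_sets UNIV (range (\<lambda>a::real. {..a}))" by (subst borel_eq_atMost) simp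
  show "Int_stable (range (\<lambda>a::real. {..a}))" by (auto simp: Int_stable_def)
  fix A assume "A \<in> range (\<lambda>a::real. {..a})"
  then show "(\<lambda>\<omega>. emeasure (directing \<omega>) A) \<in> borel_measurable (iid N)"
    by (auto simp: directing)
qed (auto simp: directing)

text \<open>The identity for \<open>Dlim\<close> at thresholds s + 1 / (m + 1) passes to the limit
  on both sides: the indicators are right-continuous in the threshold, and \<open>lim_cdf\<close> is
  the limit of \<open>Dlim\<close> by construction.\<close>

lemma expectation_below_eq_lim_cdf:
  assumes Q: "Q \<in> Psym (iid N)" and J: "finite J"
  shows "(\<integral>\<omega>. (\<Prod>j\<in>J. below (s j) (\<omega> j)) \<partial>Q) = (\<integral>\<omega>. (\<Prod>j\<in>J. lim_cdf \<omega> (s j)) \<partial>Q)"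
proof -
  have sQ[measurable_cong]: "sets Q = sets (iid N)" using Q by (auto simp: Psym_def probs_def)
  interpret prob_space Q using Q by (auto simp: Psym_def probs_def)
  have "(\<lambda>m. \<integral>\<omega>. (\<Prod>j\<in>J. below (s j + 1 / Suc m) (\<omega> j)) \<partial>Q) \<longlonglongrightarrow> (\<integral>\<omega>. (\<Prod>j\<in>J. below (s j) (\<omega> j)) \<partial>Q)"
  proof (rule integral_dominated_convergence[where w = "\<lambda>_. 1"])
    have "(\<lambda>m. below (t + 1 / Suc m) x) \<longlonglongrightarrow> below t x" for t x
    proof (cases "T x \<le> t")
      case True
      then have "below (t + 1 / Suc m) x = below t x" for m by (auto simp: below_def indicator_def intro: order_trans)
      then show ?thesis by simp
    next
      case False
      then obtain m0 where m0: "inverse (real (Suc m0)) < T x - t" using reals_Archimedean[of "T x - t"] by auto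
      have "below (t + 1 / Suc m) x = below t x" if "m0 \<le> m" for m
      proof -
        have "1 / real (Suc m) \<le> 1 / real (Suc m0)" using that by (simp add: frac_le)
        then show ?thesis using m0 False by (simp add: below_def inverse_eq_divide)
      qed
      then show ?thesis by (intro tendsto_eventually) (auto simp: eventually_sequentially)
    qed
    then show "AE \<omega> in Q. (\<lambda>m. \<Prod>j\<in>J. below (s j + 1 / Suc m) (\<omega> j)) \<longlonglongrightarrow> (\<Prod>j\<in>J. below (s j) (\<omega> j))"
      by (intro AE_I2 tendsto_prod)
    show "AE \<omega> in Q. norm (\<Prod>j\<in>J. below (s j + 1 / Suc m) (\<omega> j)) \<le> 1" for m
      using f0 f1 by (intro AE_I2) (auto simp: abs_prod intro!: prod_le_1)
    show "integrable Q (\<lambda>_. 1 :: real)" by simp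
  qed measurable
  moreover have "(\<lambda>m. \<integral>\<omega>. (\<Prod>j\<in>J. Dlim below (s j + 1 / Suc m) \<omega>) \<partial>Q) \<longlonglongrightarrow> (\<integral>\<omega>. (\<Prod>j\<in>J. lim_cdf \<omega> (s j)) \<partial>Q)"
  proof (rule integral_dominated_convergence[where w = "\<lambda>_. 1"])
    show "AE \<omega> in Q. (\<lambda>m. \<Prod>j\<in>J. Dlim below (s j + 1 / Suc m) \<omega>) \<longlonglongrightarrow> (\<Prod>j\<in>J. lim_cdf \<omega> (s j))"
      by (intro AE_I2 tendsto_prod tendsto_lim_cdf)
    show "AE \<omega> in Q. norm (\<Prod>j\<in>J. Dlim below (s j + 1 / Suc m) \<omega>) \<le> 1" for m
      using Dlim_bounds by (intro AE_I2) (auto simp: abs_prod intro!: prod_le_1)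
    show "integrable Q (\<lambda>_. 1 :: real)" by simp
  qed measurable
  moreover have "(\<integral>\<omega>. (\<Prod>j\<in>J. below (s j + 1 / Suc m) (\<omega> j)) \<partial>Q) = (\<integral>\<omega>. (\<Prod>j\<in>J. Dlim below (s j + 1 / Suc m) \<omega>) \<partial>Q)" for m
    using expectation_prod_eq_Dlim[OF Q J, of "\<lambda>_. 1" 1 "\<lambda>j. s j + 1 / Suc m"] by simp
  ultimately show ?thesis using LIMSEQ_unique by simp
qed

text \<open>The two laws are compared on lower orthants, where an i.i.d. law takes the product of
  the values of its distribution function.\<close>

lemma distr_eq_bind_directing:
  assumes Q: "Q \<in> Psym (iid N)"
  shows "distr Q (iid borel) (\<lambda>\<omega> i. T (\<omega> i)) = Q \<bind> (\<lambda>\<omega>. iid (directing \<omega>))"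
proof -
  have sQ[measurable_cong]: "sets Q = sets (iid N)" using Q by (auto simp: Psym_def probs_def)
  interpret prob_space Q using Q by (auto simp: Psym_def probs_def)
  have Q': "Q \<in> space (prob_algebra (iid N))" using sQ prob_space_axioms by (simp add: space_prob_algebra)
  have K: "(\<lambda>\<omega>. iid (directing \<omega>)) \<in> iid N \<rightarrow>\<^sub>M prob_algebra (iid borel)" by measurable
  have mT[measurable]: "(\<lambda>\<omega> i. T (\<omega> i)) \<in> measurable (iid N) (iid borel)"
    by (rule measurable_PiM_single') (auto simp: space_PiM)
  let ?L = "distr Q (iid borel) (\<lambda>\<omega> i. T (\<omega> i))" and ?R = "Q \<bind> (\<lambda>\<omega>. iid (directing \<omega>))"
  let ?G = "{{y :: nat \<Rightarrow> real. \<forall>i\<in>J. y i \<le> s i} | J s. finite J}"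
  interpret L: prob_space ?L by (rule prob_space_distr) measurable
  show ?thesis
  proof (rule measure_eqI_generator_eq[OF Int_stable_lower_orthants, where \<Omega> = UNIV and A = "\<lambda>_. UNIV"])
    show "sets ?L = sigma_sets UNIV ?G" using sigma_sets_lower_orthants by simp
    show "sets ?R = sigma_sets UNIV ?G"
      using sets_bind'[OF Q' K] sigma_sets_lower_orthants by simp
    show "range (\<lambda>_. UNIV) \<subseteq> ?G" by (auto intro!: exI[of _ "{}"])
    show "emeasure ?L UNIV \<noteq> \<infinity>" by (simp add: L.emeasure_eq_measure)
    fix X assume "X \<in> ?G"
    then obtain J s where J: "finite J" and X: "X = {y. \<forall>i\<in>J. y i \<le> s i}" by auto
    have Xs: "X \<in> sets (iid borel)" unfolding sigma_sets_lower_orthants using J X by (intro sigma_sets.Basic) auto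
    have "emeasure ?L X = emeasure Q {\<omega>\<in>space Q. \<forall>i\<in>J. T (\<omega> i) \<le> s i}"
      using Xs by (subst emeasure_distr) (auto simp: X intro!: arg_cong[where f = "emeasure Q"])
    also have "\<dots> = (\<integral>\<^sup>+\<omega>. ennreal (\<Prod>j\<in>J. below (s j) (\<omega> j)) \<partial>Q)"
    proof -
      have "{\<omega>\<in>space Q. \<forall>i\<in>J. T (\<omega> i) \<le> s i} \<in> sets Q" using J by measurable
      then have "emeasure Q {\<omega>\<in>space Q. \<forall>i\<in>J. T (\<omega> i) \<le> s i} = (\<integral>\<^sup>+\<omega>. indicator {\<omega>\<in>space Q. \<forall>i\<in>J. T (\<omega> i) \<le> s i} \<omega> \<partial>Q)"
        by simp
      also have "\<dots> = (\<integral>\<^sup>+\<omega>. ennreal (\<Prod>j\<in>J. below (s j) (\<omega> j)) \<partial>Q)"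
      proof (rule nn_integral_cong)
        fix \<omega> assume "\<omega> \<in> space Q"
        from this show "indicator {\<omega>\<in>space Q. \<forall>i\<in>J. T (\<omega> i) \<le> s i} \<omega> = ennreal (\<Prod>j\<in>J. below (s j) (\<omega> j))"
        proof (cases "\<forall>i\<in>J. T (\<omega> i) \<le> s i")
          case False
          then have "(\<Prod>j\<in>J. below (s j) (\<omega> j)) = 0"
            by (intro prod_zero[OF J]) (auto simp: below_def indicator_def)
          with False show ?thesis by simp
        qed (simp add: below_def)
      qed
      finally show ?thesis .
    qed
    also have "\<dots> = ennreal (\<integral>\<omega>. (\<Prod>j\<in>J. below (s j) (\<omega> j)) \<partial>Q)"
      using f0 f1 by (intro nn_integral_eq_integral integrable_const_bound[of _ 1] AE_I2)
        (auto simp: abs_prod intro!: prod_le_1 prod_nonneg)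
    also have "\<dots> = ennreal (\<integral>\<omega>. (\<Prod>j\<in>J. lim_cdf \<omega> (s j)) \<partial>Q)"
      by (simp only: expectation_below_eq_lim_cdf[OF Q J])
    also have "\<dots> = (\<integral>\<^sup>+\<omega>. ennreal (\<Prod>j\<in>J. lim_cdf \<omega> (s j)) \<partial>Q)"
      using lim_cdf_bounds by (intro nn_integral_eq_integral[symmetric] integrable_const_bound[of _ 1] AE_I2)
        (auto simp: abs_prod intro!: prod_le_1 prod_nonneg)
    also have "\<dots> = (\<integral>\<^sup>+\<omega>. emeasure (iid (directing \<omega>)) X \<partial>Q)"
    proof (rule nn_integral_cong)
      fix \<omega>
      have "emeasure (iid (directing \<omega>)) X = emeasure (iid (directing \<omega>)) {y\<in>space (iid (directing \<omega>)). \<forall>i\<in>J. y i \<in> {..s i}}"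
        using sets_eq_imp_space_eq[OF directing(2)] by (auto simp: X space_PiM intro!: arg_cong[where f = "emeasure _"])
      also have "\<dots> = (\<Prod>i\<in>J. emeasure (directing \<omega>) {..s i})"
        using J by (intro emeasure_iid_Collect directing) (auto simp: directing)
      also have "\<dots> = ennreal (\<Prod>j\<in>J. lim_cdf \<omega> (s j))"
        unfolding directing(3) by (rule prod_ennreal) (rule lim_cdf_bounds)
      finally show "ennreal (\<Prod>j\<in>J. lim_cdf \<omega> (s j)) = emeasure (iid (directing \<omega>)) X" by simp
    qed
    also have "\<dots> = emeasure ?R X" by (rule emeasure_bind_prob_algebra[OF Q' K Xs, symmetric])
    finally show "emeasure ?L X = emeasure ?R X" .
  qed auto
qed

end

text \<open>Points are coded as reals by \<open>T\<close>, and the left inverse \<open>R\<close>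
  carries the directing measure back to a random law \<open>K\<close> on the state space. The mixing
  measure is the distribution of \<open>K\<close> under \<open>Q\<close>.\<close>

theorem de_Finetti:
  fixes Q :: "(nat \<Rightarrow> 'a::polish_space) measure"
  assumes Q: "Q \<in> Psym (Xinf borel)"
  shows "\<exists>\<nu>\<in>space (prob_algebra (prob_algebra borel)). Q = mix_iid \<nu>"
proof -
  have sQ[measurable_cong]: "sets Q = sets (Xinf borel)" using Q by (auto simp: Psym_def probs_def)
  interpret prob_space Q using Q by (auto simp: Psym_def probs_def)
  have Q': "Q \<in> space (prob_algebra (Xinf borel))" using sQ prob_space_axioms by (simp add: space_prob_algebra)
  obtain BB :: "'a set set" where BB: "countable BB" "topological_basis BB"
    using ex_countable_basis by blast
  have "BB \<noteq> {}" using topological_basisE[OF BB(2), of UNIV undefined] by auto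
  define U where "U = from_nat_into BB"
  have U: "topological_basis (range U)" unfolding U_def using BB \<open>BB \<noteq> {}\<close> by (simp add: range_from_nat_into)
  have [measurable]: "U k \<in> sets borel" for k using topological_basis_open[OF U, of "U k"] by auto
  obtain r where [measurable]: "r \<in> borel_measurable (iid (borel :: real measure))"
    and r: "\<And>x. r (\<lambda>k. indicator (U k) x) = x" using code_retraction[OF U] by blast
  define T where "T x = cantor (\<lambda>k. indicator (U k) x)" for x
  define R where "R s = r (\<lambda>k. digit k s)" for s
  have [measurable]: "T \<in> borel_measurable borel" unfolding T_def cantor_def by measurable
  have "(\<lambda>s k. digit k s) \<in> measurable borel (iid (borel :: real measure))" by (rule measurable_PiM_single') auto
  then have R[measurable]: "R \<in> borel_measurable borel" unfolding R_def by measurable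
  have ind01: "indicator (U k) x \<in> {0, 1 :: real}" for k x by (simp add: indicator_def)
  have RT: "R (T x) = x" for x
    unfolding R_def T_def digit_cantor[of "\<lambda>k. indicator (U k) x", OF ind01] by (rule r)
  interpret unit_observable borel T
    by standard (auto simp: T_def intro!: cantor_nonneg cantor_le_1 ind01)
  define K where "K \<omega> = distr (directing \<omega>) borel R" for \<omega>
  have K[measurable]: "K \<in> Xinf borel \<rightarrow>\<^sub>M prob_algebra borel"
    unfolding K_def by (rule measurable_compose[OF directing_measurable measurable_distr_prob_space[OF R]])
  define \<nu> where "\<nu> = distr Q (prob_algebra borel) K"
  have \<nu>: "\<nu> \<in> space (prob_algebra (prob_algebra borel))"
    unfolding \<nu>_def by (auto simp: space_prob_algebra intro!: prob_space_distr)
  have mT: "(\<lambda>\<omega> i. T (\<omega> i)) \<in> measurable (Xinf borel) (iid borel)"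
    by (rule measurable_PiM_single') (auto simp: space_PiM)
  have mR: "(\<lambda>y i. R (y i)) \<in> measurable (iid borel) (Xinf borel)"
    by (rule measurable_PiM_single') (auto simp: space_PiM)
  have "Q = distr Q (Xinf borel) (\<lambda>\<omega>. \<omega>)" by (rule distr_id2[symmetric, OF sQ[symmetric]])
  also have "\<dots> = distr (distr Q (iid borel) (\<lambda>\<omega> i. T (\<omega> i))) (Xinf borel) (\<lambda>y i. R (y i))"
    using mT mR by (subst distr_distr) (auto simp: comp_def RT)
  also have "\<dots> = distr (Q \<bind> (\<lambda>\<omega>. iid (directing \<omega>))) (Xinf borel) (\<lambda>y i. R (y i))"
    by (simp only: distr_eq_bind_directing[OF Q])
  also have "\<dots> = Q \<bind> (\<lambda>\<omega>. distr (iid (directing \<omega>)) (Xinf borel) (\<lambda>y i. R (y i)))"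
  proof (rule distr_bind[OF _ not_empty mR])
    show "(\<lambda>\<omega>. iid (directing \<omega>)) \<in> Q \<rightarrow>\<^sub>M subprob_algebra (iid borel)"
      by (rule measurable_prob_algebraD) measurable
  qed
  also have "(\<lambda>\<omega>. distr (iid (directing \<omega>)) (Xinf borel) (\<lambda>y i. R (y i))) = (\<lambda>\<omega>. iid (K \<omega>))"
    unfolding K_def
  proof (intro ext distr_iid directing)
    show "R \<in> measurable (directing \<omega>) borel" for \<omega>
      using R by (simp add: measurable_cong_sets[OF directing(2) refl])
  qed
  also have "Q \<bind> (\<lambda>\<omega>. iid (K \<omega>)) = \<nu> \<bind> iid"
    unfolding \<nu>_def
  proof (rule bind_distr[symmetric])
    show "K \<in> Q \<rightarrow>\<^sub>M prob_algebra borel" by measurable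
    show "iid \<in> prob_algebra borel \<rightarrow>\<^sub>M subprob_algebra (Xinf borel)"
      by (rule measurable_prob_algebraD) measurable
  qed (rule not_empty)
  also have "\<dots> = mix_iid \<nu>" by (rule mix_iid_eq_bind[OF \<nu>, symmetric])
  finally show ?thesis using \<nu> by blast
qed

subsection \<open>The transport cost and integrals of mixtures\<close>

text \<open>\<open>ennreal\<close> truncates at 0, so using it under the integral can only drop a
  negative part.\<close>

lemma ennreal_integral_le:
  assumes "integrable M f" shows "ennreal (integral\<^sup>L M f) \<le> (\<integral>\<^sup>+x. ennreal (f x) \<partial>M)"
proof -
  have "integral\<^sup>L M f \<le> (\<integral>x. max 0 (f x) \<partial>M)"
    using assms by (intro integral_mono) auto
  then have "ennreal (integral\<^sup>L M f) \<le> ennreal (\<integral>x. max 0 (f x) \<partial>M)" by (rule ennreal_leI)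
  also have "\<dots> = (\<integral>\<^sup>+x. ennreal (max 0 (f x)) \<partial>M)"
    using assms by (intro nn_integral_eq_integral[symmetric]) auto
  also have "\<dots> = (\<integral>\<^sup>+x. ennreal (f x) \<partial>M)"
    by (intro nn_integral_cong) (auto simp: max_def ennreal_neg)
  finally show ?thesis .
qed

lemma (in prob_space) integrable_bounded:
  fixes f :: "'a \<Rightarrow> real"
  assumes "f \<in> borel_measurable M" "\<And>x. \<bar>f x\<bar> \<le> B"
  shows "integrable M f"
  using assms by (intro integrable_const_bound[of _ B]) auto

lemma (in prob_space) abs_integral_bounded:
  fixes f :: "'a \<Rightarrow> real"
  assumes "f \<in> borel_measurable M" "\<And>x. \<bar>f x\<bar> \<le> B"
  shows "\<bar>integral\<^sup>L M f\<bar> \<le> B"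
proof -
  have "\<bar>integral\<^sup>L M f\<bar> \<le> (\<integral>x. \<bar>f x\<bar> \<partial>M)" by (rule integral_abs_bound)
  also have "\<dots> \<le> B"
    using assms integrable_bounded[OF assms] by (intro integral_le_const integrable_abs) auto
  finally show ?thesis .
qed

lemma lsc_cost_measurable:
  fixes C :: "'b::second_countable_topology \<Rightarrow> 'b \<Rightarrow> real"
  assumes "lsc_cost C"
  shows "(\<lambda>z. C (fst z) (snd z)) \<in> borel_measurable (borel \<Otimes>\<^sub>M borel)"
  unfolding borel_prod borel_measurable_iff_greater
  using assms by (auto simp: lsc_cost_def intro!: borel_open)

text \<open>Weak duality. A negative dual value becomes 0, and the claim is then trivial.\<close>

lemma coupling_ge_dual:
  fixes \<phi> \<psi> :: "'b \<Rightarrow> real"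
  assumes \<pi>: "\<pi> \<in> couplings S P Q"
    and [measurable]: "\<phi> \<in> borel_measurable S" "\<psi> \<in> borel_measurable S"
    and B: "\<And>x. \<bar>\<phi> x\<bar> \<le> B" "\<And>x. \<bar>\<psi> x\<bar> \<le> B"
    and le: "\<And>x y. \<phi> x + \<psi> y \<le> C x y"
  shows "ennreal ((\<integral>x. \<phi> x \<partial>P) + (\<integral>y. \<psi> y \<partial>Q)) \<le> (\<integral>\<^sup>+z. ennreal (C (fst z) (snd z)) \<partial>\<pi>)"
proof -
  interpret prob_space \<pi> using \<pi> by (simp add: couplings_def)
  have [measurable_cong]: "sets \<pi> = sets (S \<Otimes>\<^sub>M S)" and P: "P = distr \<pi> S fst" and Q: "Q = distr \<pi> S snd"
    using \<pi> by (auto simp: couplings_def)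
  have i: "integrable \<pi> (\<lambda>z. \<phi> (fst z))" "integrable \<pi> (\<lambda>z. \<psi> (snd z))"
    by (rule integrable_bounded[where B = B]; simp add: B)+
  have "(\<integral>x. \<phi> x \<partial>P) + (\<integral>y. \<psi> y \<partial>Q) = (\<integral>z. \<phi> (fst z) + \<psi> (snd z) \<partial>\<pi>)"
    unfolding P Q using i by (subst (1 2) integral_distr) auto
  also have "ennreal \<dots> \<le> (\<integral>\<^sup>+z. ennreal (\<phi> (fst z) + \<psi> (snd z)) \<partial>\<pi>)"
    using i by (intro ennreal_integral_le) auto
  also have "\<dots> \<le> (\<integral>\<^sup>+z. ennreal (C (fst z) (snd z)) \<partial>\<pi>)"
    using le by (intro nn_integral_mono ennreal_leI)
  finally show ?thesis .
qed

text \<open>One sequence of potentials serves all pairs of measures: truncated at 0,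
  \<open>Wc\<close> is a countable supremum of functionals that are affine in each measure.\<close>

theorem Wc_eq_SUP:
  fixes C :: "'b::polish_space \<Rightarrow> 'b \<Rightarrow> real"
  assumes lsc: "lsc_cost C" and nonneg: "\<And>x y. 0 \<le> C x y"
  obtains \<phi> \<psi> :: "nat \<Rightarrow> 'b \<Rightarrow> real" where
    "\<And>m. \<phi> m \<in> borel_measurable borel" "\<And>m. \<psi> m \<in> borel_measurable borel"
    "\<And>m. \<exists>B. \<forall>x. \<bar>\<phi> m x\<bar> \<le> B \<and> \<bar>\<psi> m x\<bar> \<le> B"
    "\<And>m t. open {y. t < \<psi> m y}"
    "\<And>m x y. \<phi> m x + \<psi> m y \<le> C x y"
    "\<And>P Q. P \<in> probs borel \<Longrightarrow> Q \<in> probs borel \<Longrightarrow>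
      Wc borel C P Q = (SUP m. ennreal ((\<integral>x. \<phi> m x \<partial>P) + (\<integral>y. \<psi> m y \<partial>Q)))"
proof (rule countable_transport_duality[OF lsc nonneg])
  fix D :: "(('b \<Rightarrow> real) \<times> ('b \<Rightarrow> real)) set"
  assume D: "countable D" "(\<lambda>_. 0, \<lambda>_. 0) \<in> D"
    "\<And>\<phi> \<psi>. (\<phi>, \<psi>) \<in> D \<Longrightarrow> \<phi> \<in> borel_measurable borel"
    "\<And>\<phi> \<psi>. (\<phi>, \<psi>) \<in> D \<Longrightarrow> \<psi> \<in> borel_measurable borel"
    "\<And>\<phi> \<psi>. (\<phi>, \<psi>) \<in> D \<Longrightarrow> \<exists>B. \<forall>x. \<bar>\<phi> x\<bar> \<le> B \<and> \<bar>\<psi> x\<bar> \<le> B"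
    "\<And>\<phi> \<psi> t. (\<phi>, \<psi>) \<in> D \<Longrightarrow> open {y. t < \<psi> y}"
    "\<And>\<phi> \<psi> x y. (\<phi>, \<psi>) \<in> D \<Longrightarrow> \<phi> x + \<psi> y \<le> C x y"
    "\<And>P Q r. P \<in> probs borel \<Longrightarrow> Q \<in> probs borel \<Longrightarrow> 0 \<le> r \<Longrightarrow>
      (\<And>\<phi> \<psi>. (\<phi>, \<psi>) \<in> D \<Longrightarrow> (\<integral>x. \<phi> x \<partial>P) + (\<integral>y. \<psi> y \<partial>Q) \<le> r) \<Longrightarrow>
      \<exists>\<pi>\<in>couplings borel P Q. (\<integral>\<^sup>+z. ennreal (C (fst z) (snd z)) \<partial>\<pi>) \<le> ennreal r"
  define \<phi> where "\<phi> m = fst (from_nat_into D m)" for m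
  define \<psi> where "\<psi> m = snd (from_nat_into D m)" for m
  have inD: "(\<phi> m, \<psi> m) \<in> D" for m
    unfolding \<phi>_def \<psi>_def using from_nat_into[of D m] D(2) by auto
  have surj: "\<exists>m. \<phi> m = f \<and> \<psi> m = g" if "(f, g) \<in> D" for f g
  proof -
    note fg = that
    obtain m where "from_nat_into D m = (f, g)" using from_nat_into_surj[OF D(1) fg] by blast
    then show ?thesis by (intro exI[of _ m]) (simp add: \<phi>_def \<psi>_def)
  qed
  show ?thesis
  proof (rule that[of \<phi> \<psi>])
    fix P Q :: "'b measure" assume PQ: "P \<in> probs borel" "Q \<in> probs borel"
    let ?v = "\<lambda>m. (\<integral>x. \<phi> m x \<partial>P) + (\<integral>y. \<psi> m y \<partial>Q)"
    show "Wc borel C P Q = (SUP m. ennreal (?v m))"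
    proof (rule antisym)
      show "(SUP m. ennreal (?v m)) \<le> Wc borel C P Q"
        unfolding Wc_def
      proof (intro SUP_least INF_greatest)
        fix m \<pi> assume "\<pi> \<in> couplings borel P Q"
        moreover obtain B where "\<forall>x. \<bar>\<phi> m x\<bar> \<le> B \<and> \<bar>\<psi> m x\<bar> \<le> B" using D(5)[OF inD] by blast
        ultimately show "ennreal (?v m) \<le> (\<integral>\<^sup>+z. ennreal (C (fst z) (snd z)) \<partial>\<pi>)"
          using D(3,4,7)[OF inD] by (intro coupling_ge_dual[where B = B]) auto
      qed
      show "Wc borel C P Q \<le> (SUP m. ennreal (?v m))"
      proof (cases "(SUP m. ennreal (?v m)) = \<infinity>")
        case False
        then obtain r where r: "0 \<le> r" "(SUP m. ennreal (?v m)) = ennreal r"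
          by (cases "SUP m. ennreal (?v m)") auto
        have "?v m \<le> r" for m
          using SUP_upper[of m UNIV "\<lambda>m. ennreal (?v m)"] r by (simp add: ennreal_le_iff)
        then obtain \<pi> where "\<pi> \<in> couplings borel P Q" "(\<integral>\<^sup>+z. ennreal (C (fst z) (snd z)) \<partial>\<pi>) \<le> ennreal r"
          using D(8)[OF PQ r(1)] surj by metis
        then show ?thesis unfolding r Wc_def by (rule INF_lower2)
      next
        case True
        then show ?thesis unfolding True by simp
      qed
    qed
  qed (use D(3-7)[OF inD] in auto)
qed

lemma Wc_sym:
  assumes "lsc_cost c" and sym: "\<And>x y. c x y = c y x"
  shows "Wc (borel :: 'b::second_countable_topology measure) c P Q = Wc borel c Q P"
proof -
  have "Wc borel c Q P \<le> Wc borel c P Q" for P Q :: "'b measure"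
    unfolding Wc_def
  proof (rule INF_greatest)
    fix \<pi> assume \<pi>: "\<pi> \<in> couplings borel P Q"
    interpret prob_space \<pi> using \<pi> by (simp add: couplings_def)
    have [measurable_cong]: "sets \<pi> = sets (borel \<Otimes>\<^sub>M borel)" and P: "distr \<pi> borel fst = P" and Q: "distr \<pi> borel snd = Q"
      using \<pi> by (auto simp: couplings_def)
    note [measurable] = lsc_cost_measurable[OF assms(1)]
    let ?\<pi> = "distr \<pi> (borel \<Otimes>\<^sub>M borel) (\<lambda>z. (snd z, fst z))"
    have "?\<pi> \<in> couplings borel Q P"
      unfolding couplings_def by (auto simp: distr_distr comp_def P Q intro!: prob_space_distr)
    moreover have "(\<integral>\<^sup>+z. ennreal (c (fst z) (snd z)) \<partial>?\<pi>) = (\<integral>\<^sup>+z. ennreal (c (fst z) (snd z)) \<partial>\<pi>)"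
      by (subst nn_integral_distr) (auto simp: sym intro!: nn_integral_cong)
    ultimately show "(INF \<pi>\<in>couplings borel Q P. \<integral>\<^sup>+z. ennreal (c (fst z) (snd z)) \<partial>\<pi>)
      \<le> (\<integral>\<^sup>+z. ennreal (c (fst z) (snd z)) \<partial>\<pi>)" by (intro INF_lower2) auto
  qed
  then show ?thesis by (intro antisym)
qed

text \<open>The relaxed triangle inequality is integrated along a nearly optimal coupling. The
  summand 1 is the slack that provides such a coupling when the transport cost is finite; otherwise
  the right side is infinite.\<close>

lemma moment_le_Wc:
  fixes c :: "'b::second_countable_topology \<Rightarrow> 'b \<Rightarrow> real"
  assumes "lsc_cost c" and nonneg: "\<And>x y. 0 \<le> c x y" and K: "0 < K" "\<And>x y z. c x y \<le> K * (c x z + c z y)"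
  shows "(\<integral>\<^sup>+x. ennreal (c x0 x) \<partial>Q) \<le> ennreal K * ((\<integral>\<^sup>+x. ennreal (c x0 x) \<partial>P) + (Wc borel c P Q + 1))"
proof (cases "Wc borel c P Q = \<infinity>")
  case True
  then show ?thesis using K(1) by (simp add: ennreal_mult_top)
next
  case False
  then obtain w where "0 \<le> w" "Wc borel c P Q = ennreal w" by (cases "Wc borel c P Q") auto
  then have "Wc borel c P Q < Wc borel c P Q + 1" by (simp add: ennreal_lessI flip: ennreal_1 ennreal_plus)
  then obtain \<pi> where \<pi>: "\<pi> \<in> couplings borel P Q"
    and lt: "(\<integral>\<^sup>+z. ennreal (c (fst z) (snd z)) \<partial>\<pi>) < Wc borel c P Q + 1"
    unfolding Wc_def INF_less_iff by blast
  have [measurable_cong]: "sets \<pi> = sets (borel \<Otimes>\<^sub>M borel)" and P: "P = distr \<pi> borel fst" and Q: "Q = distr \<pi> borel snd"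
    using \<pi> by (auto simp: couplings_def)
  note [measurable] = lsc_cost_measurable[OF assms(1)]
  have [measurable]: "c x0 \<in> borel_measurable borel"
    using measurable_compose[OF measurable_Pair1'[of x0 borel borel] lsc_cost_measurable[OF assms(1)]] by simp
  have "(\<integral>\<^sup>+x. ennreal (c x0 x) \<partial>Q) = (\<integral>\<^sup>+z. ennreal (c x0 (snd z)) \<partial>\<pi>)"
    unfolding Q by (rule nn_integral_distr) auto
  also have "\<dots> \<le> (\<integral>\<^sup>+z. ennreal K * (ennreal (c x0 (fst z)) + ennreal (c (fst z) (snd z))) \<partial>\<pi>)"
    using K nonneg by (intro nn_integral_mono) (simp flip: ennreal_plus ennreal_mult add: ennreal_leI)
  also have "\<dots> = ennreal K * ((\<integral>\<^sup>+z. ennreal (c x0 (fst z)) \<partial>\<pi>) + (\<integral>\<^sup>+z. ennreal (c (fst z) (snd z)) \<partial>\<pi>))"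
    by (simp add: nn_integral_cmult nn_integral_add)
  also have "(\<integral>\<^sup>+z. ennreal (c x0 (fst z)) \<partial>\<pi>) = (\<integral>\<^sup>+x. ennreal (c x0 x) \<partial>P)"
    unfolding P by (rule nn_integral_distr[symmetric]) auto
  finally show ?thesis
    using lt by (elim order_trans) (intro mult_left_mono add_left_mono less_imp_le zero_le)
qed

section \<open>Integrals against finite and i.i.d. mixtures\<close>

lemma
  assumes I: "finite I" "I \<noteq> {}" and a: "\<And>i. i \<in> I \<Longrightarrow> 0 \<le> a i" "sum a I = 1"
    and Q: "\<And>i. i \<in> I \<Longrightarrow> Q i \<in> probs S"
  shows mix_fin_probs: "mix_fin S I a Q \<in> probs S"
    and integral_mix_fin: "\<And>f B. f \<in> borel_measurable S \<Longrightarrow> (\<And>x. \<bar>f x :: real\<bar> \<le> B) \<Longrightarrow>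
      (\<integral>x. f x \<partial>mix_fin S I a Q) = (\<Sum>i\<in>I. a i * (\<integral>x. f x \<partial>Q i))"
proof -
  define M where "M = point_measure I (\<lambda>i. ennreal (a i))"
  have M: "prob_space M"
    by (rule prob_spaceI) (simp add: M_def space_point_measure emeasure_point_measure_finite I sum_ennreal a)
  have M': "M \<in> space (prob_algebra M)" using M by (simp add: space_prob_algebra)
  have QM: "Q \<in> M \<rightarrow>\<^sub>M prob_algebra S"
    using Q by (auto simp: M_def space_prob_algebra probs_def)
  \<comment> \<open>A finite mixture is the bind of a point measure on the index set, and both
    claims are read off from the bind.\<close>
  have eq: "mix_fin S I a Q = M \<bind> Q"
    unfolding mix_fin_def
  proof (rule measure_of_eqI)
    show "sets (M \<bind> Q) = sets S" by (rule sets_bind'[OF M' QM])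
    fix A assume "A \<in> sets S"
    then have "emeasure (M \<bind> Q) A = (\<integral>\<^sup>+i. emeasure (Q i) A \<partial>M)"
      by (rule emeasure_bind_prob_algebra[OF M' QM])
    then show "(\<Sum>i\<in>I. ennreal (a i) * emeasure (Q i) A) = emeasure (M \<bind> Q) A"
      by (simp add: M_def nn_integral_point_measure_finite I)
  qed
  show "mix_fin S I a Q \<in> probs S"
    using prob_space_bind'[OF M' QM] sets_bind'[OF M' QM] by (simp add: eq probs_def)
  fix f :: "'a \<Rightarrow> real" and B assume f: "f \<in> borel_measurable S" "\<And>x. \<bar>f x\<bar> \<le> B"
  have "(\<integral>x. f x \<partial>(M \<bind> Q)) = (\<integral>i. (\<integral>x. f x \<partial>Q i) \<partial>M)"
  proof (rule integral_bind[where K = S and B = B and B' = 1])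
    show "AE x in M. emeasure (Q x) (space (Q x)) \<le> ennreal 1"
      using Q by (intro AE_I2) (auto simp: M_def space_point_measure probs_def prob_space.emeasure_space_1)
  qed (use f M QM in \<open>auto simp: measurable_prob_algebraD prob_space_def\<close>)
  then show "(\<integral>x. f x \<partial>mix_fin S I a Q) = (\<Sum>i\<in>I. a i * (\<integral>x. f x \<partial>Q i))"
    using a I by (simp add: eq M_def lebesgue_integral_point_measure_finite)
qed

lemma measurable_integral_iid:
  assumes "f \<in> borel_measurable (iid N)"
  shows "(\<lambda>P. \<integral>x. f x \<partial>iid P :: real) \<in> borel_measurable (prob_algebra N)"
  by (rule measurable_compose[OF measurable_prob_algebraD[OF measurable_iid] integral_measurable_subprob_algebra[OF assms]])

lemma
  fixes \<nu> :: "'a::topological_space measure measure"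
  assumes \<nu>: "\<nu> \<in> space (prob_algebra (prob_algebra borel))"
  shows mix_iid_probs: "mix_iid \<nu> \<in> probs (Xinf borel)"
    and nn_integral_mix_iid: "f \<in> borel_measurable (Xinf borel) \<Longrightarrow>
      (\<integral>\<^sup>+x. f x \<partial>mix_iid \<nu>) = (\<integral>\<^sup>+P. (\<integral>\<^sup>+x. f x \<partial>iid P) \<partial>\<nu>)"
    and integral_mix_iid: "g \<in> borel_measurable (Xinf borel) \<Longrightarrow> (\<And>x. \<bar>g x :: real\<bar> \<le> B) \<Longrightarrow>
      (\<integral>x. g x \<partial>mix_iid \<nu>) = (\<integral>P. (\<integral>x. g x \<partial>iid P) \<partial>\<nu>)"
proof -
  have s: "sets \<nu> = sets (prob_algebra borel)" and p: "prob_space \<nu>" using \<nu> by (auto simp: space_prob_algebra)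
  have m: "iid \<in> \<nu> \<rightarrow>\<^sub>M subprob_algebra (Xinf (borel :: 'a measure))"
    using measurable_prob_algebraD[OF measurable_iid] by (simp add: measurable_cong_sets[OF s refl])
  show "mix_iid \<nu> \<in> probs (Xinf borel)"
    unfolding mix_iid_eq_bind[OF \<nu>] probs_def
    using prob_space_bind'[OF \<nu> measurable_iid] sets_bind'[OF \<nu> measurable_iid] by simp
  show "f \<in> borel_measurable (Xinf borel) \<Longrightarrow> (\<integral>\<^sup>+x. f x \<partial>mix_iid \<nu>) = (\<integral>\<^sup>+P. (\<integral>\<^sup>+x. f x \<partial>iid P) \<partial>\<nu>)"
    unfolding mix_iid_eq_bind[OF \<nu>] by (rule nn_integral_bind[OF _ m])
  show "(\<integral>x. g x \<partial>mix_iid \<nu>) = (\<integral>P. (\<integral>x. g x \<partial>iid P) \<partial>\<nu>)"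
    if g: "g \<in> borel_measurable (Xinf borel)" "\<And>x. \<bar>g x :: real\<bar> \<le> B"
    unfolding mix_iid_eq_bind[OF \<nu>]
  proof (rule integral_bind[where B = B and B' = 1, OF g m])
    show "finite_measure \<nu>" using p by (simp add: prob_space_def)
    show "AE P in \<nu>. emeasure (iid P) (space (iid P)) \<le> ennreal 1"
      using sets_eq_imp_space_eq[OF s]
      by (intro AE_I2) (auto simp: space_prob_algebra intro!: prob_space.emeasure_space_1[THEN eq_refl] prob_space_iid)
  qed
qed

lemma distr_iid_restrict:
  assumes P: "prob_space P" and J: "finite J"
  shows "distr (iid P) (PiM J (\<lambda>_. P)) (\<lambda>x. restrict x J) = PiM J (\<lambda>_. P)"
proof -
  interpret product_prob_space "\<lambda>_. P" UNIV by (intro product_prob_spaceI P)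
  show ?thesis using J by (intro distr_PiM_restrict_finite) auto
qed

lemma integral_iid_prod:
  fixes g :: "nat \<Rightarrow> 'a \<Rightarrow> real"
  assumes prob_P: "prob_space P" and J: "finite J" and g: "\<And>i. integrable P (g i)"
  shows "(\<integral>x. (\<Prod>i\<in>J. g i (x i)) \<partial>iid P) = (\<Prod>i\<in>J. \<integral>x. g i x \<partial>P)"
proof -
  interpret product_prob_space "\<lambda>_. P" UNIV by (intro product_prob_spaceI prob_P)
  have [measurable]: "g i \<in> borel_measurable P" for i using g by auto
  have "(\<Prod>i\<in>J. \<integral>x. g i x \<partial>P) = (\<integral>x. (\<Prod>i\<in>J. g i (x i)) \<partial>PiM J (\<lambda>_. P))"
    by (rule product_integral_prod[symmetric, OF J]) (rule g)
  also have "\<dots> = (\<integral>x. (\<Prod>i\<in>J. g i (x i)) \<partial>distr (iid P) (PiM J (\<lambda>_. P)) (\<lambda>x. restrict x J))"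
    by (simp only: distr_iid_restrict[OF prob_P J])
  also have "\<dots> = (\<integral>x. (\<Prod>i\<in>J. g i (restrict x J i)) \<partial>iid P)"
    by (rule integral_distr) (auto intro!: measurable_restrict_subset)
  also have "\<dots> = (\<integral>x. (\<Prod>i\<in>J. g i (x i)) \<partial>iid P)"
    by (intro Bochner_Integration.integral_cong prod.cong refl) auto
  finally show ?thesis by simp
qed

lemma iid_Psym:
  assumes "P \<in> probs N" shows "iid P \<in> Psym (iid N)"
proof -
  have P: "prob_space P" "sets P = sets N" using assms by (auto simp: probs_def)
  have s: "sets (iid P) = sets (iid N)" by (rule sets_iid) (rule P)
  have "distr (iid P) (iid N) (\<lambda>x. x \<circ> \<sigma>) = iid P" if "bij \<sigma>" for \<sigma> :: "nat \<Rightarrow> nat"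
  proof -
    have "distr (iid P) (iid N) (\<lambda>x. x \<circ> \<sigma>) = distr (iid P) (iid P) (\<lambda>\<omega>. \<lambda>n\<in>UNIV. \<omega> (\<sigma> n))"
      by (intro distr_cong s[symmetric] refl) (auto simp: comp_def)
    also have "\<dots> = iid P"
      using that P(1) by (intro distr_PiM_reindex) (auto simp: bij_def)
    finally show ?thesis .
  qed
  then show ?thesis using P s by (auto simp: Psym_def probs_def prob_space_iid)
qed

subsection \<open>The weak closed convex hull\<close>

lemma measurable_Xinf_iff: "f \<in> borel_measurable (Xinf (borel :: 'a::second_countable_topology measure)) \<longleftrightarrow> f \<in> borel_measurable borel"
  by (simp only: measurable_cong_sets[OF sets_PiM_equal_borel refl])

lemma sets_Xinf: "sets (Xinf (borel :: 'a::second_countable_topology measure)) = sets borel"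
  by (rule sets_PiM_equal_borel)

lemma closure_weak_probs: "Q \<in> weak_topo S closure_of A \<Longrightarrow> Q \<in> probs S"
  unfolding weak_topo_def in_closure_of topology_generated_by_topspace by auto

text \<open>If the integral exceeded b, the laws with integral in the open half-line above b would
  form a neighbourhood of \<open>Q\<close> that misses \<open>A\<close>.\<close>

lemma closure_weak_le:
  assumes Q: "Q \<in> weak_topo S closure_of A"
    and f: "continuous_on UNIV f" "bounded (range f)"
    and le: "\<And>R. R \<in> A \<Longrightarrow> R \<in> probs S \<Longrightarrow> (\<integral>x. f x \<partial>R) \<le> (b::real)"
  shows "(\<integral>x. f x \<partial>Q) \<le> b"
proof (rule ccontr)
  assume "\<not> (\<integral>x. f x \<partial>Q) \<le> b"
  then have "Q \<in> {P \<in> probs S. (\<integral>x. f x \<partial>P) \<in> {b<..}}" using closure_weak_probs[OF Q] by simp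
  moreover have "openin (weak_topo S) {P \<in> probs S. (\<integral>x. f x \<partial>P) \<in> {b<..}}"
    unfolding weak_topo_def using f by (intro topology_generated_by_Basis CollectI exI[of _ f] exI[of _ "{b<..}"]) auto
  ultimately have "\<exists>R. R \<in> A \<and> R \<in> {P \<in> probs S. (\<integral>x. f x \<partial>P) \<in> {b<..}}"
    by (rule Q[unfolded in_closure_of, THEN conjunct2, THEN spec, THEN mp, OF conjI])
  then obtain R where "R \<in> A" "R \<in> probs S" "b < (\<integral>x. f x \<partial>R)" by auto
  with le[of R] show False by simp
qed

text \<open>Neighbourhoods reduce to finitely many tests with one tolerance, by induction over the
  generation of the topology: an intersection unites the tests and takes the smaller
  tolerance.\<close>

lemma closure_weakI:
  fixes S :: "'b::topological_space measure"
  assumes Q: "Q \<in> probs S" and A: "A \<subseteq> probs S"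
    and approx: "\<And>F \<epsilon>. finite F \<Longrightarrow> 0 < \<epsilon> \<Longrightarrow>
      (\<And>f. f \<in> F \<Longrightarrow> continuous_on UNIV f \<and> bounded (range f)) \<Longrightarrow>
      \<exists>R\<in>A. \<forall>f\<in>F. \<bar>(\<integral>x. f x \<partial>R) - (\<integral>x. f x \<partial>Q)\<bar> < (\<epsilon> :: real)"
  shows "Q \<in> weak_topo S closure_of A"
proof -
  define sub where "sub = {{P \<in> probs S. (\<integral>x. f x \<partial>P) \<in> U} | (f :: 'b \<Rightarrow> real) U.
        continuous_on UNIV f \<and> bounded (range f) \<and> open U}"
  define nb where "nb F \<epsilon> = {R \<in> probs S. \<forall>f\<in>F. \<bar>(\<integral>x. f x \<partial>R) - (\<integral>x. f x \<partial>Q)\<bar> < \<epsilon>}" for F :: "('b \<Rightarrow> real) set" and \<epsilon>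
  define good where "good F \<longleftrightarrow> finite F \<and> (\<forall>f\<in>F. continuous_on UNIV f \<and> bounded (range f))" for F :: "('b \<Rightarrow> real) set"
  have nbhd: "\<exists>F \<epsilon>. good F \<and> 0 < \<epsilon> \<and> nb F \<epsilon> \<subseteq> T" if "generate_topology_on sub T" "Q \<in> T" for T
    using that
  proof (induction rule: generate_topology_on.induct)
    case (Int a b)
    then obtain F \<epsilon> G \<delta> where "good F" "0 < \<epsilon>" "nb F \<epsilon> \<subseteq> a" "good G" "0 < \<delta>" "nb G \<delta> \<subseteq> b" by blast
    then show ?case
      by (intro exI[of _ "F \<union> G"] exI[of _ "min \<epsilon> \<delta>"]) (auto simp: good_def nb_def)
  next
    case (UN K)
    then show ?case by (meson Union_iff Union_upper order_trans)
  next
    case (Basis s)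
    from Basis(1) obtain f :: "'b \<Rightarrow> real" and U where s: "s = {P \<in> probs S. (\<integral>x. f x \<partial>P) \<in> U}"
      and f: "continuous_on UNIV f" "bounded (range f)" and U: "open U"
      unfolding sub_def mem_Collect_eq by (elim exE conjE) (rule that; assumption)
    have "(\<integral>x. f x \<partial>Q) \<in> U" using Basis(2) s by simp
    then obtain e where e: "0 < e" "ball (\<integral>x. f x \<partial>Q) e \<subseteq> U" using U openE by blast
    have "nb {f} e \<subseteq> s"
      using e(2) by (auto simp: nb_def s subset_eq dist_real_def abs_minus_commute)
    then show ?case using e(1) f by (intro exI[of _ "{f}"] exI[of _ e]) (auto simp: good_def)
  qed auto
  \<comment> \<open>\<open>probs S\<close> is itself subbasic, by the test 0 with the whole line as
    target.\<close>
  have top: "Q \<in> topspace (weak_topo S)"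
  proof -
    have "probs S = {P \<in> probs S. (\<integral>x. (0::real) \<partial>P) \<in> UNIV}" by auto
    then have "probs S \<in> sub" unfolding sub_def
      by (intro CollectI exI[of _ "\<lambda>_. 0"] exI[of _ UNIV]) auto
    then show ?thesis unfolding weak_topo_def topology_generated_by_topspace sub_def[symmetric] using Q by blast
  qed
  show ?thesis
    unfolding in_closure_of
  proof (intro conjI top allI impI)
    fix T assume "Q \<in> T \<and> openin (weak_topo S) T"
    then have "generate_topology_on sub T" "Q \<in> T"
      unfolding weak_topo_def sub_def openin_topology_generated_by_iff by auto
    from nbhd[OF this] obtain F \<epsilon> where F: "good F" "0 < \<epsilon>" "nb F \<epsilon> \<subseteq> T" by blast
    then obtain R where "R \<in> A" "\<forall>f\<in>F. \<bar>(\<integral>x. f x \<partial>R) - (\<integral>x. f x \<partial>Q)\<bar> < \<epsilon>"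
      using approx[of F \<epsilon>] by (auto simp: good_def)
    with F(3) A show "\<exists>y. y \<in> A \<and> y \<in> T" by (auto simp: nb_def)
  qed
qed

text \<open>Truncated multiples of the distance to a closed set give continuous functions decreasing
  to its indicator, and closed sets form a generator stable under intersection.\<close>

lemma measure_eqI_continuous:
  fixes M N :: "'b::metric_space measure"
  assumes M: "prob_space M" "sets M = sets borel" and N: "prob_space N" "sets N = sets borel"
    and eq: "\<And>f :: 'b \<Rightarrow> real. continuous_on UNIV f \<Longrightarrow> bounded (range f) \<Longrightarrow> (\<integral>x. f x \<partial>M) = (\<integral>x. f x \<partial>N)"
  shows "M = N"
proof -
  interpret M: prob_space M by (rule M)
  interpret N: prob_space N by (rule N)
  have closed: "emeasure M A = emeasure N A" if "closed A" for A
  \<comment> \<open>\<open>infdist\<close> to the empty set is 0 by convention, so the approximation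
    below would fail there.\<close>
  proof (cases "A = {}")
    case False
    define f where "f m x = max 0 (1 - real m * infdist x A)" for m and x :: 'b
    have cont: "continuous_on UNIV (f m)" for m
      unfolding f_def by (intro continuous_intros)
    have bd: "\<bar>f m x\<bar> \<le> 1" for m x using infdist_nonneg[of x A] by (simp add: f_def)
    have ptw: "(\<lambda>m. f m x) \<longlonglongrightarrow> indicator A x" for x
    proof (cases "x \<in> A")
      case True
      then show ?thesis by (simp add: f_def infdist_zero)
    next
      case x: False
      then have pos: "0 < infdist x A"
        using in_closed_iff_infdist_zero[OF that False] infdist_nonneg[of x A] by (simp add: less_le)
      then obtain m0 :: nat where m0: "1 < real m0 * infdist x A" using reals_Archimedean3 by blast
      have "f m x = 0" if "m0 \<le> m" for m
      proof -
        have "real m0 * infdist x A \<le> real m * infdist x A" using that pos by (intro mult_right_mono) auto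
        then show ?thesis using m0 by (simp add: f_def)
      qed
      then show ?thesis using x by (intro tendsto_eventually) (auto simp: eventually_sequentially)
    qed
    have lim: "(\<lambda>m. \<integral>x. f m x \<partial>R) \<longlonglongrightarrow> measure R A" if R: "prob_space R" "sets R = sets borel" for R
    proof -
      interpret R: prob_space R by (rule R)
      have [measurable]: "f m \<in> borel_measurable R" for m
        using borel_measurable_continuous_onI[OF cont[of m]] by (simp add: measurable_cong_sets[OF R(2) refl])
      have A: "A \<in> sets R" using \<open>closed A\<close> R(2) by simp
      have "(\<lambda>m. \<integral>x. f m x \<partial>R) \<longlonglongrightarrow> (\<integral>x. indicator A x \<partial>R)"
        using A bd ptw by (intro integral_dominated_convergence[where w = "\<lambda>_. 1"]) auto
      then show ?thesis using sets.sets_into_space[OF A] by (simp add: Int_absorb2)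
    qed
    have "bounded (range (f m))" for m using bd by (auto intro!: boundedI[of _ 1])
    then have "measure M A = measure N A"
      using LIMSEQ_unique[OF lim[OF M]] lim[OF N] eq[OF cont] by simp
    then show ?thesis by (simp add: M.emeasure_eq_measure N.emeasure_eq_measure)
  qed simp
  show ?thesis
  proof (rule measure_eqI_generator_eq[where E = "Collect closed" and \<Omega> = UNIV and A = "\<lambda>_. UNIV"])
    show "Int_stable (Collect closed :: 'b set set)" by (auto simp: Int_stable_def)
    show "sets M = sigma_sets UNIV (Collect closed)" "sets N = sigma_sets UNIV (Collect closed)"
      using M N by (simp_all add: borel_eq_closed)
  qed (auto simp: closed)
qed

text \<open>The infimal convolution with n times the distance is n-Lipschitz, keeps the bounds of
  \<open>f\<close> and increases to \<open>f\<close> by lower semicontinuity.\<close>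

lemma lsc_bounded_approx:
  fixes f :: "'b::metric_space \<Rightarrow> real"
  assumes lsc: "\<And>t. open {x. t < f x}" and B: "\<And>x. \<bar>f x\<bar> \<le> B"
  obtains g :: "nat \<Rightarrow> 'b \<Rightarrow> real" where "\<And>n. continuous_on UNIV (g n)" "\<And>n x. \<bar>g n x\<bar> \<le> B"
    "\<And>n x. g n x \<le> f x" "\<And>x. (\<lambda>n. g n x) \<longlonglongrightarrow> f x"
proof -
  define g where "g n x = (INF z. f z + real n * dist x z)" for n x
  have lb: "- B \<le> f z + real n * dist x z" for n x z
  proof -
    have "0 \<le> real n * dist x z" "- B \<le> f z" using B[of z] by (auto simp: abs_le_iff)
    then show ?thesis by linarith
  qed
  then have bdd: "bdd_below (range (\<lambda>z. f z + real n * dist x z))" for n x by (intro bdd_belowI[of _ "- B"]) auto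
  have g_le: "g n x \<le> f z + real n * dist x z" for n x z
    unfolding g_def by (rule cINF_lower[OF bdd]) simp
  have g_f: "g n x \<le> f x" for n x using g_le[of n x x] by simp
  have g_ge: "b \<le> g n x" if "\<And>z. b \<le> f z + real n * dist x z" for b n x
    unfolding g_def by (rule cINF_greatest) (auto simp: that)
  have lip: "g n x \<le> g n y + real n * dist x y" for n x y
  proof -
    have "g n x - real n * dist x y \<le> f z + real n * dist y z" for z
    proof -
      have "real n * dist x z \<le> real n * (dist x y + dist y z)" by (intro mult_left_mono dist_triangle) simp
      then show ?thesis using g_le[of n x z] by (simp add: algebra_simps)
    qed
    from g_ge[OF this] show ?thesis by simp
  qed
  show ?thesis
  proof (rule that[of g])
    fix n x
    show "continuous_on UNIV (g n)"
    proof (rule lipschitz_on_continuous_on[where X = UNIV, OF lipschitz_onI])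
      show "0 \<le> real n" by simp
      show "dist (g n x) (g n y) \<le> real n * dist x y" for x y
        using lip[of n x y] lip[of n y x] by (simp add: dist_real_def dist_commute abs_le_iff)
    qed
    show "\<bar>g n x\<bar> \<le> B" using g_ge[OF lb, of n x] g_f[of n x] B[of x] by (simp add: abs_le_iff)
    show "g n x \<le> f x" by (rule g_f)
    show "(\<lambda>n. g n x) \<longlonglongrightarrow> f x"
    proof (rule order_tendstoI)
      fix a assume "a < f x"
      then obtain t where t: "a < t" "t < f x" using dense by blast
      then obtain d where d: "0 < d" "ball x d \<subseteq> {x. t < f x}" using openE[OF lsc[of t], of x] by auto
      \<comment> \<open>Outside the ball of radius d the penalty n * d lifts even the lower bound -B
        above t; inside it \<open>f\<close> itself exceeds t.\<close>
      obtain n0 :: nat where n0: "t + B < real n0 * d" using d(1) reals_Archimedean3 by blast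
      have "a < g n x" if n: "n0 \<le> n" for n
      proof -
        have "t \<le> f z + real n * dist x z" for z
        proof (cases "z \<in> ball x d")
          case True
          then have "t < f z" using d(2) by auto
          then show ?thesis by (simp add: add_increasing2)
        next
          case False
          then have "real n0 * d \<le> real n * dist x z" using n d(1) by (intro mult_mono) auto
          then show ?thesis using n0 B[of z] by (simp add: abs_le_iff)
        qed
        from g_ge[OF this] show ?thesis using t by simp
      qed
      then show "\<forall>\<^sub>F n in sequentially. a < g n x" by (auto simp: eventually_sequentially)
    next
      fix a assume "f x < a"
      then show "\<forall>\<^sub>F n in sequentially. g n x < a" by (intro always_eventually allI le_less_trans[OF g_f])
    qed
  qed
qed

text \<open>Markov's inequality for the k-th power bounds the mass of {h >= t} by (b / t)^k, which
  tends to 0 for every t > b.\<close>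

lemma (in prob_space) AE_le_if_moments_le:
  fixes h :: "'a \<Rightarrow> real"
  assumes [measurable]: "h \<in> borel_measurable M" and h: "\<And>x. x \<in> space M \<Longrightarrow> 0 \<le> h x" "\<And>x. x \<in> space M \<Longrightarrow> h x \<le> B"
    and b: "0 \<le> b" and le: "\<And>k. (\<integral>x. h x ^ k \<partial>M) \<le> b ^ k"
  shows "AE x in M. h x \<le> b"
proof -
  have null: "AE x in M. h x < t" if t: "b < t" for t
  proof -
    let ?A = "{x\<in>space M. t \<le> h x}"
    have [measurable]: "?A \<in> sets M" by measurable
    have int: "integrable M (\<lambda>x. h x ^ k)" for k
      using h by (intro integrable_const_bound[of _ "B ^ k"] AE_I2) (auto intro: power_mono)
    have "measure M ?A \<le> (b / t) ^ k" for k
    proof -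
      have "t ^ k * measure M ?A = (\<integral>x. t ^ k * indicator ?A x \<partial>M)" by simp
      also have "\<dots> \<le> (\<integral>x. h x ^ k \<partial>M)"
      proof (intro integral_mono integrable_mult_right int)
        show "integrable M (indicator ?A :: _ \<Rightarrow> real)" by (intro integrable_real_indicator) (auto simp: emeasure_eq_measure)
        show "t ^ k * indicator ?A x \<le> h x ^ k" if "x \<in> space M" for x
          using h(1)[OF that] t b by (auto simp: indicator_def intro!: power_mono)
      qed
      also note le
      finally have "measure M ?A * t ^ k \<le> b ^ k" by (simp add: mult.commute)
      moreover have "0 < t ^ k" using t b by simp
      ultimately show ?thesis by (simp add: power_divide pos_le_divide_eq)
    qed
    moreover have "(\<lambda>k. (b / t) ^ k) \<longlonglongrightarrow> 0" using t b by (intro LIMSEQ_power_zero) (simp add: divide_less_eq)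
    ultimately have "measure M ?A \<le> 0" by (intro LIMSEQ_le_const) auto
    then have "measure M ?A = 0" by (simp add: measure_le_0_iff)
    then have "AE x in M. x \<notin> ?A" by (simp add: prob_eq_0)
    then show ?thesis by (rule AE_mp) (auto intro!: AE_I2)
  qed
  have "AE x in M. \<forall>m. h x < b + 1 / Suc m" by (subst AE_all_countable) (simp add: null)
  then show ?thesis
  proof eventually_elim
    case (elim x)
    show ?case
    proof (rule field_le_epsilon)
      fix e :: real assume "0 < e"
      then obtain m where "inverse (real (Suc m)) < e" using reals_Archimedean by blast
      then show "h x \<le> b + e" using elim[rule_format, of m] by (simp add: inverse_eq_divide)
    qed
  qed
qed

lemma continuous_on_permute: "continuous_on UNIV (\<lambda>x. x \<circ> \<sigma> :: nat \<Rightarrow> 'a::topological_space)"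
  by (intro continuous_on_coordinatewise_then_product) (simp add: comp_def)

text \<open>Invariance says that the continuous tests f(x o \<sigma>) - f(x) have integral 0.
  Written as two inequalities, with the factor s for the sign, this passes to convex combinations
  and weak limits; continuous tests then determine the image measure.\<close>

lemma closure_Psym:
  fixes A :: "(nat \<Rightarrow> 'a::polish_space) measure set"
  assumes Q: "Q \<in> closed_conv_weak (Xinf borel) A" and A: "A \<subseteq> Psym (Xinf borel)"
  shows "Q \<in> Psym (Xinf borel)"
proof -
  have Qp: "Q \<in> probs (Xinf borel)" using Q closure_weak_probs unfolding closed_conv_weak_def by blast
  then have sQ: "sets Q = sets (Xinf borel)" and pQ: "prob_space Q" by (auto simp: probs_def)
  have "distr Q (Xinf borel) (\<lambda>x. x \<circ> \<sigma>) = Q" if \<sigma>: "bij \<sigma>" "finite {i. \<sigma> i \<noteq> i}" for \<sigma> :: "nat \<Rightarrow> nat"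
  proof (rule measure_eqI_continuous)
    have m: "(\<lambda>x. x \<circ> \<sigma>) \<in> measurable (Xinf borel) (Xinf borel)"
      by (rule measurable_PiM_single') (auto simp: space_PiM comp_def)
    then have mQ: "(\<lambda>x. x \<circ> \<sigma>) \<in> measurable Q (Xinf borel)" by (simp add: measurable_cong_sets[OF sQ refl])
    show "prob_space (distr Q (Xinf borel) (\<lambda>x. x \<circ> \<sigma>))" by (rule prob_space.prob_space_distr[OF pQ mQ])
    show "sets (distr Q (Xinf borel) (\<lambda>x. x \<circ> \<sigma>)) = sets borel" "sets Q = sets borel"
      by (simp_all add: sets_Xinf sQ)
    show "prob_space Q" by (rule pQ)
    fix f :: "(nat \<Rightarrow> 'a) \<Rightarrow> real" assume f: "continuous_on UNIV f" "bounded (range f)"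
    obtain B where B: "\<And>x. \<bar>f x\<bar> \<le> B" using f(2) by (auto simp: bounded_iff)
    have fm: "f \<in> borel_measurable (Xinf borel)"
      using borel_measurable_continuous_onI[OF f(1)] by (simp add: measurable_Xinf_iff)
    have fc: "continuous_on UNIV (\<lambda>x. f (x \<circ> \<sigma>))"
      by (rule continuous_on_compose2[OF f(1) continuous_on_permute]) simp
    have fcm: "(\<lambda>x. f (x \<circ> \<sigma>)) \<in> borel_measurable (Xinf borel)"
      using borel_measurable_continuous_onI[OF fc] by (simp add: measurable_Xinf_iff)
    have int: "integrable R f" "integrable R (\<lambda>x. f (x \<circ> \<sigma>))" if "R \<in> probs (Xinf borel)" for R
    proof -
      have sR: "sets R = sets (Xinf borel)" and pR: "prob_space R" using that by (auto simp: probs_def)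
      show "integrable R f" "integrable R (\<lambda>x. f (x \<circ> \<sigma>))"
        using fm fcm B unfolding measurable_cong_sets[OF sR refl, symmetric]
        by (auto intro!: prob_space.integrable_bounded[OF pR, where B = B])
    qed
    have zero: "(\<integral>x. s * (f (x \<circ> \<sigma>) - f x) \<partial>R) = 0" if R: "R \<in> conv_meas (Xinf borel) A" for R and s :: real
    proof -
      obtain I a P where R: "R = mix_fin (Xinf borel) I a P" and I: "finite I" "I \<noteq> {}"
        and a: "\<And>i. i \<in> I \<Longrightarrow> 0 \<le> a i" "sum a I = 1" and P: "\<And>i. i \<in> I \<Longrightarrow> P i \<in> A"
        using R unfolding conv_meas_def by blast
      have Pp: "P i \<in> probs (Xinf borel)" if "i \<in> I" for i using P[OF that] A by (auto simp: Psym_def)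
      have Pz: "(\<integral>x. s * (f (x \<circ> \<sigma>) - f x) \<partial>P i) = 0" if "i \<in> I" for i
        using Psym_integral[OF _ \<sigma> fm, of "P i"] P[OF that] A int[OF Pp[OF that]] by auto
      have "\<bar>s * (f (x \<circ> \<sigma>) - f x)\<bar> \<le> \<bar>s\<bar> * (2 * B)" for x
        unfolding abs_mult using B[of x] B[of "x \<circ> \<sigma>"] by (intro mult_left_mono) linarith+
      moreover have "(\<lambda>x. s * (f (x \<circ> \<sigma>) - f x)) \<in> borel_measurable (Xinf borel)" using fm fcm by measurable
      ultimately have "(\<integral>x. s * (f (x \<circ> \<sigma>) - f x) \<partial>R) = (\<Sum>i\<in>I. a i * (\<integral>x. s * (f (x \<circ> \<sigma>) - f x) \<partial>P i))"
        unfolding R by (intro integral_mix_fin[OF I a Pp, where B = "\<bar>s\<bar> * (2 * B)"])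
      also have "\<dots> = 0" using Pz by (intro sum.neutral) (simp del: Bochner_Integration.integral_mult_right_zero)
      finally show ?thesis .
    qed
    have bd: "bounded (range (\<lambda>x. s * (f (x \<circ> \<sigma>) - f x)))" for s :: real
    proof (rule boundedI)
      fix y assume "y \<in> range (\<lambda>x. s * (f (x \<circ> \<sigma>) - f x))"
      then obtain x where "y = s * (f (x \<circ> \<sigma>) - f x)" by auto
      moreover have "\<bar>s * (f (x \<circ> \<sigma>) - f x)\<bar> \<le> \<bar>s\<bar> * (2 * B)" for x
        unfolding abs_mult using B[of x] B[of "x \<circ> \<sigma>"] by (intro mult_left_mono) linarith+
      ultimately show "norm y \<le> \<bar>s\<bar> * (2 * B)" by simp
    qed
    have le0: "(\<integral>x. s * (f (x \<circ> \<sigma>) - f x) \<partial>Q) \<le> 0" for s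
    proof (rule closure_weak_le[OF Q[unfolded closed_conv_weak_def]])
      show "continuous_on UNIV (\<lambda>x. s * (f (x \<circ> \<sigma>) - f x))" by (intro continuous_intros f fc)
    qed (rule bd, rule eq_refl, rule zero)
    have "(\<integral>x. f (x \<circ> \<sigma>) \<partial>Q) = (\<integral>x. f x \<partial>Q)"
      using le0[of 1] le0[of "-1"] int[OF Qp] by simp
    then show "(\<integral>x. f x \<partial>distr Q (Xinf borel) (\<lambda>x. x \<circ> \<sigma>)) = (\<integral>x. f x \<partial>Q)"
      by (simp add: integral_distr[OF mQ fm])
  qed
  then show ?thesis using Qp by (simp add: Psym_def)
qed

section \<open>The transport ball and the first identity\<close>

lemma proper_costD:
  assumes "proper_cost c"
  shows "lsc_cost c" "0 \<le> c x y" "c x y = c y x" "c x x = 0"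
    and "\<exists>K>0. \<forall>x y z. c x y \<le> K * (c x z + c z y)"
  using assms by (auto simp: proper_cost_def transport_cost_def)

lemma measurable_cost:
  fixes c :: "'b::second_countable_topology \<Rightarrow> 'b \<Rightarrow> real"
  assumes "lsc_cost c" shows "c x \<in> borel_measurable borel"
  using measurable_compose[OF measurable_Pair1'[of x borel borel] lsc_cost_measurable[OF assms]] by simp

lemma Wc_self:
  fixes c :: "'b::second_countable_topology \<Rightarrow> 'b \<Rightarrow> real"
  assumes "lsc_cost c" "\<And>x. c x x = 0" and P: "P \<in> probs borel"
  shows "Wc borel c P P = 0"
proof -
  have [measurable_cong]: "sets P = sets borel" and pP: "prob_space P" using P by (auto simp: probs_def)
  let ?\<pi> = "distr P (borel \<Otimes>\<^sub>M borel) (\<lambda>x. (x, x))"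
  have "?\<pi> \<in> couplings borel P P"
    unfolding couplings_def
    by (auto simp: distr_distr comp_def distr_id2 P[unfolded probs_def, simplified] intro!: prob_space.prob_space_distr pP)
  moreover have "(\<integral>\<^sup>+z. ennreal (c (fst z) (snd z)) \<partial>?\<pi>) = 0"
    using lsc_cost_measurable[OF assms(1)] by (subst nn_integral_distr) (auto simp: assms(2))
  ultimately have "Wc borel c P P \<le> 0" unfolding Wc_def by (intro INF_lower2) auto
  then show ?thesis by simp
qed

text \<open>A finite cost to \<open>Phat\<close> forces a finite moment by the relaxed triangle
  inequality. Symmetry puts the varying measure second, where the potentials are lower
  semicontinuous.\<close>

lemma Wball_iff:
  fixes c :: "'a::polish_space \<Rightarrow> 'a \<Rightarrow> real"
  assumes c: "proper_cost c" and Phat: "Phat \<in> Pc borel c"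
  shows "P \<in> Wball borel c \<rho> Phat \<longleftrightarrow> P \<in> probs borel \<and> Wc borel c Phat P \<le> ennreal \<rho>"
proof -
  have sym: "Wc borel c P Phat = Wc borel c Phat P"
    by (rule Wc_sym) (rule proper_costD[OF c])+
  have "P \<in> Pc borel c" if P: "P \<in> probs borel" "Wc borel c Phat P \<le> ennreal \<rho>"
  proof -
    obtain K where K: "0 < K" "\<And>x y z. c x y \<le> K * (c x z + c z y)" using proper_costD(5)[OF c] by blast
    obtain x0 where x0: "(\<integral>\<^sup>+x. ennreal (c x0 x) \<partial>Phat) < \<infinity>" using Phat by (auto simp: Pc_def)
    have "(\<integral>\<^sup>+x. ennreal (c x0 x) \<partial>P) \<le> ennreal K * ((\<integral>\<^sup>+x. ennreal (c x0 x) \<partial>Phat) + (Wc borel c Phat P + 1))"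
      by (rule moment_le_Wc[OF proper_costD(1,2)[OF c] K])
    also have "\<dots> < \<infinity>"
    proof -
      have "Wc borel c Phat P < \<infinity>" using P(2) by (rule le_less_trans) simp
      then show ?thesis using x0 by (simp add: ennreal_mult_eq_top_iff flip: less_top)
    qed
    finally show ?thesis using P by (auto simp: Pc_def)
  qed
  moreover have "P \<in> probs borel" if "P \<in> Pc borel c" using that by (simp add: Pc_def)
  ultimately show ?thesis unfolding Wball_def mem_Collect_eq sym by blast
qed

lemma space_prob_algebra_probs: "space (prob_algebra N) = probs N"
  by (auto simp: space_prob_algebra probs_def)

lemma mixture_if_closed_conv:
  fixes c :: "'a::polish_space \<Rightarrow> 'a \<Rightarrow> real"
  assumes c: "proper_cost c" and \<rho>: "0 < \<rho>" and Phat: "Phat \<in> Pc borel c"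
    and Q: "Q \<in> closed_conv_weak (Xinf borel) {iid P | P. P \<in> Wball borel c \<rho> Phat}"
  shows "\<exists>\<nu>. Q = mix_iid \<nu> \<and> \<nu> \<in> space (prob_algebra (prob_algebra borel))
    \<and> (AE P in \<nu>. Wc borel c Phat P \<le> ennreal \<rho>)"
proof -
  note ball = Wball_iff[OF c Phat, of _ \<rho>]
  have Phat_probs: "Phat \<in> probs borel" using Phat by (simp add: Pc_def)
  have Phat_ball: "Phat \<in> Wball borel c \<rho> Phat"
    unfolding ball using Phat_probs Wc_self[OF proper_costD(1)[OF c] proper_costD(4)[OF c] Phat_probs] by simp
  let ?A = "{iid P | P. P \<in> Wball borel c \<rho> Phat}"
  have A: "?A \<subseteq> Psym (Xinf borel)" using ball by (auto intro: iid_Psym)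
  have "Q \<in> Psym (Xinf borel)" using Q A by (rule closure_Psym)
  then obtain \<nu> where \<nu>: "\<nu> \<in> space (prob_algebra (prob_algebra borel))" and Q\<nu>: "Q = mix_iid \<nu>"
    using de_Finetti by blast
  have s\<nu>: "sets \<nu> = sets (prob_algebra borel)" and p\<nu>: "prob_space \<nu>" using \<nu> by (auto simp: space_prob_algebra)
  interpret \<nu>: prob_space \<nu> by (rule p\<nu>)
  have sp: "space \<nu> = probs borel" using sets_eq_imp_space_eq[OF s\<nu>] by (simp add: space_prob_algebra_probs)
  \<comment> \<open>An upper bound for a continuous test on the i.i.d. laws of the ball passes to
    convex combinations and to their closure.\<close>
  have test: "(\<integral>x. f x \<partial>Q) \<le> b"
    if f: "continuous_on UNIV f" "\<And>x. \<bar>f x\<bar> \<le> B" and le: "\<And>P. P \<in> Wball borel c \<rho> Phat \<Longrightarrow> (\<integral>x. f x \<partial>iid P) \<le> b"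
    for f :: "(nat \<Rightarrow> 'a) \<Rightarrow> real" and B b
  proof (rule closure_weak_le[OF Q[unfolded closed_conv_weak_def]])
    show "bounded (range f)" using f(2) by (auto intro!: boundedI)
    fix R assume "R \<in> conv_meas (Xinf borel) ?A"
    then obtain I a P where R: "R = mix_fin (Xinf borel) I a P" and I: "finite I" "I \<noteq> {}"
      and a: "\<And>i. i \<in> I \<Longrightarrow> 0 \<le> a i" "sum a I = 1" and P: "\<And>i. i \<in> I \<Longrightarrow> P i \<in> ?A"
      unfolding conv_meas_def by blast
    have fm: "f \<in> borel_measurable (Xinf borel)"
      using borel_measurable_continuous_onI[OF f(1)] by (simp only: measurable_Xinf_iff)
    have Pp: "P i \<in> probs (Xinf borel)" if "i \<in> I" for i using P[OF that] A by (auto simp: Psym_def)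
    have "(\<integral>x. f x \<partial>R) = (\<Sum>i\<in>I. a i * (\<integral>x. f x \<partial>P i))"
      unfolding R by (rule integral_mix_fin[OF I a Pp fm f(2)])
    also have "\<dots> \<le> (\<Sum>i\<in>I. a i * b)"
    proof (intro sum_mono mult_left_mono a(1))
      fix i assume "i \<in> I"
      then obtain P' where "P i = iid P'" "P' \<in> Wball borel c \<rho> Phat" using P by blast
      then show "(\<integral>x. f x \<partial>P i) \<le> b" using le by simp
    qed
    also have "\<dots> = b" by (simp add: a(2) flip: sum_distrib_right)
    finally show "(\<integral>x. f x \<partial>R) \<le> b" .
  qed (rule f)
  obtain \<phi> \<psi> :: "nat \<Rightarrow> 'a \<Rightarrow> real" where
    d: "\<And>m. \<phi> m \<in> borel_measurable borel" "\<And>m. \<psi> m \<in> borel_measurable borel"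
    "\<And>m. \<exists>B. \<forall>x. \<bar>\<phi> m x\<bar> \<le> B \<and> \<bar>\<psi> m x\<bar> \<le> B"
    "\<And>m t. open {y. t < \<psi> m y}"
    "\<And>m x y. \<phi> m x + \<psi> m y \<le> c x y"
    "\<And>P Q. P \<in> probs borel \<Longrightarrow> Q \<in> probs borel \<Longrightarrow>
      Wc borel c P Q = (SUP m. ennreal ((\<integral>x. \<phi> m x \<partial>P) + (\<integral>y. \<psi> m y \<partial>Q)))"
    using Wc_eq_SUP[OF proper_costD(1,2)[OF c]] by blast
  have dual: "Wc borel c Phat P \<le> ennreal \<rho> \<longleftrightarrow> (\<forall>m. (\<integral>x. \<phi> m x \<partial>Phat) + (\<integral>y. \<psi> m y \<partial>P) \<le> \<rho>)"
    if "P \<in> probs borel" for P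
    using \<rho> by (simp add: d(6)[OF Phat_probs that] SUP_le_iff ennreal_le_iff)
  have "AE P in \<nu>. (\<integral>x. \<phi> m x \<partial>Phat) + (\<integral>y. \<psi> m y \<partial>P) \<le> \<rho>" for m
  proof -
    obtain B where B: "\<And>x. \<bar>\<psi> m x\<bar> \<le> B" using d(3)[of m] by blast
    obtain g :: "nat \<Rightarrow> 'a \<Rightarrow> real" where g: "\<And>n. continuous_on UNIV (g n)" "\<And>n x. \<bar>g n x\<bar> \<le> B"
      "\<And>n x. g n x \<le> \<psi> m x" "\<And>x. (\<lambda>n. g n x) \<longlonglongrightarrow> \<psi> m x"
      using lsc_bounded_approx[OF d(4) B] by blast
    \<comment> \<open>The dual constraint now says that the integral of \<open>\<psi> m\<close> is
      at most \<open>r\<close>.\<close>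
    define r where "r = \<rho> - (\<integral>x. \<phi> m x \<partial>Phat)"
    have gm: "g n \<in> borel_measurable borel" for n by (rule borel_measurable_continuous_onI[OF g(1)])
    have gi: "integrable P (g n)" "\<bar>\<integral>x. g n x \<partial>P\<bar> \<le> B" if "P \<in> probs borel" for P n
    proof -
      have "prob_space P" and s: "sets P = sets borel" using that by (auto simp: probs_def)
      then interpret prob_space P by simp
      have "g n \<in> borel_measurable P" using gm by (simp add: measurable_cong_sets[OF s refl])
      then show "integrable P (g n)" "\<bar>\<integral>x. g n x \<partial>P\<bar> \<le> B"
        by (rule integrable_bounded[OF _ g(2)], rule abs_integral_bounded[OF _ g(2)])
    qed
    have gr: "(\<integral>x. g n x \<partial>P) \<le> r" if "P \<in> Wball borel c \<rho> Phat" for P n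
    proof -
      have P: "P \<in> probs borel" "Wc borel c Phat P \<le> ennreal \<rho>" using that ball by auto
      then interpret prob_space P by (simp add: probs_def)
      have s: "sets P = sets borel" using P by (simp add: probs_def)
      have "integrable P (\<psi> m)"
        using d(2)[of m] B by (intro integrable_bounded[where B = B]) (auto simp: measurable_cong_sets[OF s refl])
      then have "(\<integral>x. g n x \<partial>P) \<le> (\<integral>x. \<psi> m x \<partial>P)" using gi(1)[OF P(1)] g(3) by (intro integral_mono) auto
      also have "\<dots> \<le> r" using dual[OF P(1)] P(2) by (simp add: r_def algebra_simps)
      finally show ?thesis .
    qed
    \<comment> \<open>The centre \<open>Phat\<close> lies in the ball, so \<open>r\<close> is at
      least the integral of \<open>g 0\<close> under it, which is at least -B.\<close>
    have b0: "0 \<le> r + B" using gr[OF Phat_ball, of 0] gi(2)[OF Phat_probs, of 0] by linarith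
    \<comment> \<open>Adding B makes the random integral nonnegative, so its powers are monotone and
      the moment criterion applies.\<close>
    have ae: "AE P in \<nu>. (\<integral>x. g n x \<partial>P) + B \<le> r + B" for n
    proof (rule \<nu>.AE_le_if_moments_le[where B = "2 * B"])
      show "(\<lambda>P. (\<integral>x. g n x \<partial>P) + B) \<in> borel_measurable \<nu>"
        unfolding measurable_cong_sets[OF s\<nu> refl] prob_algebra_def
        by (intro borel_measurable_add measurable_restrict_space1 integral_measurable_subprob_algebra gm measurable_const)
          simp
      show "0 \<le> (\<integral>x. g n x \<partial>P) + B" "(\<integral>x. g n x \<partial>P) + B \<le> 2 * B" if "P \<in> space \<nu>" for P
        using gi(2)[of P n] that by (auto simp: sp)
      show "0 \<le> r + B" by (rule b0)
      fix k
      \<comment> \<open>By independence this product integrates under an i.i.d. law to the k-th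
        power of a single integral.\<close>
      define f where "f x = (\<Prod>i<k. g n (x i) + B)" for x :: "nat \<Rightarrow> 'a"
      have fc: "continuous_on UNIV f"
        unfolding f_def
        by (intro continuous_intros continuous_on_compose2[OF g(1)] continuous_on_product_coordinates) auto
      have f_bd: "\<bar>f x\<bar> \<le> (2 * B) ^ k" for x
      proof -
        have "\<bar>g n (x i) + B\<bar> \<le> 2 * B" for i using g(2)[of n "x i"] by linarith
        then have "\<bar>f x\<bar> \<le> (\<Prod>i<k. 2 * B)" unfolding f_def abs_prod by (intro prod_mono) auto
        then show ?thesis by simp
      qed
      have fm: "f \<in> borel_measurable (Xinf borel)"
        using borel_measurable_continuous_onI[OF fc] by (simp only: measurable_Xinf_iff)
      have f_iid: "(\<integral>x. f x \<partial>iid P) = ((\<integral>x. g n x \<partial>P) + B) ^ k" if P: "P \<in> probs borel" for P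
      proof -
        have pP: "prob_space P" using P by (simp add: probs_def)
        have "(\<integral>x. f x \<partial>iid P) = (\<Prod>i<k. \<integral>x. g n x + B \<partial>P)"
          unfolding f_def using gi(1)[OF P] pP
          by (intro integral_iid_prod[where g = "\<lambda>i x. g n x + B"])
            (auto simp: prob_space.finite_measure finite_measure.integrable_const)
        then show ?thesis using gi(1)[OF P] pP
          by (simp add: prob_space.finite_measure finite_measure.integrable_const prob_space.prob_space)
      qed
      have "(\<integral>P. ((\<integral>x. g n x \<partial>P) + B) ^ k \<partial>\<nu>) = (\<integral>P. (\<integral>x. f x \<partial>iid P) \<partial>\<nu>)"
        by (intro Bochner_Integration.integral_cong refl) (simp add: f_iid sp)
      also have "\<dots> = (\<integral>x. f x \<partial>Q)"
        unfolding Q\<nu> by (rule integral_mix_iid[OF \<nu> fm f_bd, symmetric])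
      also have "\<dots> \<le> (r + B) ^ k"
      proof (rule test[OF fc f_bd])
        fix P assume P: "P \<in> Wball borel c \<rho> Phat"
        then have Pp: "P \<in> probs borel" by (simp add: ball)
        show "(\<integral>x. f x \<partial>iid P) \<le> (r + B) ^ k"
          unfolding f_iid[OF Pp] using gr[OF P, of n] gi(2)[OF Pp, of n] by (intro power_mono) auto
      qed
      finally show "(\<integral>P. ((\<integral>x. g n x \<partial>P) + B) ^ k \<partial>\<nu>) \<le> (r + B) ^ k" .
    qed
    have "AE P in \<nu>. \<forall>n. (\<integral>x. g n x \<partial>P) \<le> r"
      using ae by (simp add: AE_all_countable)
    moreover have "AE P in \<nu>. P \<in> probs borel" using sp by (intro AE_I2) simp
    ultimately show ?thesis
    proof eventually_elim
      case (elim P)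
      then interpret prob_space P by (simp add: probs_def)
      have s: "sets P = sets borel" using elim by (simp add: probs_def)
      have "(\<lambda>n. \<integral>x. g n x \<partial>P) \<longlonglongrightarrow> (\<integral>x. \<psi> m x \<partial>P)"
        using gm d(2)[of m] g(2,4)
        by (intro integral_dominated_convergence[where w = "\<lambda>_. B"]) (auto simp: measurable_cong_sets[OF s refl])
      then have "(\<integral>x. \<psi> m x \<partial>P) \<le> r" by (rule LIMSEQ_le_const2) (use elim in auto)
      then show ?case by (simp add: r_def)
    qed
  qed
  then have "AE P in \<nu>. \<forall>m. (\<integral>x. \<phi> m x \<partial>Phat) + (\<integral>y. \<psi> m y \<partial>P) \<le> \<rho>" by (simp add: AE_all_countable)
  moreover have "AE P in \<nu>. P \<in> probs borel" using sp by (intro AE_I2) simp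
  ultimately have "AE P in \<nu>. Wc borel c Phat P \<le> ennreal \<rho>"
    by eventually_elim (simp add: dual)
  then show ?thesis using \<nu> Q\<nu> by blast
qed

text \<open>Laws in one cell give nearly equal integrals for all the finitely many tests. Replacing
  each law by a representative of its cell in the ball, weighted by the mass of the cell, moves
  every test integral by at most \<delta>.\<close>

lemma closed_conv_if_mixture:
  fixes c :: "'a::polish_space \<Rightarrow> 'a \<Rightarrow> real"
  assumes c: "proper_cost c" and Phat: "Phat \<in> Pc borel c"
    and \<nu>: "\<nu> \<in> space (prob_algebra (prob_algebra borel))"
    and ae: "AE P in \<nu>. Wc borel c Phat P \<le> ennreal \<rho>"
  shows "mix_iid \<nu> \<in> closed_conv_weak (Xinf borel) {iid P | P. P \<in> Wball borel c \<rho> Phat}"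
proof -
  note ball = Wball_iff[OF c Phat, of _ \<rho>]
  let ?A = "{iid P | P. P \<in> Wball borel c \<rho> Phat}"
  have Ap: "?A \<subseteq> probs (Xinf borel)" using ball iid_Psym by (auto simp: Psym_def)
  have s\<nu>: "sets \<nu> = sets (prob_algebra borel)" and p\<nu>: "prob_space \<nu>" using \<nu> by (auto simp: space_prob_algebra)
  interpret \<nu>: prob_space \<nu> by (rule p\<nu>)
  have sp: "space \<nu> = probs borel" using sets_eq_imp_space_eq[OF s\<nu>] by (simp add: space_prob_algebra_probs)
  have ae_ball: "AE P in \<nu>. P \<in> Wball borel c \<rho> Phat"
    using ae by (rule AE_mp) (auto intro!: AE_I2 simp: ball sp)
  have "\<exists>P. P \<in> Wball borel c \<rho> Phat"
  proof (rule ccontr)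
    assume "\<nexists>P. P \<in> Wball borel c \<rho> Phat"
    then have "AE P in \<nu>. False" using ae_ball by simp
    then show False by simp
  qed
  \<comment> \<open>A fallback representative for cells of mass 0, which may contain no law of the
    ball.\<close>
  then obtain P0 where P0: "P0 \<in> Wball borel c \<rho> Phat" ..
  show ?thesis
    unfolding closed_conv_weak_def
  proof (rule closure_weakI)
    show "mix_iid \<nu> \<in> probs (Xinf borel)" by (rule mix_iid_probs[OF \<nu>])
    show "conv_meas (Xinf borel) ?A \<subseteq> probs (Xinf borel)"
      unfolding conv_meas_def using Ap by (auto intro!: mix_fin_probs)
    fix F :: "((nat \<Rightarrow> 'a) \<Rightarrow> real) set" and \<epsilon> :: real
    assume F: "finite F" and \<epsilon>: "0 < \<epsilon>" and Fc: "\<And>f. f \<in> F \<Longrightarrow> continuous_on UNIV f \<and> bounded (range f)"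
    have "\<forall>f\<in>F. \<exists>B. \<forall>x. \<bar>f x\<bar> \<le> B" using Fc by (auto simp: bounded_iff)
    then obtain B where B: "\<And>f x. f \<in> F \<Longrightarrow> \<bar>f x\<bar> \<le> B f" by metis
    have fm: "f \<in> borel_measurable (Xinf borel)" if "f \<in> F" for f
      using borel_measurable_continuous_onI[of f] Fc[OF that] by (simp add: measurable_Xinf_iff)
    define G where "G f P = (\<integral>x. f x \<partial>iid P)" for f :: "(nat \<Rightarrow> 'a) \<Rightarrow> real" and P
    have Gm[measurable]: "G f \<in> borel_measurable \<nu>" if "f \<in> F" for f
      unfolding G_def[abs_def] measurable_cong_sets[OF s\<nu> refl] by (rule measurable_integral_iid[OF fm[OF that]])
    have Gb: "\<bar>G f P\<bar> \<le> B f" if "f \<in> F" "P \<in> probs borel" for f P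
    proof -
      have "iid P \<in> probs (Xinf borel)" using iid_Psym[OF that(2)] by (simp add: Psym_def)
      then have "prob_space (iid P)" and s: "sets (iid P) = sets (Xinf borel)" by (auto simp: probs_def)
      then interpret prob_space "iid P" by simp
      show ?thesis unfolding G_def using fm[OF that(1)] B[OF that(1)]
        by (intro abs_integral_bounded) (simp_all add: measurable_cong_sets[OF s refl])
    qed
    \<comment> \<open>Half of \<epsilon>, because the error is bounded weakly by \<delta> and must
      be strictly below \<epsilon>.\<close>
    define \<delta> where "\<delta> = \<epsilon> / 2"
    have \<delta>: "0 < \<delta>" using \<epsilon> by (simp add: \<delta>_def)
    \<comment> \<open>All test integrals in units of \<delta>, rounded down; the tests are bounded,
      so finitely many values occur.\<close>
    define cell where "cell P = (\<lambda>f\<in>F. \<lfloor>G f P / \<delta>\<rfloor>)" for P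
    define Z where "Z = PiE F (\<lambda>f. {\<lfloor>- B f / \<delta>\<rfloor>..\<lfloor>B f / \<delta>\<rfloor>})"
    have finZ: "finite Z" unfolding Z_def using F by (intro finite_PiE) auto
    have cellZ: "cell P \<in> Z" if "P \<in> probs borel" for P
    proof -
      have "- B f / \<delta> \<le> G f P / \<delta>" "G f P / \<delta> \<le> B f / \<delta>" if "f \<in> F" for f
        using Gb[OF that \<open>P \<in> probs borel\<close>] \<delta> by (intro divide_right_mono; simp add: abs_le_iff)+
      then show ?thesis unfolding Z_def cell_def
        by (intro restrict_PiE_iff[THEN iffD2] ballI) (simp only: atLeastAtMost_iff floor_mono)
    qed
    define E where "E z = {P\<in>space \<nu>. cell P = z}" for z
    have Em[measurable]: "E z \<in> sets \<nu>" if "z \<in> Z" for z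
    proof -
      have "E z = {P\<in>space \<nu>. \<forall>f\<in>F. \<lfloor>G f P / \<delta>\<rfloor> = z f}"
        using that unfolding E_def cell_def Z_def by (auto simp: fun_eq_iff PiE_iff extensional_def)
      also have "\<dots> \<in> sets \<nu>" using F Gm by (intro sets.sets_Collect_finite_All) (auto, measurable)
      finally show ?thesis .
    qed
    have "\<exists>P. P \<in> Wball borel c \<rho> Phat \<and> (measure \<nu> (E z) \<noteq> 0 \<longrightarrow> P \<in> E z)" if z: "z \<in> Z" for z
    proof (cases "measure \<nu> (E z) = 0")
      case False
      have "\<exists>P\<in>E z. P \<in> Wball borel c \<rho> Phat"
      proof (rule ccontr)
        assume none: "\<not> (\<exists>P\<in>E z. P \<in> Wball borel c \<rho> Phat)"
        have "AE P in \<nu>. P \<notin> E z" using ae_ball by eventually_elim (use none in blast)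
        then show False using False Em[OF z] by (simp add: \<nu>.prob_eq_0)
      qed
      then show ?thesis by blast
    qed (use P0 in auto)
    then obtain rep where rep: "\<And>z. z \<in> Z \<Longrightarrow> rep z \<in> Wball borel c \<rho> Phat"
      "\<And>z. z \<in> Z \<Longrightarrow> measure \<nu> (E z) \<noteq> 0 \<Longrightarrow> rep z \<in> E z" by metis
    have sum1: "(\<Sum>z\<in>Z. measure \<nu> (E z)) = 1"
    proof -
      have EZ: "E ` Z \<subseteq> sets \<nu>" using Em by blast
      have "(\<Union>z\<in>Z. E z) = space \<nu>" using cellZ by (auto simp: E_def sp)
      moreover have "disjoint_family_on E Z" by (auto simp: disjoint_family_on_def E_def)
      ultimately show ?thesis
        using \<nu>.finite_measure_finite_Union[OF finZ EZ] by (simp add: \<nu>.prob_space)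
    qed
    then have "Z \<noteq> {}" by auto
    \<comment> \<open>\<open>conv_meas\<close> indexes its combinations by natural numbers, so the
      cells are enumerated.\<close>
    obtain h where h: "bij_betw h {0..<card Z} Z" using ex_bij_betw_nat_finite[OF finZ] by blast
    let ?I = "{0..<card Z}"
    define a where "a i = measure \<nu> (E (h i))" for i
    define R where "R = mix_fin (Xinf borel) ?I a (\<lambda>i. iid (rep (h i)))"
    have hZ: "h i \<in> Z" if "i \<in> ?I" for i using h that by (auto simp: bij_betw_def)
    have I: "finite ?I" "?I \<noteq> {}" using finZ \<open>Z \<noteq> {}\<close> by (auto simp: card_gt_0_iff)
    have a: "\<And>i. i \<in> ?I \<Longrightarrow> 0 \<le> a i" "sum a ?I = 1"
      unfolding a_def using sum.reindex_bij_betw[OF h, of "\<lambda>z. measure \<nu> (E z)"] sum1 by auto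
    have Ri: "iid (rep (h i)) \<in> ?A" if "i \<in> ?I" for i using rep(1)[OF hZ[OF that]] by blast
    have "R \<in> conv_meas (Xinf borel) ?A"
      unfolding conv_meas_def R_def using I a Ri
      by (intro CollectI exI[of _ ?I] exI[of _ a] exI[of _ "\<lambda>i. iid (rep (h i))"]) auto
    moreover have "\<bar>(\<integral>x. f x \<partial>R) - (\<integral>x. f x \<partial>mix_iid \<nu>)\<bar> < \<epsilon>" if f: "f \<in> F" for f
    proof -
      have "(\<integral>x. f x \<partial>R) = (\<Sum>i\<in>?I. a i * G f (rep (h i)))"
        unfolding R_def G_def using Ri Ap by (intro integral_mix_fin[OF I a _ fm[OF f] B[OF f]]) auto
      also have "\<dots> = (\<Sum>z\<in>Z. measure \<nu> (E z) * G f (rep z))"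
        unfolding a_def by (rule sum.reindex_bij_betw[OF h])
      also have "\<dots> = (\<integral>P. (\<Sum>z\<in>Z. G f (rep z) * indicator (E z) P) \<partial>\<nu>)"
        using Em sets.sets_into_space[OF Em]
        by (subst Bochner_Integration.integral_sum) (auto simp: \<nu>.emeasure_eq_measure Int_absorb2 mult.commute)
      finally have 1: "(\<integral>x. f x \<partial>R) = (\<integral>P. (\<Sum>z\<in>Z. G f (rep z) * indicator (E z) P) \<partial>\<nu>)" .
      have 2: "(\<integral>x. f x \<partial>mix_iid \<nu>) = (\<integral>P. G f P \<partial>\<nu>)"
        unfolding G_def by (rule integral_mix_iid[OF \<nu> fm[OF f] B[OF f]])
      have iG: "integrable \<nu> (G f)"
        using Gm[OF f] Gb[OF f] by (intro \<nu>.integrable_const_bound[where B = "B f"] AE_I2) (auto simp: sp)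
      have iS: "integrable \<nu> (\<lambda>P. \<Sum>z\<in>Z. G f (rep z) * indicator (E z) P)"
        using Em by (intro Bochner_Integration.integrable_sum integrable_mult_right integrable_real_indicator) (auto simp: \<nu>.emeasure_eq_measure)
      \<comment> \<open>The representative of a cell of mass 0 need not lie in it, but almost every
        law avoids such cells.\<close>
      have null: "AE P in \<nu>. \<forall>z\<in>Z. measure \<nu> (E z) = 0 \<longrightarrow> P \<notin> E z"
        using finZ Em by (intro AE_finite_allI) (auto simp: \<nu>.prob_eq_0 AE_impI)
      have close: "AE P in \<nu>. \<bar>(\<Sum>z\<in>Z. G f (rep z) * indicator (E z) P) - G f P\<bar> \<le> \<delta>"
        using null AE_space
      proof eventually_elim
        case (elim P)
        define z where "z = cell P"
        have z: "z \<in> Z" "P \<in> E z" using elim cellZ by (auto simp: z_def E_def sp)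
        have "(\<Sum>z'\<in>Z. G f (rep z') * indicator (E z') P) = (\<Sum>z'\<in>Z. if z' = z then G f (rep z) else 0)"
          using elim by (intro sum.cong refl) (auto simp: E_def z_def)
        also have "\<dots> = G f (rep z)" using finZ z by simp
        finally have S: "(\<Sum>z'\<in>Z. G f (rep z') * indicator (E z') P) = G f (rep z)" .
        have "rep z \<in> E z" using rep(2)[OF z(1)] elim(1) z by auto
        then have "cell (rep z) = cell P" using z by (simp add: E_def)
        then have "cell (rep z) f = cell P f" by simp
        then have "\<lfloor>G f (rep z) / \<delta>\<rfloor> = \<lfloor>G f P / \<delta>\<rfloor>" using f by (simp add: cell_def)
        then have "\<bar>G f (rep z) / \<delta> - G f P / \<delta>\<bar> \<le> 1" by linarith
        then have "\<bar>G f (rep z) - G f P\<bar> / \<delta> \<le> 1" using \<delta> by (simp add: diff_divide_distrib[symmetric])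
        then show ?case unfolding S using \<delta> by simp
      qed
      have "\<bar>(\<integral>x. f x \<partial>R) - (\<integral>x. f x \<partial>mix_iid \<nu>)\<bar> = \<bar>\<integral>P. (\<Sum>z\<in>Z. G f (rep z) * indicator (E z) P) - G f P \<partial>\<nu>\<bar>"
        unfolding 1 2 using iS iG by simp
      also have "\<dots> \<le> (\<integral>P. \<bar>(\<Sum>z\<in>Z. G f (rep z) * indicator (E z) P) - G f P\<bar> \<partial>\<nu>)" by (rule integral_abs_bound)
      also have "\<dots> \<le> \<delta>" using iS iG close by (intro \<nu>.integral_le_const) auto
      also have "\<dots> < \<epsilon>" using \<epsilon> by (simp add: \<delta>_def)
      finally show ?thesis .
    qed
    ultimately show "\<exists>R\<in>conv_meas (Xinf borel) ?A. \<forall>f\<in>F. \<bar>(\<integral>x. f x \<partial>R) - (\<integral>x. f x \<partial>mix_iid \<nu>)\<bar> < \<epsilon>" by blast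
  qed
qed

subsection \<open>Marginal balls\<close>

lemma nn_integral_iid_component:
  assumes P: "prob_space P" and g: "g \<in> borel_measurable P"
  shows "(\<integral>\<^sup>+x. g (x i) \<partial>iid P) = (\<integral>\<^sup>+x. g x \<partial>P)"
proof -
  have "(\<integral>\<^sup>+x. g x \<partial>P) = (\<integral>\<^sup>+x. g x \<partial>distr (iid P) P (\<lambda>\<omega>. \<omega> i))"
    by (simp only: distr_PiM_component[OF P UNIV_I])
  also have "\<dots> = (\<integral>\<^sup>+x. g (x i) \<partial>iid P)" using g by (intro nn_integral_distr) auto
  finally show ?thesis ..
qed

lemma integral_iid_component:
  fixes g :: "'a \<Rightarrow> real"
  assumes P: "prob_space P" and g: "g \<in> borel_measurable P"
  shows "(\<integral>x. g (x i) \<partial>iid P) = (\<integral>x. g x \<partial>P)"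
proof -
  have "(\<integral>x. g x \<partial>P) = (\<integral>x. g x \<partial>distr (iid P) P (\<lambda>\<omega>. \<omega> i))"
    by (simp only: distr_PiM_component[OF P UNIV_I])
  also have "\<dots> = (\<integral>x. g (x i) \<partial>iid P)" using g by (intro integral_distr) auto
  finally show ?thesis ..
qed

lemma measurable_prM: "prM M \<in> measurable (Xinf N) (XM M N)"
  unfolding prM_def[abs_def] by (rule measurable_restrict_subset) simp

lemma distr_iid_prM:
  assumes "P \<in> probs N" shows "distr (iid P) (XM M N) (prM M) = XM M P"
proof -
  have P: "prob_space P" "sets P = sets N" using assms by (auto simp: probs_def)
  have "distr (iid P) (XM M N) (prM M) = distr (iid P) (XM M P) (\<lambda>x. restrict x {..<M})"
    using P(2) by (intro distr_cong sets_PiM_cong) (auto simp: prM_def)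
  then show ?thesis by (simp add: distr_iid_restrict[OF P(1)])
qed

text \<open>The superlevel set of the sum is the union over all levels s between
  \<open>t - g p\<close> and \<open>f p\<close>.\<close>

lemma open_less_add:
  fixes f g :: "'b::topological_space \<Rightarrow> real"
  assumes "\<And>t. open {p. t < f p}" "\<And>t. open {p. t < g p}"
  shows "open {p. t < f p + g p}"
proof -
  have "{p. t < f p + g p} = (\<Union>s. {p. s < f p} \<inter> {p. t - s < g p})"
  proof (intro set_eqI iffI)
    fix p assume "p \<in> {p. t < f p + g p}"
    then have "t - g p < f p" by simp
    then obtain s where "t - g p < s" "s < f p" using dense by blast
    then show "p \<in> (\<Union>s. {p. s < f p} \<inter> {p. t - s < g p})" by (intro UN_I[of s]) auto
  qed auto
  then show ?thesis using assms by (simp only:) (intro open_UN ballI open_Int)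
qed

text \<open>The cost is read on whole sequences, which form a Polish space, so that duality is
  available for it.\<close>

lemma lsc_cost_costM:
  fixes c :: "'a::topological_space \<Rightarrow> 'a \<Rightarrow> real"
  assumes "lsc_cost c" shows "lsc_cost (costM M c)"
proof -
  have "open {p :: (nat \<Rightarrow> 'a) \<times> (nat \<Rightarrow> 'a). t < (\<Sum>i<M. c (fst p i) (snd p i))}" for t
  proof (induction M arbitrary: t)
    case (Suc M)
    have "open {p :: (nat \<Rightarrow> 'a) \<times> (nat \<Rightarrow> 'a). t < c (fst p M) (snd p M)}" for t
    proof -
      have "continuous_on UNIV (\<lambda>p :: (nat \<Rightarrow> 'a) \<times> (nat \<Rightarrow> 'a). (fst p M, snd p M))"
        by (intro continuous_on_Pair continuous_on_compose2[OF continuous_on_product_coordinates continuous_on_fst]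
            continuous_on_compose2[OF continuous_on_product_coordinates continuous_on_snd]) (auto intro: continuous_on_id)
      then have "open ((\<lambda>p :: (nat \<Rightarrow> 'a) \<times> (nat \<Rightarrow> 'a). (fst p M, snd p M)) -` {q. t < c (fst q) (snd q)})"
        using assms by (intro open_vimage) (auto simp: lsc_cost_def)
      then show ?thesis by (simp add: vimage_def)
    qed
    then show ?case using open_less_add[OF Suc.IH] by simp
  qed simp
  then show ?thesis by (simp add: lsc_cost_def costM_def)
qed

lemma probs_Xinf: "probs (Xinf (borel :: 'a::second_countable_topology measure)) = probs borel"
  by (simp add: probs_def sets_Xinf)

lemma sets_Xinf_pair:
  "sets (Xinf (borel :: 'a::second_countable_topology measure) \<Otimes>\<^sub>M Xinf (borel :: 'a measure)) = sets (borel \<Otimes>\<^sub>M borel)"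
  by (rule sets_pair_measure_cong[OF sets_Xinf sets_Xinf])

text \<open>On sequences the product and the Borel sigma-algebra agree. Duality speaks of the
  latter, product measures and projections of the former.\<close>

lemma couplings_Xinf: "couplings (Xinf (borel :: 'a::second_countable_topology measure)) = couplings borel"
  unfolding couplings_def sets_Xinf_pair
  by (intro ext) (simp add: distr_cong[OF refl sets_Xinf refl])

text \<open>Independent copies of a coupling of P and Q couple the two i.i.d. laws, at M times its
  cost.\<close>

lemma Wc_iid_le:
  fixes c :: "'a::polish_space \<Rightarrow> 'a \<Rightarrow> real"
  assumes lsc: "lsc_cost c" and nonneg: "\<And>x y. 0 \<le> c x y" and M: "0 < M"
  shows "Wc borel (costM M c) (iid P) (iid Q) \<le> ennreal M * Wc borel c P Q"
proof (rule ennreal_le_epsilon)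
  fix e :: real assume fin: "ennreal M * Wc borel c P Q < top" and e: "0 < e"
  have *: "Wc borel (costM M c) (iid P) (iid Q) \<le> ennreal M * (\<integral>\<^sup>+z. ennreal (c (fst z) (snd z)) \<partial>\<pi>)"
    if \<pi>: "\<pi> \<in> couplings borel P Q" for \<pi>
  proof -
    have p\<pi>: "prob_space \<pi>" and s\<pi>[measurable_cong]: "sets \<pi> = sets (borel \<Otimes>\<^sub>M borel)"
      and P: "distr \<pi> borel fst = P" and Q: "distr \<pi> borel snd = Q"
      using \<pi> by (auto simp: couplings_def)
    have m1: "(\<lambda>\<omega> i. fst (\<omega> i)) \<in> measurable (iid \<pi>) (Xinf borel)"
      and m2: "(\<lambda>\<omega> i. snd (\<omega> i)) \<in> measurable (iid \<pi>) (Xinf borel)"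
      by (rule measurable_PiM_single'; auto simp: space_PiM)+
    let ?T = "\<lambda>\<omega>. (\<lambda>i. fst (\<omega> i), \<lambda>i. snd (\<omega> i))"
    have mT: "?T \<in> measurable (iid \<pi>) (Xinf borel \<Otimes>\<^sub>M Xinf borel)" using m1 m2 by measurable
    let ?\<Pi> = "distr (iid \<pi>) (Xinf borel \<Otimes>\<^sub>M Xinf borel) ?T"
    have "distr ?\<Pi> (Xinf borel) fst = iid (distr \<pi> borel fst)"
      using mT distr_iid[OF p\<pi>, of fst borel] by (subst distr_distr) (auto simp: comp_def)
    moreover have "distr ?\<Pi> (Xinf borel) snd = iid (distr \<pi> borel snd)"
      using mT distr_iid[OF p\<pi>, of snd borel] by (subst distr_distr) (auto simp: comp_def)
    ultimately have "?\<Pi> \<in> couplings (Xinf borel) (iid P) (iid Q)"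
      unfolding couplings_def P Q using mT by (auto intro!: prob_space.prob_space_distr prob_space_iid p\<pi>)
    then have "Wc borel (costM M c) (iid P) (iid Q) \<le> (\<integral>\<^sup>+z. ennreal (costM M c (fst z) (snd z)) \<partial>?\<Pi>)"
      unfolding couplings_Xinf Wc_def by (rule INF_lower)
    also have "\<dots> = (\<integral>\<^sup>+\<omega>. ennreal (costM M c (\<lambda>i. fst (\<omega> i)) (\<lambda>i. snd (\<omega> i))) \<partial>iid \<pi>)"
    proof (subst nn_integral_distr[OF mT])
      show "(\<lambda>z. ennreal (costM M c (fst z) (snd z))) \<in> borel_measurable (distr (iid \<pi>) (Xinf borel \<Otimes>\<^sub>M Xinf borel) ?T)"
        using lsc_cost_measurable[OF lsc_cost_costM[OF lsc, of M]]
        by (subst measurable_cong_sets[of _ "borel \<Otimes>\<^sub>M borel"]) (auto simp: sets_Xinf_pair)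
    qed simp
    also have "\<dots> = (\<Sum>i<M. \<integral>\<^sup>+\<omega>. ennreal (c (fst (\<omega> i)) (snd (\<omega> i))) \<partial>iid \<pi>)"
      unfolding costM_def using nonneg lsc_cost_measurable[OF lsc]
      by (subst nn_integral_sum[symmetric]) (auto simp: sum_ennreal)
    also have "\<dots> = (\<Sum>i<M. \<integral>\<^sup>+z. ennreal (c (fst z) (snd z)) \<partial>\<pi>)"
      using lsc_cost_measurable[OF lsc] by (intro sum.cong refl nn_integral_iid_component p\<pi>) measurable
    also have "\<dots> = ennreal M * (\<integral>\<^sup>+z. ennreal (c (fst z) (snd z)) \<partial>\<pi>)"
      by (simp add: ennreal_of_nat_eq_real_of_nat)
    finally show ?thesis .
  qed
  show "Wc borel (costM M c) (iid P) (iid Q) \<le> ennreal M * Wc borel c P Q + ennreal e"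
  proof -
    have "Wc borel c P Q < top" using fin M by (auto simp: ennreal_mult_less_top)
    then obtain w where w: "0 \<le> w" "Wc borel c P Q = ennreal w" by (cases "Wc borel c P Q") auto
    \<comment> \<open>A slack of e / M per coordinate adds up to e.\<close>
    then have "Wc borel c P Q < ennreal (w + e / M)" using e M by (simp add: ennreal_lessI)
    then obtain \<pi> where \<pi>: "\<pi> \<in> couplings borel P Q"
      and lt: "(\<integral>\<^sup>+z. ennreal (c (fst z) (snd z)) \<partial>\<pi>) < ennreal (w + e / M)"
      unfolding Wc_def INF_less_iff by blast
    have "Wc borel (costM M c) (iid P) (iid Q) \<le> ennreal M * ennreal (w + e / M)"
      by (rule order_trans[OF *[OF \<pi>] mult_left_mono[OF less_imp_le[OF lt]]]) simp
    also have "\<dots> = ennreal M * Wc borel c P Q + ennreal e"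
      using M w e by (simp add: field_simps flip: ennreal_mult ennreal_plus)
    finally show ?thesis .
  qed
qed

lemma Wc_measurable:
  fixes c :: "'a::polish_space \<Rightarrow> 'a \<Rightarrow> real"
  assumes lsc: "lsc_cost c" and nonneg: "\<And>x y. 0 \<le> c x y" and R: "R \<in> probs borel"
  shows "(\<lambda>P. Wc borel c R P) \<in> borel_measurable (prob_algebra borel)"
proof -
  obtain \<phi> \<psi> :: "nat \<Rightarrow> 'a \<Rightarrow> real" where
    d: "\<And>m. \<psi> m \<in> borel_measurable borel"
    "\<And>P Q. P \<in> probs borel \<Longrightarrow> Q \<in> probs borel \<Longrightarrow>
      Wc borel c P Q = (SUP m. ennreal ((\<integral>x. \<phi> m x \<partial>P) + (\<integral>y. \<psi> m y \<partial>Q)))"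
    using Wc_eq_SUP[OF lsc nonneg] by metis
  have "(\<lambda>P. \<integral>y. \<psi> m y \<partial>P) \<in> borel_measurable (prob_algebra borel)" for m
    unfolding prob_algebra_def by (intro measurable_restrict_space1 integral_measurable_subprob_algebra d)
  then have "(\<lambda>P. SUP m. ennreal ((\<integral>x. \<phi> m x \<partial>R) + (\<integral>y. \<psi> m y \<partial>P))) \<in> borel_measurable (prob_algebra borel)"
    by (intro borel_measurable_SUP measurable_compose[OF _ measurable_ennreal] borel_measurable_add measurable_const) auto
  then show ?thesis
    by (subst measurable_cong) (auto simp: space_prob_algebra_probs d(2)[OF R])
qed

text \<open>\<open>costM M\<close> reads only the first M coordinates, so pushing both components of
  a coupling through \<open>prM\<close> leaves its cost unchanged.\<close>

lemma Wc_distr_prM_le: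
  fixes c :: "'a::polish_space \<Rightarrow> 'a \<Rightarrow> real"
  assumes lsc: "lsc_cost c"
  shows "Wc (XM M borel) (costM M c) (distr P (XM M borel) (prM M)) (distr Q (XM M borel) (prM M))
    \<le> Wc borel (costM M c) P Q"
  unfolding Wc_def[of borel] couplings_Xinf[symmetric]
proof (rule INF_greatest)
  fix \<pi> assume \<pi>: "\<pi> \<in> couplings (Xinf borel) P Q"
  have p\<pi>: "prob_space \<pi>" and s\<pi>[measurable_cong]: "sets \<pi> = sets (Xinf borel \<Otimes>\<^sub>M Xinf borel)"
    and P: "P = distr \<pi> (Xinf borel) fst" and Q: "Q = distr \<pi> (Xinf borel) snd"
    using \<pi> by (auto simp: couplings_def)
  note [measurable] = measurable_prM
  let ?X = "XM M (borel :: 'a measure)"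
  let ?T = "\<lambda>z. (prM M (fst z), prM M (snd z))"
  have mT: "?T \<in> measurable \<pi> (?X \<Otimes>\<^sub>M ?X)" by measurable
  let ?\<Pi> = "distr \<pi> (?X \<Otimes>\<^sub>M ?X) ?T"
  have "?\<Pi> \<in> couplings ?X (distr P ?X (prM M)) (distr Q ?X (prM M))"
    unfolding couplings_def P Q
    by (auto simp: distr_distr comp_def intro!: prob_space.prob_space_distr p\<pi>)
  then have "Wc ?X (costM M c) (distr P ?X (prM M)) (distr Q ?X (prM M))
    \<le> (\<integral>\<^sup>+z. ennreal (costM M c (fst z) (snd z)) \<partial>?\<Pi>)"
    unfolding Wc_def by (rule INF_lower)
  also have "\<dots> = (\<integral>\<^sup>+z. ennreal (costM M c (prM M (fst z)) (prM M (snd z))) \<partial>\<pi>)"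
  proof (subst nn_integral_distr[OF mT])
    have "(\<lambda>z. c (fst z i) (snd z i)) \<in> borel_measurable (?X \<Otimes>\<^sub>M ?X)" if "i < M" for i
    proof -
      have "(\<lambda>z. (fst z i, snd z i)) \<in> measurable (?X \<Otimes>\<^sub>M ?X) (borel \<Otimes>\<^sub>M borel)"
        using that by (intro measurable_Pair measurable_compose[OF measurable_fst measurable_component_singleton]
            measurable_compose[OF measurable_snd measurable_component_singleton]) auto
      from measurable_compose[OF this lsc_cost_measurable[OF lsc]] show ?thesis by simp
    qed
    then show "(\<lambda>z. ennreal (costM M c (fst z) (snd z))) \<in> borel_measurable ?\<Pi>"
      unfolding costM_def by simp
  qed simp
  also have "\<dots> = (\<integral>\<^sup>+z. ennreal (costM M c (fst z) (snd z)) \<partial>\<pi>)"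
    by (simp add: costM_def prM_def)
  finally show "Wc ?X (costM M c) (distr P ?X (prM M)) (distr Q ?X (prM M))
    \<le> (\<integral>\<^sup>+z. ennreal (costM M c (fst z) (snd z)) \<partial>\<pi>)" .
qed

lemma hmax_diff: "\<bar>hmax (\<lambda>_. 1) n u - hmax (\<lambda>_. 1) n v\<bar> \<le> (\<Sum>m<n. \<bar>u m - v m\<bar>)"
proof (induction n)
  case (Suc n)
  have "\<bar>max a b - max a' b'\<bar> \<le> \<bar>a - a'\<bar> + \<bar>b - b'\<bar>" for a a' b b' :: real by linarith
  from this[of "hmax (\<lambda>_. 1) n u" "u n" "hmax (\<lambda>_. 1) n v" "v n"] Suc show ?case by simp
qed simp

lemma hmax_zero: "hmax (\<lambda>_. 1) n (\<lambda>_. 0) = 0"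
  by (induction n) auto

lemma abs_hmax_le_sum: "\<bar>hmax (\<lambda>_. 1) n u\<bar> \<le> (\<Sum>m<n. \<bar>u m\<bar>)"
  using hmax_diff[of n u "\<lambda>_. 0"] by (simp add: hmax_zero)

text \<open>Duality replaces a measurable choice of couplings: a dual value is affine in the first
  measure, hence an average over the mixing measure of dual values at i.i.d. laws, and each of these
  is at most a transport cost. The moment condition comes from integrating
  \<open>moment_le_Wc\<close>.\<close>

lemma marginals_in_ball_if_mixture:
  fixes c :: "'a::polish_space \<Rightarrow> 'a \<Rightarrow> real"
  assumes c: "proper_cost c" and \<rho>: "0 < \<rho>" and Phat: "Phat \<in> Pc borel c"
    and \<nu>: "\<nu> \<in> space (prob_algebra (prob_algebra borel))"
    and le: "(\<integral>\<^sup>+P. Wc borel c Phat P \<partial>\<nu>) \<le> ennreal \<rho>" and M: "1 \<le> M"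
  shows "distr (mix_iid \<nu>) (XM M borel) (prM M) \<in> Wball (XM M borel) (costM M c) (real M * \<rho>) (XM M Phat)"
proof -
  note lsc = proper_costD(1)[OF c] and nonneg = proper_costD(2)[OF c]
  have Php: "Phat \<in> probs borel" using Phat by (simp add: Pc_def)
  have s\<nu>[measurable_cong]: "sets \<nu> = sets (prob_algebra borel)" and p\<nu>: "prob_space \<nu>" using \<nu> by (auto simp: space_prob_algebra)
  interpret \<nu>: prob_space \<nu> by (rule p\<nu>)
  have sp: "space \<nu> = probs borel" using sets_eq_imp_space_eq[OF s\<nu>] by (simp add: space_prob_algebra_probs)
  have Wm[measurable]: "(\<lambda>P. Wc borel c Phat P) \<in> borel_measurable \<nu>"
    using Wc_measurable[OF lsc nonneg Php] by (simp add: measurable_cong_sets[OF s\<nu> refl])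
  let ?Q = "mix_iid \<nu>" and ?X = "XM M (borel :: 'a measure)"
  have Qp: "?Q \<in> probs (Xinf borel)" by (rule mix_iid_probs[OF \<nu>])
  then have pQ: "prob_space ?Q" and sQ[measurable_cong]: "sets ?Q = sets (Xinf borel)" by (auto simp: probs_def)
  have mpr: "prM M \<in> measurable ?Q ?X"
    using measurable_prM by (simp add: measurable_cong_sets[OF sQ refl])
  let ?QM = "distr ?Q ?X (prM M)"
  have QMp: "?QM \<in> probs ?X" using prob_space.prob_space_distr[OF pQ mpr] by (simp add: probs_def)
  have M0: "0 < M" using M by simp
  have iid_p: "iid P \<in> probs borel" if "P \<in> probs borel" for P :: "'a measure"
    using iid_Psym[OF that] by (simp add: Psym_def probs_Xinf)
  have "?QM \<in> Pc ?X (costM M c)"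
  proof -
    obtain K where K: "0 < K" "\<And>x y z. c x y \<le> K * (c x z + c z y)" using proper_costD(5)[OF c] by blast
    obtain x0 where x0: "(\<integral>\<^sup>+x. ennreal (c x0 x) \<partial>Phat) < \<infinity>" using Phat by (auto simp: Pc_def)
    \<comment> \<open>Points of \<open>XM M\<close> are undefined outside \<open>{..<M}\<close>, so
      the constant base point has to be restricted.\<close>
    define y0 where "y0 = restrict (\<lambda>_. x0) {..<M}"
    have [measurable]: "c x \<in> borel_measurable borel" for x by (rule measurable_cost[OF lsc])
    have "(\<integral>\<^sup>+y. ennreal (costM M c y0 y) \<partial>?QM) = (\<integral>\<^sup>+x. ennreal (costM M c y0 (prM M x)) \<partial>?Q)"
    proof (rule nn_integral_distr[OF mpr])
      show "(\<lambda>y. ennreal (costM M c y0 y)) \<in> borel_measurable ?QM"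
        unfolding costM_def measurable_distr_eq1 by (intro measurable_compose[OF _ measurable_ennreal] borel_measurable_sum
          measurable_compose[OF measurable_component_singleton]) auto
    qed
    also have "\<dots> = (\<integral>\<^sup>+x. (\<Sum>i<M. ennreal (c x0 (x i))) \<partial>?Q)"
      using nonneg by (intro nn_integral_cong) (simp add: costM_def prM_def y0_def sum_ennreal)
    also have "\<dots> = (\<integral>\<^sup>+P. (\<integral>\<^sup>+x. (\<Sum>i<M. ennreal (c x0 (x i))) \<partial>iid P) \<partial>\<nu>)"
      by (rule nn_integral_mix_iid[OF \<nu>]) measurable
    also have "\<dots> \<le> (\<integral>\<^sup>+P. ennreal (M * K) * ((\<integral>\<^sup>+x. ennreal (c x0 x) \<partial>Phat) + (Wc borel c Phat P + 1)) \<partial>\<nu>)"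
    proof (rule nn_integral_mono)
      fix P assume "P \<in> space \<nu>"
      then have P: "prob_space P" and sP[measurable_cong]: "sets P = sets borel" by (auto simp: sp probs_def)
      have siP[measurable_cong]: "sets (iid P) = sets (iid borel)" by (rule sets_iid[OF sP])
      have "(\<integral>\<^sup>+x. (\<Sum>i<M. ennreal (c x0 (x i))) \<partial>iid P) = (\<Sum>i<M. \<integral>\<^sup>+x. ennreal (c x0 (x i)) \<partial>iid P)"
        by (rule nn_integral_sum) measurable
      also have "\<dots> = (\<Sum>i<M. \<integral>\<^sup>+x. ennreal (c x0 x) \<partial>P)"
        by (intro sum.cong refl nn_integral_iid_component P) measurable
      also have "\<dots> = ennreal M * (\<integral>\<^sup>+x. ennreal (c x0 x) \<partial>P)" by (simp add: ennreal_of_nat_eq_real_of_nat)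
      also have "\<dots> \<le> ennreal M * (ennreal K * ((\<integral>\<^sup>+x. ennreal (c x0 x) \<partial>Phat) + (Wc borel c Phat P + 1)))"
        by (intro mult_left_mono moment_le_Wc[OF lsc nonneg K]) simp
      finally show "(\<integral>\<^sup>+x. (\<Sum>i<M. ennreal (c x0 (x i))) \<partial>iid P)
        \<le> ennreal (M * K) * ((\<integral>\<^sup>+x. ennreal (c x0 x) \<partial>Phat) + (Wc borel c Phat P + 1))"
        using K(1) by (simp add: ennreal_mult mult.assoc)
    qed
    also have "\<dots> = ennreal (M * K) * ((\<integral>\<^sup>+x. ennreal (c x0 x) \<partial>Phat) + ((\<integral>\<^sup>+P. Wc borel c Phat P \<partial>\<nu>) + 1))"
      by (simp add: nn_integral_cmult nn_integral_add \<nu>.emeasure_space_1)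
    also have "\<dots> < \<infinity>"
    proof -
      have "(\<integral>\<^sup>+P. Wc borel c Phat P \<partial>\<nu>) < \<infinity>" using le by (rule le_less_trans) simp
      then show ?thesis using x0 by (simp add: ennreal_mult_eq_top_iff flip: less_top)
    qed
    finally have "(\<integral>\<^sup>+y. ennreal (costM M c y0 y) \<partial>?QM) < \<infinity>" .
    moreover have "y0 \<in> space ?X" by (simp add: y0_def space_PiM)
    ultimately show ?thesis using QMp unfolding Pc_def by blast
  qed
  moreover have "Wc ?X (costM M c) ?QM (XM M Phat) \<le> ennreal (real M * \<rho>)"
  proof -
    obtain \<phi> \<psi> :: "nat \<Rightarrow> (nat \<Rightarrow> 'a) \<Rightarrow> real" where
      d: "\<And>m. \<phi> m \<in> borel_measurable borel" "\<And>m. \<psi> m \<in> borel_measurable borel"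
      "\<And>m. \<exists>B. \<forall>x. \<bar>\<phi> m x\<bar> \<le> B \<and> \<bar>\<psi> m x\<bar> \<le> B"
      "\<And>P Q. P \<in> probs borel \<Longrightarrow> Q \<in> probs borel \<Longrightarrow>
        Wc borel (costM M c) P Q = (SUP m. ennreal ((\<integral>x. \<phi> m x \<partial>P) + (\<integral>y. \<psi> m y \<partial>Q)))"
    proof (rule Wc_eq_SUP[of "costM M c"])
      show "lsc_cost (costM M c)" by (rule lsc_cost_costM[OF lsc])
      show "0 \<le> costM M c x y" for x y unfolding costM_def by (intro sum_nonneg nonneg)
    qed blast
    have Qb: "?Q \<in> probs borel" using Qp by (simp add: probs_Xinf)
    \<comment> \<open>The bound is proved for whole sequences; the projection cannot raise the
      cost.\<close>
    have "Wc borel (costM M c) ?Q (iid Phat) \<le> ennreal (real M * \<rho>)"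
      unfolding d(4)[OF Qb iid_p[OF Php]]
    proof (rule SUP_least)
      fix m
      obtain B where B: "\<And>x. \<bar>\<phi> m x\<bar> \<le> B" using d(3)[of m] by blast
      have fm: "\<phi> m \<in> borel_measurable (Xinf borel)" using d(1) by (simp add: measurable_Xinf_iff)
      have int: "integrable \<nu> (\<lambda>P. \<integral>x. \<phi> m x \<partial>iid P)"
      proof (rule \<nu>.integrable_const_bound[where B = B])
        show "(\<lambda>P. \<integral>x. \<phi> m x \<partial>iid P) \<in> borel_measurable \<nu>"
          unfolding measurable_cong_sets[OF s\<nu> refl] by (rule measurable_integral_iid[OF fm])
        show "AE P in \<nu>. norm (\<integral>x. \<phi> m x \<partial>iid P) \<le> B"
        proof (rule AE_I2)
          fix P assume "P \<in> space \<nu>"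
          then have iP: "iid P \<in> probs borel" using iid_p by (simp add: sp)
          then interpret I: prob_space "iid P" by (simp add: probs_def)
          show "norm (\<integral>x. \<phi> m x \<partial>iid P) \<le> B"
            using I.abs_integral_bounded[of "\<phi> m" B] B d(1) iP by (simp add: probs_def cong: measurable_cong_sets)
        qed
      qed
      let ?b = "\<integral>y. \<psi> m y \<partial>iid Phat"
      have "(\<integral>x. \<phi> m x \<partial>?Q) + ?b = (\<integral>P. (\<integral>x. \<phi> m x \<partial>iid P) + ?b \<partial>\<nu>)"
        using int by (simp add: integral_mix_iid[OF \<nu> fm B] \<nu>.prob_space)
      also have "ennreal \<dots> \<le> (\<integral>\<^sup>+P. ennreal ((\<integral>x. \<phi> m x \<partial>iid P) + ?b) \<partial>\<nu>)"
        using int by (intro ennreal_integral_le) auto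
      also have "\<dots> \<le> (\<integral>\<^sup>+P. ennreal M * Wc borel c Phat P \<partial>\<nu>)"
      proof (rule nn_integral_mono)
        fix P assume "P \<in> space \<nu>"
        then have P: "P \<in> probs borel" by (simp add: sp)
        have "ennreal ((\<integral>x. \<phi> m x \<partial>iid P) + ?b) \<le> Wc borel (costM M c) (iid P) (iid Phat)"
          unfolding d(4)[OF iid_p[OF P] iid_p[OF Php]] by (rule SUP_upper) simp
        also have "\<dots> \<le> ennreal M * Wc borel c P Phat" by (rule Wc_iid_le[OF lsc nonneg M0])
        also have "Wc borel c P Phat = Wc borel c Phat P"
          by (rule Wc_sym[OF lsc]) (rule proper_costD(3)[OF c])
        finally show "ennreal ((\<integral>x. \<phi> m x \<partial>iid P) + ?b) \<le> ennreal M * Wc borel c Phat P" .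
      qed
      also have "\<dots> = ennreal M * (\<integral>\<^sup>+P. Wc borel c Phat P \<partial>\<nu>)" by (rule nn_integral_cmult) measurable
      also have "\<dots> \<le> ennreal M * ennreal \<rho>" using le by (rule mult_left_mono) simp
      finally show "ennreal ((\<integral>x. \<phi> m x \<partial>?Q) + ?b) \<le> ennreal (real M * \<rho>)" using \<rho> by (simp add: ennreal_mult)
    qed
    with Wc_distr_prM_le[OF lsc, of M ?Q "iid Phat"] show ?thesis
      unfolding distr_iid_prM[OF Php] by (rule order_trans)
  qed
  ultimately show ?thesis by (simp add: Wball_def)
qed

text \<open>Uncorrelated terms with common second moment v give their average the second moment v /
  n, and the first absolute moment follows by weighted means.\<close>

lemma (in prob_space) expectation_abs_avg_le:
  fixes f :: "nat \<Rightarrow> 'a \<Rightarrow> real"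
  assumes [measurable]: "\<And>i. f i \<in> borel_measurable M" and B: "\<And>i x. \<bar>f i x\<bar> \<le> B"
    and diag: "\<And>i. (\<integral>x. f i x * f i x \<partial>M) = v" and off: "\<And>i j. i \<noteq> j \<Longrightarrow> (\<integral>x. f i x * f j x \<partial>M) = 0"
    and n: "0 < n"
  shows "(\<integral>x. \<bar>(\<Sum>i<n. f i x) / n\<bar> \<partial>M) \<le> (B^2 + 1) / sqrt n"
proof -
  define d where "d x = (\<Sum>i<n. (1 / n) * f i x)" for x
  have d_eq: "(\<Sum>i<n. f i x) / n = d x" for x by (simp add: d_def sum_divide_distrib)
  have d_bd: "\<bar>d x\<bar> \<le> B" for x
  proof -
    have "\<bar>\<Sum>i<n. f i x\<bar> \<le> (\<Sum>i<n. B)" by (rule order_trans[OF sum_abs sum_mono]) (rule B)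
    then show ?thesis using n unfolding d_eq[symmetric] by (simp add: abs_divide pos_divide_le_eq mult.commute)
  qed
  have [measurable]: "d \<in> borel_measurable M" unfolding d_def by measurable
  have int1: "integrable M d" by (rule integrable_bounded[OF _ d_bd]) measurable
  have int2: "integrable M (\<lambda>x. (d x)^2)"
  proof (rule integrable_bounded)
    show "\<bar>(d x)^2\<bar> \<le> B^2" for x using d_bd[of x] by (simp add: abs_le_square_iff[symmetric])
  qed measurable
  have "v \<le> B^2"
  proof -
    have "f 0 x * f 0 x \<le> B^2" "\<bar>f 0 x * f 0 x\<bar> \<le> B^2" for x
      using B[of 0 x] by (simp_all add: power2_eq_square[symmetric] abs_le_square_iff[symmetric])
    then show ?thesis unfolding diag[of 0, symmetric]
      by (intro integral_le_const integrable_bounded[where B = "B^2"]) auto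
  qed
  have "(\<integral>x. (d x)^2 \<partial>M) = (v - 0) * (\<Sum>i<n. (1 / n)^2) + 0 * (\<Sum>i<n. 1 / n)^2"
    unfolding d_def by (rule expectation_square_combination[OF _ _ B diag off]) auto
  also have "\<dots> = v / n" using n by (simp add: power2_eq_square)
  finally have sq: "(\<integral>x. (d x)^2 \<partial>M) \<le> B^2 / n" using \<open>v \<le> B^2\<close> n by (simp add: divide_right_mono)
  have s: "0 < sqrt n" using n by simp
  \<comment> \<open>Used with \<open>r = sqrt n\<close>, which makes both terms of order 1 / sqrt
    n.\<close>
  have amgm: "\<bar>t\<bar> \<le> r * t^2 + 1 / r" if "0 < r" for r t :: real
  proof -
    have "0 \<le> (r * \<bar>t\<bar> - 1)^2" by simp
    also have "\<dots> = r * (r * t^2) - 2 * (r * \<bar>t\<bar>) + 1" by (simp add: power2_eq_square algebra_simps)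
    finally have "r * \<bar>t\<bar> \<le> r * (r * t^2) + 1" using \<open>0 < r\<close> mult_nonneg_nonneg[of r "\<bar>t\<bar>"] by linarith
    also have "\<dots> = r * (r * t^2 + 1 / r)" using \<open>0 < r\<close> by (simp add: distrib_left)
    finally show ?thesis using \<open>0 < r\<close> by simp
  qed
  have "(\<integral>x. \<bar>d x\<bar> \<partial>M) \<le> (\<integral>x. sqrt n * (d x)^2 + 1 / sqrt n \<partial>M)"
    using int1 int2 amgm[OF s] by (intro integral_mono) auto
  also have "\<dots> = sqrt n * (\<integral>x. (d x)^2 \<partial>M) + 1 / sqrt n" using int2 by (simp add: prob_space)
  also have "\<dots> \<le> sqrt n * (B^2 / n) + 1 / sqrt n" using sq by (intro add_right_mono mult_left_mono) auto
  also have "sqrt n * (B^2 / n) = B^2 / sqrt n" using n by (simp add: field_simps)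
  finally show ?thesis by (simp add: d_eq add_divide_distrib)
qed

text \<open>Centring may double the bound, whence \<open>2 * B\<close>; distinct centred coordinates
  are uncorrelated by independence.\<close>

lemma iid_law_of_large_numbers:
  fixes g :: "'a \<Rightarrow> real"
  assumes pP: "prob_space P" and g: "g \<in> borel_measurable P" and B: "\<And>x. \<bar>g x\<bar> \<le> B" and n: "0 < n"
  shows "(\<integral>x. \<bar>(\<Sum>i<n. g (x i)) / n - (\<integral>x. g x \<partial>P)\<bar> \<partial>iid P) \<le> ((2 * B)^2 + 1) / sqrt n"
proof -
  interpret P: prob_space P by (rule pP)
  interpret I: prob_space "iid P" by (rule prob_space_iid[OF pP])
  define b where "b = (\<integral>x. g x \<partial>P)"
  define h where "h x = g x - b" for x
  have [measurable]: "h \<in> borel_measurable P" using g unfolding h_def by simp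
  have "\<bar>b\<bar> \<le> B" unfolding b_def by (rule P.abs_integral_bounded[OF g B])
  then have h_bd: "\<bar>h x\<bar> \<le> 2 * B" for x using B[of x] by (simp add: h_def)
  have hi: "integrable P h" by (rule P.integrable_bounded[OF _ h_bd]) measurable
  have h0: "(\<integral>x. h x \<partial>P) = 0"
    using P.integrable_bounded[OF g B] by (simp add: h_def b_def P.prob_space)
  have off: "(\<integral>x. h (x i) * h (x j) \<partial>iid P) = 0" if "i \<noteq> j" for i j
    using integral_iid_prod[OF pP, of "{i, j}" "\<lambda>_. h"] hi that by (simp add: h0)
  have diag: "(\<integral>x. h (x i) * h (x i) \<partial>iid P) = (\<integral>x. h x * h x \<partial>P)" for i
    by (rule integral_iid_component[OF pP, where g = "\<lambda>x. h x * h x"]) measurable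
  have "(\<integral>x. \<bar>(\<Sum>i<n. h (x i)) / n\<bar> \<partial>iid P) \<le> ((2 * B)^2 + 1) / sqrt n"
    by (rule I.expectation_abs_avg_le[OF _ h_bd diag off n]) measurable
  moreover have "(\<Sum>i<n. h (x i)) / n = (\<Sum>i<n. g (x i)) / n - b" for x
    using n by (simp add: h_def sum_subtractf diff_divide_distrib)
  ultimately show ?thesis by (simp add: b_def)
qed

text \<open>Image measures commute with the bind, and every i.i.d. law is invariant.\<close>

lemma mixture_Psym:
  fixes \<nu> :: "'a::topological_space measure measure"
  assumes \<nu>: "\<nu> \<in> space (prob_algebra (prob_algebra borel))"
  shows "mix_iid \<nu> \<in> Psym (Xinf borel)"
proof -
  have Qp: "mix_iid \<nu> \<in> probs (Xinf borel)" by (rule mix_iid_probs[OF \<nu>])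
  then have sQ: "sets (mix_iid \<nu>) = sets (Xinf borel)" by (simp add: probs_def)
  have s\<nu>: "sets \<nu> = sets (prob_algebra borel)" and p\<nu>: "prob_space \<nu>" using \<nu> by (auto simp: space_prob_algebra)
  have sp: "space \<nu> = probs borel" using sets_eq_imp_space_eq[OF s\<nu>] by (simp add: space_prob_algebra_probs)
  have m\<nu>: "iid \<in> \<nu> \<rightarrow>\<^sub>M subprob_algebra (Xinf (borel :: 'a measure))"
    using measurable_prob_algebraD[OF measurable_iid] by (simp add: measurable_cong_sets[OF s\<nu> refl])
  have "distr (mix_iid \<nu>) (Xinf borel) (\<lambda>x. x \<circ> \<sigma>) = mix_iid \<nu>" if \<sigma>: "bij \<sigma>" "finite {i. \<sigma> i \<noteq> i}" for \<sigma> :: "nat \<Rightarrow> nat"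
  proof -
    have m: "(\<lambda>x. x \<circ> \<sigma>) \<in> measurable (Xinf borel) (Xinf (borel :: 'a measure))"
      by (rule measurable_PiM_single') (auto simp: space_PiM comp_def)
    have "distr (mix_iid \<nu>) (Xinf borel) (\<lambda>x. x \<circ> \<sigma>) = \<nu> \<bind> (\<lambda>P. distr (iid P) (Xinf borel) (\<lambda>x. x \<circ> \<sigma>))"
      unfolding mix_iid_eq_bind[OF \<nu>] by (rule distr_bind[OF m\<nu> prob_space.not_empty[OF p\<nu>] m])
    also have "\<dots> = \<nu> \<bind> iid"
    proof (rule bind_cong[OF refl])
      fix P assume "P \<in> space \<nu>"
      then have "iid P \<in> Psym (Xinf borel)" by (intro iid_Psym) (simp add: sp)
      then show "distr (iid P) (Xinf borel) (\<lambda>x. x \<circ> \<sigma>) = iid P" using \<sigma> by (auto simp: Psym_def)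
    qed
    finally show ?thesis by (simp add: mix_iid_eq_bind[OF \<nu>])
  qed
  then show ?thesis using Qp by (simp add: Psym_def)
qed

text \<open>The maximum \<open>H n\<close> of n dual values is integrated as a whole. For fixed n
  its mean is bounded by letting M tend to infinity; then n tends to infinity by monotone
  convergence.\<close>

lemma mixture_if_marginals_in_ball:
  fixes c :: "'a::polish_space \<Rightarrow> 'a \<Rightarrow> real"
  assumes c: "proper_cost c" and \<rho>: "0 < \<rho>" and Phat: "Phat \<in> Pc borel c"
    and Q: "Q \<in> Psym (Xinf borel)"
    and marg: "\<And>M. 1 \<le> M \<Longrightarrow> distr Q (XM M borel) (prM M) \<in> Wball (XM M borel) (costM M c) (real M * \<rho>) (XM M Phat)"
  shows "\<exists>\<nu>. Q = mix_iid \<nu> \<and> \<nu> \<in> space (prob_algebra (prob_algebra borel))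
    \<and> (\<integral>\<^sup>+P. Wc borel c Phat P \<partial>\<nu>) \<le> ennreal \<rho>"
proof -
  note lsc = proper_costD(1)[OF c] and nonneg = proper_costD(2)[OF c]
  have Php: "Phat \<in> probs borel" using Phat by (simp add: Pc_def)
  then have pPh: "prob_space Phat" and sPh: "sets Phat = sets borel" by (auto simp: probs_def)
  obtain \<nu> where \<nu>: "\<nu> \<in> space (prob_algebra (prob_algebra borel))" and Q\<nu>: "Q = mix_iid \<nu>"
    using de_Finetti[OF Q] by blast
  have s\<nu>[measurable_cong]: "sets \<nu> = sets (prob_algebra borel)" and p\<nu>: "prob_space \<nu>" using \<nu> by (auto simp: space_prob_algebra)
  interpret \<nu>: prob_space \<nu> by (rule p\<nu>)
  have sp: "space \<nu> = probs borel" using sets_eq_imp_space_eq[OF s\<nu>] by (simp add: space_prob_algebra_probs)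
  have sQ[measurable_cong]: "sets Q = sets (Xinf borel)" using Q by (auto simp: Psym_def probs_def)
  obtain \<phi> \<psi> :: "nat \<Rightarrow> 'a \<Rightarrow> real" where
    d: "\<And>m. \<phi> m \<in> borel_measurable borel" "\<And>m. \<psi> m \<in> borel_measurable borel"
    "\<And>m. \<exists>B. \<forall>x. \<bar>\<phi> m x\<bar> \<le> B \<and> \<bar>\<psi> m x\<bar> \<le> B"
    "\<And>m x y. \<phi> m x + \<psi> m y \<le> c x y"
    "\<And>P Q. P \<in> probs borel \<Longrightarrow> Q \<in> probs borel \<Longrightarrow>
      Wc borel c P Q = (SUP m. ennreal ((\<integral>x. \<phi> m x \<partial>P) + (\<integral>y. \<psi> m y \<partial>Q)))"
    by (rule Wc_eq_SUP[OF lsc nonneg]) blast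
  note [measurable] = d(1,2)
  obtain B where B: "\<And>m x. \<bar>\<phi> m x\<bar> \<le> B m" "\<And>m x. \<bar>\<psi> m x\<bar> \<le> B m" using d(3) by metis
  define b where "b m = (\<integral>x. \<phi> m x \<partial>Phat)" for m
  define v where "v m P = b m + (\<integral>y. \<psi> m y \<partial>P)" for m P
  have b_bd: "\<bar>b m\<bar> \<le> B m" for m
    unfolding b_def by (rule prob_space.abs_integral_bounded[OF pPh _ B(1)]) (simp add: measurable_cong_sets[OF sPh refl])
  have v_bd: "\<bar>v m P\<bar> \<le> 2 * B m" if "P \<in> probs borel" for m P
  proof -
    have pP: "prob_space P" and sP: "sets P = sets borel" using that by (auto simp: probs_def)
    have "\<bar>\<integral>y. \<psi> m y \<partial>P\<bar> \<le> B m"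
      by (rule prob_space.abs_integral_bounded[OF pP _ B(2)]) (simp add: measurable_cong_sets[OF sP refl])
    then show ?thesis using b_bd[of m] by (simp add: v_def)
  qed
  have v_meas[measurable]: "v m \<in> borel_measurable \<nu>" for m
    unfolding v_def[abs_def] measurable_cong_sets[OF s\<nu> refl] prob_algebra_def
    by (intro borel_measurable_add measurable_const measurable_restrict_space1 integral_measurable_subprob_algebra d) simp
  define H where "H n P = hmax (\<lambda>_. 1) n (\<lambda>m. v m P)" for n P
  have H_meas[measurable]: "H n \<in> borel_measurable \<nu>" for n unfolding H_def[abs_def] by measurable
  have H_bd: "\<bar>H n P\<bar> \<le> (\<Sum>m<n. 2 * B m)" if "P \<in> probs borel" for n P
    unfolding H_def by (rule order_trans[OF abs_hmax_le_sum sum_mono]) (rule v_bd[OF that])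
  have H_int: "integrable \<nu> (H n)" for n
    using H_bd by (intro \<nu>.integrable_const_bound[where B = "\<Sum>m<n. 2 * B m"] AE_I2) (auto simp: sp)
  \<comment> \<open>The term 1 / M pays for an almost optimal coupling, the last one for the law of
    large numbers applied to the n first potentials.\<close>
  have key: "(\<integral>P. H n P \<partial>\<nu>) \<le> \<rho> + 1 / M + (\<Sum>m<n. (2 * B m)^2 + 1) / sqrt M" if M: "1 \<le> M" for M n :: nat
  proof -
    have M0: "0 < M" using M by simp
    let ?X = "XM M (borel :: 'a measure)"
    define A where "A m x = (\<Sum>i<M. \<psi> m (x i)) / M" for m and x :: "nat \<Rightarrow> 'a"
    define D where "D m y = (\<Sum>i<M. \<phi> m (y i)) / M" for m and y :: "nat \<Rightarrow> 'a"
    have avg_bd: "\<bar>(\<Sum>i<M. g (x i)) / M\<bar> \<le> C" if "\<And>x. \<bar>g x\<bar> \<le> C" for g :: "'a \<Rightarrow> real" and C and x :: "nat \<Rightarrow> 'a"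
    proof -
      have "\<bar>\<Sum>i<M. g (x i)\<bar> \<le> (\<Sum>i<M. C)" by (rule order_trans[OF sum_abs sum_mono]) (rule that)
      then show ?thesis using M0 by (simp add: abs_divide pos_divide_le_eq mult.commute)
    qed
    have A_bd: "\<bar>A m x\<bar> \<le> B m" and D_bd: "\<bar>D m x\<bar> \<le> B m" for m x
      unfolding A_def D_def by (rule avg_bd, rule B)+
    have meas_avg: "(\<lambda>x. (\<Sum>i<M. g (x i)) / M) \<in> borel_measurable ?X" if "g \<in> borel_measurable borel" for g :: "'a \<Rightarrow> real"
      using that by (intro borel_measurable_divide borel_measurable_sum measurable_const
        measurable_compose[OF measurable_component_singleton]) auto
    have A_m[measurable]: "A m \<in> borel_measurable ?X" and D_m[measurable]: "D m \<in> borel_measurable ?X" for m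
      unfolding A_def[abs_def] D_def[abs_def] by (intro meas_avg d)+
    have A_pr: "A m (prM M x) = A m x" and D_pr: "D m (prM M x) = D m x" for m x
      unfolding A_def D_def prM_def by simp_all
    have A_mi: "A m \<in> borel_measurable (Xinf borel)" and D_mi: "D m \<in> borel_measurable (Xinf borel)" for m
      using measurable_compose[OF measurable_prM A_m] measurable_compose[OF measurable_prM D_m] by (simp_all add: A_pr D_pr)
    have "Wc ?X (costM M c) (distr Q ?X (prM M)) (XM M Phat) \<le> ennreal (real M * \<rho>)"
      using marg[OF M] by (simp add: Wball_def)
    \<comment> \<open>A slack of 1 in the total cost makes an almost optimal coupling available and
      costs only 1 / M per coordinate.\<close>
    also have "\<dots> < ennreal (real M * \<rho> + 1)" using \<rho> by (simp add: ennreal_lessI)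
    finally obtain \<pi> where \<pi>: "\<pi> \<in> couplings ?X (distr Q ?X (prM M)) (XM M Phat)"
      and cost: "(\<integral>\<^sup>+z. ennreal (costM M c (fst z) (snd z)) \<partial>\<pi>) < ennreal (real M * \<rho> + 1)"
      unfolding Wc_def INF_less_iff by blast
    interpret \<pi>: prob_space \<pi> using \<pi> by (simp add: couplings_def)
    have s\<pi>[measurable_cong]: "sets \<pi> = sets (?X \<Otimes>\<^sub>M ?X)"
      and \<pi>1: "distr \<pi> ?X fst = distr Q ?X (prM M)" and \<pi>2: "distr \<pi> ?X snd = XM M Phat"
      using \<pi> by (auto simp: couplings_def)
    \<comment> \<open>\<open>G\<close> takes the empirical averages of \<phi> along the second
      sequence, so the dual inequality can be used coordinatewise. \<open>F\<close> takes their
      means \<open>b\<close> instead and depends on the first sequence alone.\<close>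
    define F where "F x = hmax (\<lambda>_. 1) n (\<lambda>m. b m + A m x)" for x
    define G where "G z = hmax (\<lambda>_. 1) n (\<lambda>m. D m (snd z) + A m (fst z))" for z
    have F_m[measurable]: "F \<in> borel_measurable ?X" unfolding F_def by measurable
    have G_m[measurable]: "G \<in> borel_measurable \<pi>" unfolding G_def by measurable
    have F_mi: "F \<in> borel_measurable (Xinf borel)" unfolding F_def using A_mi by measurable
    have F_bd: "\<bar>F x\<bar> \<le> (\<Sum>m<n. 2 * B m)" for x
      unfolding F_def
    proof (rule order_trans[OF abs_hmax_le_sum sum_mono])
      show "\<bar>b m + A m x\<bar> \<le> 2 * B m" for m using b_bd[of m] A_bd[of m x] by linarith
    qed
    have G_bd: "\<bar>G z\<bar> \<le> (\<Sum>m<n. 2 * B m)" for z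
      unfolding G_def
    proof (rule order_trans[OF abs_hmax_le_sum sum_mono])
      show "\<bar>D m (snd z) + A m (fst z)\<bar> \<le> 2 * B m" for m using D_bd[of m "snd z"] A_bd[of m "fst z"] by linarith
    qed
    have G_int: "integrable \<pi> G" by (rule \<pi>.integrable_bounded[OF G_m G_bd])
    have G_le: "M * G z \<le> costM M c (fst z) (snd z)" for z
    proof -
      have cost0: "0 \<le> costM M c (fst z) (snd z)" unfolding costM_def by (intro sum_nonneg nonneg)
      have "D m (snd z) + A m (fst z) \<le> costM M c (fst z) (snd z) / M" for m
      proof -
        have "D m (snd z) + A m (fst z) = (\<Sum>i<M. \<phi> m (snd z i) + \<psi> m (fst z i)) / M"
          by (simp add: D_def A_def sum.distrib add_divide_distrib)
        \<comment> \<open>The potentials \<phi> belong to \<open>Phat\<close>, which sits in the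
          second component of the coupling, so symmetry of the cost enters.\<close>
        also have "\<dots> \<le> (\<Sum>i<M. c (fst z i) (snd z i)) / M"
          using d(4) proper_costD(3)[OF c] by (intro divide_right_mono sum_mono) (metis, simp)
        finally show ?thesis by (simp add: costM_def)
      qed
      then have "G z \<le> costM M c (fst z) (snd z) / M"
        unfolding G_def using cost0 by (intro hmax_le) auto
      then show ?thesis using M0 by (simp add: field_simps)
    qed
    have "ennreal (\<integral>z. M * G z \<partial>\<pi>) \<le> (\<integral>\<^sup>+z. ennreal (M * G z) \<partial>\<pi>)"
      using G_int by (intro ennreal_integral_le) auto
    also have "\<dots> \<le> (\<integral>\<^sup>+z. ennreal (costM M c (fst z) (snd z)) \<partial>\<pi>)"
      using G_le by (intro nn_integral_mono ennreal_leI)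
    also note cost
    finally have lt: "ennreal (\<integral>z. M * G z \<partial>\<pi>) < ennreal (real M * \<rho> + 1)" .
    \<comment> \<open>Monotonicity of \<open>ennreal\<close> needs no sign condition on the
      integral, so the strict bound returns to the reals by contradiction.\<close>
    have "(\<integral>z. M * G z \<partial>\<pi>) < real M * \<rho> + 1"
    proof (rule ccontr)
      assume "\<not> (\<integral>z. M * G z \<partial>\<pi>) < real M * \<rho> + 1"
      then have "ennreal (real M * \<rho> + 1) \<le> ennreal (\<integral>z. M * G z \<partial>\<pi>)" by (intro ennreal_leI) linarith
      then show False using leD lt by blast
    qed
    then have G_cost: "(\<integral>z. G z \<partial>\<pi>) \<le> \<rho> + 1 / M" using M0 by (simp add: field_simps)
    define R where "R y = (\<Sum>m<n. \<bar>D m y - b m\<bar>)" for y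
    have R_m[measurable]: "R \<in> borel_measurable ?X" unfolding R_def by measurable
    have R_bd: "\<bar>R y\<bar> \<le> (\<Sum>m<n. 2 * B m)" for y
      unfolding R_def
    proof (rule order_trans[OF sum_abs sum_mono])
      show "\<bar>\<bar>D m y - b m\<bar>\<bar> \<le> 2 * B m" for m using D_bd[of m y] b_bd[of m] by linarith
    qed
    \<comment> \<open>Replacing averages by means inside the maximum costs at most the sum of their
      distances, a function of the second sequence alone.\<close>
    have FG: "F (fst z) \<le> G z + R (snd z)" for z
    proof -
      have "F (fst z) - G z \<le> (\<Sum>m<n. \<bar>b m + A m (fst z) - (D m (snd z) + A m (fst z))\<bar>)"
        unfolding F_def G_def using abs_le_D1[OF hmax_diff] .
      also have "\<dots> = R (snd z)" unfolding R_def by (intro sum.cong refl) (simp add: abs_minus_commute)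
      finally show ?thesis by simp
    qed
    have Fi: "integrable \<pi> (\<lambda>z. F (fst z))" by (rule \<pi>.integrable_bounded[OF _ F_bd]) measurable
    have Ri: "integrable \<pi> (\<lambda>z. R (snd z))" by (rule \<pi>.integrable_bounded[OF _ R_bd]) measurable
    have mpr: "prM M \<in> measurable Q ?X" using measurable_prM by (simp add: measurable_cong_sets[OF sQ refl])
    \<comment> \<open>Jensen's inequality for the maximum: each \<open>v m P\<close> is the mean of
      \<open>b m + A m\<close> under the i.i.d. law of P, hence at most the mean of
      \<open>F\<close>.\<close>
    have "(\<integral>P. H n P \<partial>\<nu>) \<le> (\<integral>P. (\<integral>x. F x \<partial>iid P) \<partial>\<nu>)"
    proof (rule integral_mono[OF H_int])
      show "integrable \<nu> (\<lambda>P. \<integral>x. F x \<partial>iid P)"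
      proof (rule \<nu>.integrable_const_bound[where B = "\<Sum>m<n. 2 * B m"])
        show "(\<lambda>P. \<integral>x. F x \<partial>iid P) \<in> borel_measurable \<nu>"
          unfolding measurable_cong_sets[OF s\<nu> refl] by (rule measurable_integral_iid[OF F_mi])
        show "AE P in \<nu>. norm (\<integral>x. F x \<partial>iid P) \<le> (\<Sum>m<n. 2 * B m)"
        proof (rule AE_I2)
          fix P assume "P \<in> space \<nu>"
          then have "prob_space P" and sP: "sets P = sets borel" by (auto simp: sp probs_def)
          then interpret I: prob_space "iid P" by (intro prob_space_iid)
          show "norm (\<integral>x. F x \<partial>iid P) \<le> (\<Sum>m<n. 2 * B m)"
            using I.abs_integral_bounded[of F, OF _ F_bd] F_mi by (simp add: measurable_cong_sets[OF sets_iid[OF sP] refl])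
        qed
      qed
      fix P assume "P \<in> space \<nu>"
      then have pP: "prob_space P" and sP: "sets P = sets borel" by (auto simp: sp probs_def)
      interpret I: prob_space "iid P" by (rule prob_space_iid[OF pP])
      have F_I: "integrable (iid P) F"
        using F_mi by (intro I.integrable_bounded[OF _ F_bd]) (simp add: measurable_cong_sets[OF sets_iid[OF sP] refl])
      have A_I: "integrable (iid P) (A m)" for m
        using A_mi by (intro I.integrable_bounded[OF _ A_bd]) (simp add: measurable_cong_sets[OF sets_iid[OF sP] refl])
      have v_eq: "v m P = (\<integral>x. b m + A m x \<partial>iid P)" for m
      proof -
        have \<psi>m: "\<psi> m \<in> borel_measurable P" by (simp add: measurable_cong_sets[OF sP refl])
        have "integrable (iid P) (\<lambda>x. \<psi> m (x i))" for i
          using \<psi>m B(2) by (intro I.integrable_bounded[where B = "B m"]) auto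
        then have "(\<integral>x. A m x \<partial>iid P) = (\<Sum>i<M. \<integral>x. \<psi> m (x i) \<partial>iid P) / M" unfolding A_def by simp
        also have "\<dots> = (\<integral>x. \<psi> m x \<partial>P)" using M0 by (simp add: integral_iid_component[OF pP \<psi>m])
        finally show ?thesis using A_I by (simp add: v_def I.prob_space)
      qed
      show "H n P \<le> (\<integral>x. F x \<partial>iid P)"
        unfolding H_def
      proof (rule hmax_le)
        show "0 \<le> (\<integral>x. F x \<partial>iid P)" unfolding F_def by (intro integral_nonneg_AE AE_I2 hmax_nonneg)
        fix m assume "m < n"
        then have "b m + A m x \<le> F x" for x
          unfolding F_def using hmax_ge[of m n "\<lambda>_. 1" "\<lambda>m. b m + A m x"] by simp
        then show "1 * v m P \<le> (\<integral>x. F x \<partial>iid P)"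
          unfolding v_eq using A_I F_I by (simp del: Bochner_Integration.integral_add) (intro integral_mono, auto)
      qed
    qed
    also have "\<dots> = (\<integral>x. F x \<partial>Q)" unfolding Q\<nu> by (rule integral_mix_iid[OF \<nu> F_mi F_bd, symmetric])
    also have "\<dots> = (\<integral>x. F (prM M x) \<partial>Q)" unfolding F_def A_pr ..
    also have "\<dots> = (\<integral>x. F x \<partial>distr \<pi> ?X fst)" unfolding \<pi>1 by (rule integral_distr[OF mpr F_m, symmetric])
    also have "\<dots> = (\<integral>z. F (fst z) \<partial>\<pi>)" by (rule integral_distr) measurable
    also have "\<dots> \<le> (\<integral>z. G z + R (snd z) \<partial>\<pi>)" using Fi G_int Ri FG by (intro integral_mono) auto
    also have "\<dots> = (\<integral>z. G z \<partial>\<pi>) + (\<integral>z. R (snd z) \<partial>\<pi>)" using G_int Ri by simp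
    also have "(\<integral>z. R (snd z) \<partial>\<pi>) = (\<integral>y. R y \<partial>XM M Phat)"
      unfolding \<pi>2[symmetric] by (rule integral_distr[symmetric]) measurable
    also have "\<dots> = (\<integral>y. R y \<partial>iid Phat)"
    proof -
      have "prM M \<in> measurable (iid Phat) ?X"
        using measurable_prM by (simp add: measurable_cong_sets[OF sets_iid[OF sPh] refl])
      then have "(\<integral>y. R y \<partial>distr (iid Phat) ?X (prM M)) = (\<integral>y. R (prM M y) \<partial>iid Phat)"
        by (rule integral_distr) measurable
      then show ?thesis unfolding distr_iid_prM[OF Php] R_def D_pr .
    qed
    also have "\<dots> \<le> (\<Sum>m<n. (2 * B m)^2 + 1) / sqrt M"
    proof -
      interpret I: prob_space "iid Phat" by (rule prob_space_iid[OF pPh])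
      have "integrable (iid Phat) (\<lambda>y. \<bar>D m y - b m\<bar>)" for m
      proof (rule I.integrable_bounded[where B = "2 * B m"])
        show "(\<lambda>y. \<bar>D m y - b m\<bar>) \<in> borel_measurable (iid Phat)"
          using D_mi[of m] by (simp add: measurable_cong_sets[OF sets_iid[OF sPh] refl])
        show "\<bar>\<bar>D m y - b m\<bar>\<bar> \<le> 2 * B m" for y using D_bd[of m y] b_bd[of m] by linarith
      qed
      then have "(\<integral>y. R y \<partial>iid Phat) = (\<Sum>m<n. \<integral>y. \<bar>D m y - b m\<bar> \<partial>iid Phat)"
        unfolding R_def by (rule Bochner_Integration.integral_sum)
      also have "\<dots> \<le> (\<Sum>m<n. ((2 * B m)^2 + 1) / sqrt M)"
        unfolding D_def b_def
        by (intro sum_mono iid_law_of_large_numbers[OF pPh _ B(1) M0]) (simp add: measurable_cong_sets[OF sPh refl])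
      finally show ?thesis by (simp add: sum_divide_distrib)
    qed
    finally show ?thesis using G_cost by simp
  qed
  have H_le: "(\<integral>P. H n P \<partial>\<nu>) \<le> \<rho>" for n
  proof (rule LIMSEQ_le_const)
    have "(\<lambda>M. \<rho> + 1 / real M + (\<Sum>m<n. (2 * B m)^2 + 1) / sqrt (real M)) \<longlonglongrightarrow> \<rho> + 0 + 0"
      by (intro tendsto_add tendsto_const lim_1_over_n tendsto_divide_0[OF tendsto_const]
          filterlim_at_top_imp_at_infinity filterlim_compose[OF sqrt_at_top filterlim_real_sequentially])
    then show "(\<lambda>M. \<rho> + 1 / real M + (\<Sum>m<n. (2 * B m)^2 + 1) / sqrt (real M)) \<longlonglongrightarrow> \<rho>" by simp
    show "\<exists>N. \<forall>M\<ge>N. (\<integral>P. H n P \<partial>\<nu>) \<le> \<rho> + 1 / real M + (\<Sum>m<n. (2 * B m)^2 + 1) / sqrt (real M)"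
      using key by blast
  qed
  have Hn: "(\<integral>\<^sup>+P. ennreal (H n P) \<partial>\<nu>) \<le> ennreal \<rho>" for n
  proof -
    have "0 \<le> H n P" for P by (simp add: H_def hmax_nonneg)
    then show ?thesis using H_int[of n] H_le[of n]
      by (subst nn_integral_eq_integral) (auto intro: ennreal_leI)
  qed
  \<comment> \<open>The functions \<open>H n\<close> increase in n and together dominate every dual
    value, hence the cost.\<close>
  have "(\<integral>\<^sup>+P. Wc borel c Phat P \<partial>\<nu>) \<le> (\<integral>\<^sup>+P. (SUP n. ennreal (H n P)) \<partial>\<nu>)"
  proof (rule nn_integral_mono)
    fix P assume "P \<in> space \<nu>"
    then have P: "P \<in> probs borel" by (simp add: sp)
    show "Wc borel c Phat P \<le> (SUP n. ennreal (H n P))"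
      unfolding d(5)[OF Php P]
    proof (rule SUP_least)
      fix m
      have "v m P \<le> H (Suc m) P" unfolding H_def by simp
      then show "ennreal ((\<integral>x. \<phi> m x \<partial>Phat) + (\<integral>y. \<psi> m y \<partial>P)) \<le> (SUP n. ennreal (H n P))"
        unfolding v_def b_def by (intro SUP_upper2[of "Suc m"] ennreal_leI) auto
    qed
  qed
  also have "\<dots> = (SUP n. \<integral>\<^sup>+P. ennreal (H n P) \<partial>\<nu>)"
    by (rule nn_integral_monotone_convergence_SUP) (auto simp: incseq_def le_fun_def H_def intro!: ennreal_leI hmax_mono)
  also have "\<dots> \<le> ennreal \<rho>" by (rule SUP_least) (rule Hn)
  finally show ?thesis using \<nu> Q\<nu> by blast
qed

theorem mainTheorem14:
  fixes c :: "'a::polish_space \<Rightarrow> 'a \<Rightarrow> real" and \<rho> :: real and Phat :: "'a measure"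
  assumes "proper_cost c" and "\<rho> > 0" and "Phat \<in> Pc borel c"
  shows "(closed_conv_weak (Xinf borel) {iid P | P. P \<in> Wball borel c \<rho> Phat}
           = {mix_iid \<nu> | \<nu>. \<nu> \<in> space (prob_algebra (prob_algebra (borel :: 'a measure)))
                \<and> (AE P in \<nu>. Wc borel c Phat P \<le> ennreal \<rho>)})
    \<and> ({Q \<in> Psym (Xinf borel). \<forall>M::nat. M \<ge> 1 \<longrightarrow>
            distr Q (XM M borel) (prM M) \<in> Wball (XM M borel) (costM M c) (real M * \<rho>) (XM M Phat)}
           = {mix_iid \<nu> | \<nu>. \<nu> \<in> space (prob_algebra (prob_algebra (borel :: 'a measure)))
                \<and> (\<integral>\<^sup>+ P. Wc borel c Phat P \<partial>\<nu>) \<le> ennreal \<rho>})"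
proof (intro conjI set_eqI iffI)
  fix Q assume "Q \<in> closed_conv_weak (Xinf borel) {iid P | P. P \<in> Wball borel c \<rho> Phat}"
  from mixture_if_closed_conv[OF assms this]
  show "Q \<in> {mix_iid \<nu> | \<nu>. \<nu> \<in> space (prob_algebra (prob_algebra borel)) \<and> (AE P in \<nu>. Wc borel c Phat P \<le> ennreal \<rho>)}"
    by blast
next
  fix Q assume "Q \<in> {mix_iid \<nu> | \<nu>. \<nu> \<in> space (prob_algebra (prob_algebra borel)) \<and> (AE P in \<nu>. Wc borel c Phat P \<le> ennreal \<rho>)}"
  then show "Q \<in> closed_conv_weak (Xinf borel) {iid P | P. P \<in> Wball borel c \<rho> Phat}"
    using closed_conv_if_mixture[OF assms(1,3)] by blast
next
  fix Q assume "Q \<in> {Q \<in> Psym (Xinf borel). \<forall>M::nat. M \<ge> 1 \<longrightarrow>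
    distr Q (XM M borel) (prM M) \<in> Wball (XM M borel) (costM M c) (real M * \<rho>) (XM M Phat)}"
  then have "Q \<in> Psym (Xinf borel)" "\<And>M. 1 \<le> M \<Longrightarrow>
    distr Q (XM M borel) (prM M) \<in> Wball (XM M borel) (costM M c) (real M * \<rho>) (XM M Phat)" by auto
  from mixture_if_marginals_in_ball[OF assms this]
  show "Q \<in> {mix_iid \<nu> | \<nu>. \<nu> \<in> space (prob_algebra (prob_algebra borel)) \<and> (\<integral>\<^sup>+ P. Wc borel c Phat P \<partial>\<nu>) \<le> ennreal \<rho>}"
    by blast
next
  fix Q assume "Q \<in> {mix_iid \<nu> | \<nu>. \<nu> \<in> space (prob_algebra (prob_algebra borel)) \<and> (\<integral>\<^sup>+ P. Wc borel c Phat P \<partial>\<nu>) \<le> ennreal \<rho>}"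
  then obtain \<nu> where "Q = mix_iid \<nu>" "\<nu> \<in> space (prob_algebra (prob_algebra borel))"
    "(\<integral>\<^sup>+ P. Wc borel c Phat P \<partial>\<nu>) \<le> ennreal \<rho>" by blast
  then show "Q \<in> {Q \<in> Psym (Xinf borel). \<forall>M::nat. M \<ge> 1 \<longrightarrow>
    distr Q (XM M borel) (prM M) \<in> Wball (XM M borel) (costM M c) (real M * \<rho>) (XM M Phat)}"
    using mixture_Psym marginals_in_ball_if_mixture[OF assms] by blast
qed

end
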